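(* Let $m,N\in\mathbb{N}$ with $N+1\ge m$, let $h=\frac1N$, and let $\omega\in\mathbb{R}$ with $\omega h\notin\mathbb{Z}$. Then the coefficients $\mathring{C}_\beta$ ($\beta=0,1,\dots,N$) of the optimal quadrature formula in the sense of Sard of the form $$\int_0^1 e^{2\pi i\omega x}\varphi(x)\,dx\cong\sum_{\beta=0}^N C_\beta\,\varphi(h\beta)$$ in the space $L_2^{(m)}[0,1]$ are expressed by $$\mathring{C}_0=h\left(\frac{e^{2\pi i\omega h}K_{\omega,m}}{e^{2\pi i\omega h}-1}-\frac{1}{2\pi i\omega h}+\sum_{k=1}^{m-1}\left(a_k\frac{q_k}{q_k-1}+b_k\frac{q_k^N}{1-q_k}\right)\right),$$ $$\mathring{C}_\beta=h\left(e^{2\pi i\omega h\beta}K_{\omega,m}+\sum_{k=1}^{m-1}\left(a_kq_k^\beta+b_kq_k^{N-\beta}\right)\right),\quad \beta=1,2,\dots,N-1,$$ $$\mathring{C}_N=h\left(\frac{e^{2\pi i\omega}K_{\omega,m}}{1-e^{2\pi i\omega h}}+\frac{e^{2\pi i\omega}}{2\pi i\omega h}+\sum_{k=1}^{m-1}\left(a_k\frac{q_k^N}{1-q_k}+b_k\frac{q_k}{q_k-1}\right)\right),$$ where $a_k,b_k$ ($k=1,\dots,m-1$) are defined by the following system of $2m-2$ linear equations: for $j=1,2,\dots,m-1$, $$\sum_{k=1}^{m-1}a_k\left[\sum_{t=1}^{j}\frac{q_k\Delta^t0^j}{(q_k-1)^{t+1}}\right]+\sum_{k=1}^{m-1}b_k\left[\sum_{t=1}^j\frac{q_k^{N+t}\Delta^t0^{j}}{(1-q_k)^{t+1}}\right]=\frac{j!}{(2\pi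 i\omega h)^{j+1}}-\sum_{t=1}^j\frac{e^{2\pi i\omega h}K_{\omega,m}\Delta^t0^j}{(e^{2\pi i\omega h}-1)^{t+1}},$$ and, for $j=1,2,\dots,m-1$, $$\begin{aligned} &\sum_{k=1}^{m-1}a_k\left[\sum_{t=1}^j\frac{q_k^t\Delta^t0^j}{(1-q_k)^{t+1}}-\sum_{\alpha=1}^{j}h^{\alpha-j}\binom{j}{\alpha}\sum_{t=1}^{\alpha}\frac{q_k^{N+t}\Delta^t0^{\alpha}}{(1-q_k)^{t+1}}\right]\\ &+\sum_{k=1}^{m-1}b_k\left[\sum_{t=1}^j\frac{q_k^{N+1}\Delta^t0^j}{(q_k-1)^{t+1}}-\sum_{\alpha=1}^{j}h^{\alpha-j}\binom{j}{\alpha}\sum_{t=1}^{\alpha}\frac{q_k\Delta^t0^{\alpha}}{(q_k-1)^{t+1}}\right]\\ &=\frac{(-1)^{j+1}j!}{(2\pi i\omega h)^{j+1}}+\sum_{\alpha=1}^{j}h^{\alpha-j}\frac{(-1)^{\alpha}j!\,e^{2\pi i\omega}}{(j-\alpha)!(2\pi i\omega h)^{\alpha+1}}-\frac{K_{\omega,m}}{1-e^{2\pi i\omega h}}\sum_{t=1}^j\left(\frac{e^{2\pi i\omega h}}{1-e^{2\pi i\omega h}}\right)^t\Delta^t0^j\\ &\quad+\frac{K_{\omega,m}e^{2\pi i\omega}}{1-e^{2\pi i\omega h}}\sum_{\alpha=1}^{j}h^{\alpha-j}\binom{j}{\alpha}\sum_{t=1}^{\alpha}\left(\frac{e^{2\pi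 i\omega h}}{1-e^{2\pi i\omega h}}\right)^t\Delta^t0^\alpha . \end{aligned}$$ Here $q_1,\dots,q_{m-1}$ are the roots of the Euler-Frobenius polynomial $E_{2m-2}(x)$ with $|q_k|<1$, and $$K_{\omega,m}=\left(\frac{\sin \pi\omega h}{\pi\omega h}\right)^{2m}\frac{(2m-1)!}{2\sum_{\alpha=0}^{m-2}\mathrm{a}_{\alpha}\cos[2\pi\omega h(m-1-\alpha)]+\mathrm{a}_{m-1}},$$ where $\mathrm{a}_{\alpha}=\sum_{j=0}^{\alpha}(-1)^j\binom{2m}{j}(\alpha+1-j)^{2m-1}$ are the coefficients of $E_{2m-2}(x)=\sum_{s=0}^{2m-2}\mathrm{a}_sx^s$.
   Context: $i^2=-1$. $L_2^{(m)}[a,b]$ is the Sobolev space of complex-valued functions on $[a,b]$ having an absolutely continuous $(m-1)$-th derivative on $[a,b]$ and square integrable $m$-th derivative, with inner product $\langle\varphi,\psi\rangle=\int_a^b\varphi^{(m)}(x)\overline{\psi^{(m)}(x)}\,dx$ and (semi)norm $\|\varphi\|_{L_2^{(m)}[a,b]}=\langle\varphi,\varphi\rangle^{1/2}$. For nodes $x_\beta=h\beta+a$, $h=\frac{b-a}{N}$, the error functional of a quadrature formula $\int_a^b e^{2\pi i\omega x}\varphi(x)\,dx\cong\sum_{\beta=0}^NC_\beta\varphi(x_\beta)$ (with $C_\beta\in\mathbb{C}$) is $(\ell,\varphi)=\int_a^b e^{2\pi i\omega x}\varphi(x)\,dx-\sum_{\beta=0}^NC_\beta\varphi(x_\beta)$.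 It is required that $(\ell,x^\alpha)=0$ for $\alpha=0,1,\dots,m-1$, so that $\ell$ is a bounded functional with norm $\|\ell\|_{L_2^{(m)*}[a,b]}=\sup\{|(\ell,\varphi)|:\|\varphi\|_{L_2^{(m)}[a,b]}\le1\}$. The formula is optimal in the sense of Sard, with optimal coefficients $\mathring{C}_\beta$, if these coefficients minimize $\|\ell\|_{L_2^{(m)*}[a,b]}$ over all coefficient vectors $(C_0,\dots,C_N)$ satisfying these conditions, the nodes being fixed. Here $[a,b]=[0,1]$. The Euler-Frobenius polynomials are $E_k(x)=\frac{(1-x)^{k+2}}{x}\left(x\frac{d}{dx}\right)^k\frac{x}{(1-x)^2}$, $k=0,1,2,\dots$; $E_k$ has degree $k$, its roots are real, negative and distinct, and $E_{2m-2}$ has exactly $m-1$ roots with absolute value less than $1$. $\Delta^t0^j=\sum_{l=1}^t(-1)^{t-l}\binom{t}{l}l^j$ for $t,j\ge1$. Empty sums are zero. *)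

theory Defs
  imports "HOL-Analysis.Analysis" "HOL-Computational_Algebra.Polynomial"
begin

section \<open>The Sobolev space\<close>

definition abs_continuous_on :: "real \<Rightarrow> real \<Rightarrow> (real \<Rightarrow> complex) \<Rightarrow> bool" where
  "abs_continuous_on a b f \<longleftrightarrow>
     (\<forall>\<epsilon>>0. \<exists>\<delta>>0. \<forall>(n::nat) u v.
        (\<forall>i<n. a \<le> u i \<and> u i \<le> v i \<and> v i \<le> b) \<and>
        (\<forall>i<n. \<forall>j<n. i \<noteq> j \<longrightarrow> {u i<..<v i} \<inter> {u j<..<v j} = {}) \<and>
        (\<Sum>i<n. v i - u i) < \<delta>
        \<longrightarrow> (\<Sum>i<n. norm (f (v i) - f (u i))) < \<epsilon>)"

text \<open>Derivatives are one-sided at the end points. Where the derivative does not exist the value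
  is arbitrary; for the \<open>m\<close>-th derivative of a member of the space below this happens only on a
  null set.\<close>

definition deriv_on :: "real \<Rightarrow> real \<Rightarrow> nat \<Rightarrow> (real \<Rightarrow> complex) \<Rightarrow> real \<Rightarrow> complex" where
  "deriv_on a b k = (\<lambda>f x. vector_derivative f (at x within {a..b})) ^^ k"

definition sobolev_space :: "nat \<Rightarrow> real \<Rightarrow> real \<Rightarrow> (real \<Rightarrow> complex) set" where
  "sobolev_space m a b = {\<phi>.
     (\<forall>k<m-1. \<forall>x\<in>{a..b}. deriv_on a b k \<phi> differentiable (at x within {a..b})) \<and>
     abs_continuous_on a b (deriv_on a b (m-1) \<phi>) \<and>
     set_borel_measurable lebesgue {a..b} (deriv_on a b m \<phi>) \<and>
     set_integrable lebesgue {a..b} (\<lambda>x. (cmod (deriv_on a b m \<phi> x))\<^sup>2)}"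

definition sobolev_inner ::
  "nat \<Rightarrow> real \<Rightarrow> real \<Rightarrow> (real \<Rightarrow> complex) \<Rightarrow> (real \<Rightarrow> complex) \<Rightarrow> complex" where
  "sobolev_inner m a b \<phi> \<psi> =
     (LINT x:{a..b}|lebesgue. deriv_on a b m \<phi> x * cnj (deriv_on a b m \<psi> x))"

definition sobolev_norm :: "nat \<Rightarrow> real \<Rightarrow> real \<Rightarrow> (real \<Rightarrow> complex) \<Rightarrow> real" where
  "sobolev_norm m a b \<phi> = sqrt (Re (sobolev_inner m a b \<phi> \<phi>))"

section \<open>Optimal quadrature formulas\<close>

definition error_functional ::
  "real \<Rightarrow> real \<Rightarrow> nat \<Rightarrow> real \<Rightarrow> (nat \<Rightarrow> complex) \<Rightarrow> (real \<Rightarrow> complex) \<Rightarrow> complex" where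
  "error_functional a b N \<omega> C \<phi> =
     (LINT x:{a..b}|lebesgue. exp (2 * of_real pi * \<i> * of_real \<omega> * of_real x) * \<phi> x)
     - (\<Sum>\<beta>=0..N. C \<beta> * \<phi> ((b - a) / real N * real \<beta> + a))"

definition poly_exact ::
  "nat \<Rightarrow> real \<Rightarrow> real \<Rightarrow> nat \<Rightarrow> real \<Rightarrow> (nat \<Rightarrow> complex) \<Rightarrow> bool" where
  "poly_exact m a b N \<omega> C \<longleftrightarrow>
     (\<forall>\<alpha><m. error_functional a b N \<omega> C (\<lambda>x. of_real (x ^ \<alpha>)) = 0)"

definition error_norm ::
  "nat \<Rightarrow> real \<Rightarrow> real \<Rightarrow> nat \<Rightarrow> real \<Rightarrow> (nat \<Rightarrow> complex) \<Rightarrow> ereal" where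
  "error_norm m a b N \<omega> C =
     (SUP \<phi>\<in>{\<phi> \<in> sobolev_space m a b. sobolev_norm m a b \<phi> \<le> 1}.
        ereal (cmod (error_functional a b N \<omega> C \<phi>)))"

text \<open>Only the values of \<open>C\<close> on \<open>{0..N}\<close> matter.\<close>

definition sard_optimal ::
  "nat \<Rightarrow> real \<Rightarrow> real \<Rightarrow> nat \<Rightarrow> real \<Rightarrow> (nat \<Rightarrow> complex) \<Rightarrow> bool" where
  "sard_optimal m a b N \<omega> C \<longleftrightarrow>
     poly_exact m a b N \<omega> C \<and>
     (\<forall>D. poly_exact m a b N \<omega> D \<longrightarrow> error_norm m a b N \<omega> C \<le> error_norm m a b N \<omega> D)"

section \<open>Euler-Frobenius polynomials\<close>

definition euler_frobenius_fun :: "nat \<Rightarrow> complex \<Rightarrow> complex" where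
  "euler_frobenius_fun k x =
     (1 - x) ^ (k + 2) / x * ((\<lambda>f z. z * deriv f z) ^^ k) (\<lambda>z. z / (1 - z)\<^sup>2) x"

text \<open>The defining expression has removable singularities at 0 and 1.\<close>

definition euler_frobenius :: "nat \<Rightarrow> complex poly" where
  "euler_frobenius k = (THE p. \<forall>x. x \<noteq> 0 \<longrightarrow> x \<noteq> 1 \<longrightarrow> poly p x = euler_frobenius_fun k x)"

definition ef_coeff :: "nat \<Rightarrow> nat \<Rightarrow> real" where
  "ef_coeff m \<alpha> =
     (\<Sum>j=0..\<alpha>. (- 1) ^ j * real (2 * m choose j) * real (\<alpha> + 1 - j) ^ (2 * m - 1))"

fun ef_rec :: "nat \<Rightarrow> complex poly" where
  "ef_rec 0 = 1"
| "ef_rec (Suc k) = [:1, of_nat (Suc k):] * ef_rec k + [:0, 1, -1:] * pderiv (ef_rec k)"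

lemma ef_rec_iterate:
  assumes "x \<noteq> 1"
  shows "((\<lambda>f z. z * deriv f z) ^^ k) (\<lambda>z. z / (1 - z)\<^sup>2) x
           = x * poly (ef_rec k) x / (1 - x) ^ (k + 2)"
  using assms
proof (induction k arbitrary: x)
  case 0
  show ?case by (simp add: power2_eq_square)
next
  case (Suc k)
  let ?g = "\<lambda>z. z * poly (ef_rec k) z / (1 - z) ^ (k + 2)"
  have ev: "eventually (\<lambda>z. ((\<lambda>f z. z * deriv f z) ^^ k) (\<lambda>z. z / (1 - z)\<^sup>2) z = ?g z) (nhds x)"
    by (rule eventually_mono[OF t1_space_nhds[OF Suc.prems]]) (rule Suc.IH)
  have nz: "1 - x \<noteq> 0" using Suc.prems by simp
  have "((\<lambda>z. (1 - z) ^ Suc (k + 1)) has_field_derivative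
      (1 + of_nat (k + 1)) * ((0 - 1) * (1 - x) ^ (k + 1))) (at x)"
    by (rule DERIV_power_Suc) (auto intro!: derivative_eq_intros)
  then have dp: "((\<lambda>z. (1 - z) ^ (k + 2)) has_field_derivative
      - (of_nat (k + 2) * (1 - x) ^ (k + 1))) (at x)"
    by (simp add: algebra_simps)
  have dn: "((\<lambda>z. z * poly (ef_rec k) z) has_field_derivative
      poly (ef_rec k) x + x * poly (pderiv (ef_rec k)) x) (at x)"
    by (auto intro!: derivative_eq_intros)
  have "(?g has_field_derivative
      (((poly (ef_rec k) x + x * poly (pderiv (ef_rec k)) x) * (1 - x) ^ (k + 2)
        + x * poly (ef_rec k) x * (of_nat (k + 2) * (1 - x) ^ (k + 1))) / ((1 - x) ^ (k + 2))\<^sup>2)) (at x)"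
    using DERIV_divide[OF dn dp] nz by (simp add: power2_eq_square)
  moreover have "((poly (ef_rec k) x + x * poly (pderiv (ef_rec k)) x) * (1 - x) ^ (k + 2)
        + x * poly (ef_rec k) x * (of_nat (k + 2) * (1 - x) ^ (k + 1))) / ((1 - x) ^ (k + 2))\<^sup>2
      = poly (ef_rec (Suc k)) x / (1 - x) ^ (k + 3)"
    using nz by (simp add: divide_simps power2_eq_square power_add eval_nat_numeral)
      (simp add: algebra_simps)
  ultimately have "deriv ?g x = poly (ef_rec (Suc k)) x / (1 - x) ^ (k + 3)"
    by (metis DERIV_imp_deriv)
  then show ?case
    using deriv_cong_ev[OF ev refl] by (simp add: eval_nat_numeral)
qed

lemma ef_rec_fun:
  assumes "x \<noteq> 0" "x \<noteq> 1"
  shows "poly (ef_rec k) x = euler_frobenius_fun k x"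
  using assms by (simp add: euler_frobenius_fun_def ef_rec_iterate)

lemma euler_frobenius_eq_ef_rec: "euler_frobenius k = ef_rec k"
  unfolding euler_frobenius_def
proof (rule the_equality)
  show "\<forall>x. x \<noteq> 0 \<longrightarrow> x \<noteq> 1 \<longrightarrow> poly (ef_rec k) x = euler_frobenius_fun k x"
    by (simp add: ef_rec_fun)
next
  fix p assume p: "\<forall>x. x \<noteq> 0 \<longrightarrow> x \<noteq> 1 \<longrightarrow> poly p x = euler_frobenius_fun k x"
  have "infinite (UNIV - {0, 1 :: complex})"
    by (simp add: infinite_UNIV_char_0)
  moreover have "UNIV - {0, 1} \<subseteq> {x. poly (p - ef_rec k) x = 0}"
    using p by (auto simp: ef_rec_fun)
  ultimately have "infinite {x. poly (p - ef_rec k) x = 0}"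
    using finite_subset by blast
  then show "p = ef_rec k"
    using poly_roots_finite[of "p - ef_rec k"] by auto
qed

theorem euler_frobenius:
  assumes "x \<noteq> 0" "x \<noteq> 1"
  shows "poly (euler_frobenius k) x = euler_frobenius_fun k x"
  using assms by (simp add: euler_frobenius_eq_ef_rec ef_rec_fun)

lemma coeff_ef_rec:
  "coeff (ef_rec k) s =
     (\<Sum>j=0..s. (- 1) ^ j * of_nat (k + 2 choose j) * of_nat (s + 1 - j) ^ (k + 1))"
proof (induction k arbitrary: s)
  case 0
  consider "s = 0" | "s = 1" | "s \<ge> 2" by linarith
  then show ?case
  proof cases
    case 3
    then obtain r where s: "s = r + 2" using le_Suc_ex by (metis add.commute)
    have "(\<Sum>j=0..s. (- 1) ^ j * of_nat (0 + 2 choose j) * (of_nat (s + 1 - j) :: complex) ^ (0 + 1))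
        = (\<Sum>j\<in>{0, 1, 2}. (- 1) ^ j * of_nat (0 + 2 choose j) * of_nat (s + 1 - j) ^ (0 + 1))"
      by (rule sum.mono_neutral_right) (use 3 in \<open>auto simp: binomial_eq_0\<close>)
    also have "\<dots> = 0"
      by (simp add: s eval_nat_numeral algebra_simps)
    finally show ?thesis using 3 by (simp add: coeff_eq_0)
  qed (auto simp: numeral_2_eq_2)
next
  case (Suc k)
  show ?case
  proof (cases s)
    case 0
    then show ?thesis using Suc.IH[of 0] by simp
  next
    case (Suc r)
    define c where "c j = (of_nat (k + 2 choose j) :: complex)" for j
    define y where "y j = (of_nat (r + 2 - j) :: complex)" for j
    have A: "coeff (ef_rec k) (Suc r) = (\<Sum>j=0..Suc r. (- 1) ^ j * c j * y j ^ (k + 1))"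
      by (simp add: Suc.IH c_def y_def)
    have B: "coeff (ef_rec k) r = - (\<Sum>j=1..Suc r. (- 1) ^ j * c (j - 1) * y j ^ (k + 1))"
    proof -
      have "(\<Sum>j=1..Suc r. (- 1) ^ j * c (j - 1) * y j ^ (k + 1))
          = (\<Sum>j=0..r. (- 1) ^ Suc j * c j * y (Suc j) ^ (k + 1))"
        using sum.shift_bounds_cl_Suc_ivl[of "\<lambda>j. (- 1) ^ j * c (j - 1) * y j ^ (k + 1)" 0 r]
        by simp
      then show ?thesis
        by (simp add: Suc.IH c_def y_def sum_negf)
    qed
    have R: "coeff (ef_rec (Suc k)) (Suc r)
        = of_nat (r + 2) * coeff (ef_rec k) (Suc r)
          + (of_nat (k + 1) - of_nat r) * coeff (ef_rec k) r"
      by (cases r) (simp_all add: coeff_pderiv coeff_pCons algebra_simps)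
    have T: "of_nat (k + 3 choose j) * y j
        = of_nat (r + 2) * c j - (of_nat (k + 1) - of_nat r) * c (j - 1)"
      if j: "1 \<le> j" "j \<le> Suc r" for j
    proof -
      obtain i where i: "j = Suc i" using j by (cases j) auto
      have yj: "y j = of_nat r + 1 - of_nat i"
        using j by (simp add: y_def i of_nat_diff Suc_diff_le)
      have "of_nat (Suc i * (k + 2 choose Suc i)) = (of_nat ((k + 2 - i) * (k + 2 choose i)) :: complex)"
        using binomial_absorb_comp[of "k + 2" i] binomial_absorption[of i "k + 2"]
        by (metis Suc_times_binomial_add binomial_absorb_comp binomial_absorption diff_Suc_1)
      moreover have "of_nat ((k + 2 - i) * (k + 2 choose i))
          = (of_nat (k + 2) - of_nat i) * (of_nat (k + 2 choose i) :: complex)"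
        by (cases "i \<le> k + 2") (auto simp: of_nat_diff binomial_eq_0)
      ultimately have S: "(of_nat i + 1) * c j = (of_nat k + 2 - of_nat i) * c i"
        by (simp add: c_def i algebra_simps)
      have "of_nat (k + 3 choose j) = c i + c j"
        by (simp add: c_def i eval_nat_numeral)
      then have "of_nat (k + 3 choose j) * y j
          - (of_nat (r + 2) * c j - (of_nat (k + 1) - of_nat r) * c (j - 1))
          = (of_nat k + 2 - of_nat i) * c i - (of_nat i + 1) * c j"
        unfolding yj by (simp add: i algebra_simps)
      then show ?thesis
        using S by simp
    qed
    have "(\<Sum>j=0..Suc r. (- 1) ^ j * of_nat (k + 3 choose j) * y j ^ (k + 2))
        = y 0 ^ (k + 2) + (\<Sum>j=1..Suc r. (- 1) ^ j * of_nat (k + 3 choose j) * y j ^ (k + 2))"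
      by (simp add: sum.atLeast_Suc_atMost)
    also have "(\<Sum>j=1..Suc r. (- 1) ^ j * of_nat (k + 3 choose j) * y j ^ (k + 2))
        = (\<Sum>j=1..Suc r. (- 1) ^ j * (of_nat (k + 3 choose j) * y j) * y j ^ (k + 1))"
      by (simp add: mult.assoc)
    also have "\<dots> = (\<Sum>j=1..Suc r. (- 1) ^ j
        * (of_nat (r + 2) * c j - (of_nat (k + 1) - of_nat r) * c (j - 1)) * y j ^ (k + 1))"
      by (intro sum.cong refl) (simp add: T del: of_nat_Suc of_nat_add)
    also have "\<dots> = of_nat (r + 2) * (\<Sum>j=1..Suc r. (- 1) ^ j * c j * y j ^ (k + 1))
        - (of_nat (k + 1) - of_nat r) * (\<Sum>j=1..Suc r. (- 1) ^ j * c (j - 1) * y j ^ (k + 1))"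
      by (simp only: sum_distrib_left sum_subtractf[symmetric])
        (intro sum.cong refl, simp add: algebra_simps)
    also have "(\<Sum>j=1..Suc r. (- 1) ^ j * c j * y j ^ (k + 1))
        = coeff (ef_rec k) (Suc r) - y 0 ^ (k + 1)"
      unfolding A by (simp add: sum.atLeast_Suc_atMost c_def)
    also have "y 0 ^ (k + 2) + (of_nat (r + 2) * (coeff (ef_rec k) (Suc r) - y 0 ^ (k + 1))
          - (of_nat (k + 1) - of_nat r) * (\<Sum>j=1..Suc r. (- 1) ^ j * c (j - 1) * y j ^ (k + 1)))
        = coeff (ef_rec (Suc k)) (Suc r)"
      unfolding R B by (simp add: y_def algebra_simps)
    finally show ?thesis
      by (simp add: \<open>s = Suc r\<close> y_def eval_nat_numeral)
  qed
qed

theorem coeff_euler_frobenius: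
  assumes "m \<ge> 1"
  shows "coeff (euler_frobenius (2 * m - 2)) s = of_real (ef_coeff m s)"
proof -
  have "2 * m - 2 + 2 = 2 * m" "2 * m - 2 + 1 = 2 * m - 1"
    using assms by auto
  then show ?thesis
    by (simp only: euler_frobenius_eq_ef_rec coeff_ef_rec ef_coeff_def) simp
qed

section \<open>The coefficient formulas\<close>

text \<open>The differences of zero \<open>\<Delta>\<^sup>t 0\<^sup>j\<close>, for \<open>t, j \<ge> 1\<close>.\<close>

definition diff_zero :: "nat \<Rightarrow> nat \<Rightarrow> complex" where
  "diff_zero t j = (\<Sum>l=1..t. (- 1) ^ (t - l) * of_nat (t choose l) * of_nat l ^ j)"

text \<open>The sum is over \<open>0 \<le> \<alpha> \<le> m - 2\<close>; it is empty for \<open>m = 1\<close>.\<close>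

definition K_const :: "real \<Rightarrow> nat \<Rightarrow> real \<Rightarrow> real" where
  "K_const \<omega> m h =
     (sin (pi * \<omega> * h) / (pi * \<omega> * h)) ^ (2 * m) *
     (fact (2 * m - 1) /
       (2 * (\<Sum>\<alpha><m-1. ef_coeff m \<alpha> * cos (2 * pi * \<omega> * h * real (m - 1 - \<alpha>)))
        + ef_coeff m (m - 1)))"

text \<open>In the next two definitions \<open>T\<close> is \<open>2\<pi>i\<omega>h\<close> and \<open>z = e\<^sup>T\<close>, \<open>w = e\<^bsup>2\<pi>i\<omega>\<^esup>\<close>. Only the values of
  \<open>a\<close>, \<open>b\<close> and \<open>q\<close> on \<open>{1..m-1}\<close> matter.\<close>

definition coeff_system ::
  "nat \<Rightarrow> nat \<Rightarrow> real \<Rightarrow> real \<Rightarrow> (nat \<Rightarrow> complex) \<Rightarrow> (nat \<Rightarrow> complex) \<Rightarrow> (nat \<Rightarrow> complex) \<Rightarrow> bool" where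
  "coeff_system m N \<omega> h q a b \<longleftrightarrow>
    (let T = 2 * of_real pi * \<i> * of_real \<omega> * of_real h;
         z = exp T;
         w = exp (2 * of_real pi * \<i> * of_real \<omega>);
         K = complex_of_real (K_const \<omega> m h);
         H = complex_of_real h
     in
      (\<forall>j\<in>{1..m-1}.
         (\<Sum>k=1..m-1. a k * (\<Sum>t=1..j. q k * diff_zero t j / (q k - 1) ^ (t + 1)))
         + (\<Sum>k=1..m-1. b k * (\<Sum>t=1..j. q k ^ (N + t) * diff_zero t j / (1 - q k) ^ (t + 1)))
         = fact j / T ^ (j + 1)
           - (\<Sum>t=1..j. z * K * diff_zero t j / (z - 1) ^ (t + 1))) \<and>
      (\<forall>j\<in>{1..m-1}.
         (\<Sum>k=1..m-1. a k *
            ((\<Sum>t=1..j. q k ^ t * diff_zero t j / (1 - q k) ^ (t + 1))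
             - (\<Sum>\<alpha>=1..j. H powi (int \<alpha> - int j) * of_nat (j choose \<alpha>) *
                 (\<Sum>t=1..\<alpha>. q k ^ (N + t) * diff_zero t \<alpha> / (1 - q k) ^ (t + 1)))))
         + (\<Sum>k=1..m-1. b k *
            ((\<Sum>t=1..j. q k ^ (N + 1) * diff_zero t j / (q k - 1) ^ (t + 1))
             - (\<Sum>\<alpha>=1..j. H powi (int \<alpha> - int j) * of_nat (j choose \<alpha>) *
                 (\<Sum>t=1..\<alpha>. q k * diff_zero t \<alpha> / (q k - 1) ^ (t + 1)))))
         = (- 1) ^ (j + 1) * fact j / T ^ (j + 1)
           + (\<Sum>\<alpha>=1..j. H powi (int \<alpha> - int j) *
                ((- 1) ^ \<alpha> * fact j * w / (fact (j - \<alpha>) * T ^ (\<alpha> + 1))))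
           - K / (1 - z) * (\<Sum>t=1..j. (z / (1 - z)) ^ t * diff_zero t j)
           + K * w / (1 - z) *
               (\<Sum>\<alpha>=1..j. H powi (int \<alpha> - int j) * of_nat (j choose \<alpha>) *
                 (\<Sum>t=1..\<alpha>. (z / (1 - z)) ^ t * diff_zero t \<alpha>))))"

definition coeff_formula ::
  "nat \<Rightarrow> nat \<Rightarrow> real \<Rightarrow> real \<Rightarrow> (nat \<Rightarrow> complex) \<Rightarrow> (nat \<Rightarrow> complex) \<Rightarrow> (nat \<Rightarrow> complex) \<Rightarrow> nat \<Rightarrow> complex" where
  "coeff_formula m N \<omega> h q a b \<beta> =
    (let T = 2 * of_real pi * \<i> * of_real \<omega> * of_real h;
         z = exp T;
         w = exp (2 * of_real pi * \<i> * of_real \<omega>);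
         K = complex_of_real (K_const \<omega> m h);
         H = complex_of_real h
     in
      if \<beta> = 0 then
        H * (z * K / (z - 1) - 1 / T
             + (\<Sum>k=1..m-1. a k * (q k / (q k - 1)) + b k * (q k ^ N / (1 - q k))))
      else if \<beta> < N then
        H * (exp (T * of_nat \<beta>) * K
             + (\<Sum>k=1..m-1. a k * q k ^ \<beta> + b k * q k ^ (N - \<beta>)))
      else
        H * (w * K / (1 - z) + w / T
             + (\<Sum>k=1..m-1. a k * (q k ^ N / (1 - q k)) + b k * (q k / (q k - 1)))))"

end

theory Submission
  imports Defs
begin

text \<open>Write \<open>\<sigma> = 2\<pi>i\<omega>\<close>. If the formula with coefficients \<open>C\<close> is exact on polynomials of degree less than
  \<open>m\<close>, then \<open>\<ell>(\<phi>) = (-1)\<^sup>m \<integral> s\<^bsup>(m)\<^esup> \<phi>\<^bsup>(m)\<^esup>\<close>, where the \<open>2m\<close>-th derivative of \<open>s\<close> is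
  \<open>exp(\<sigma>x) - \<Sum> C\<^sub>\<gamma> \<delta>(x - h\<gamma>)\<close> and \<open>s\<close> is determined up to a polynomial of degree less than \<open>m\<close>. If that
  polynomial can be chosen such that \<open>s\<close> vanishes at all nodes, then \<open>C\<close> is optimal: the error at
  the conjugate of \<open>s\<close> is the same for all coefficient vectors, and for \<open>C\<close> it attains the norm. The
  norm of a Hilbert space functional determines the functional once an extremal element is known, which
  gives uniqueness.

  For coefficients that are a combination of geometric sequences \<open>x\<^sup>\<gamma>\<close>, the values of \<open>s\<close> at the
  nodes are explicit in the regularised moments \<open>\<Sum>i\<ge>1. i\<^sup>n x\<^sup>i\<close>, which for \<open>n = 2m - 1\<close> are
  \<open>x E\<^bsub>2m-2\<^esub>(x) / (1 - x)\<^bsup>2m\<^esup>\<close>. So the roots of \<open>E\<^bsub>2m-2\<^esub>\<close> contribute only polynomials, \<open>K\<close> is the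
  factor for which \<open>x = exp(\<sigma>h)\<close> cancels the exponential, and the linear system says that the remaining
  polynomial has degree less than \<open>m\<close> and that monomials are integrated exactly. A solution of the
  homogeneous system is a natural spline vanishing at \<open>N + 1 \<ge> m\<close> points, hence zero, and a Vandermonde
  argument turns this into the vanishing of the unknowns also for small \<open>N\<close>.\<close>

text \<open>The space speaks only of absolute continuity, so it has to be proved that the derivative
  of order \<open>m\<close> exists almost everywhere and integrates back to the one below. Vitali
  coverings give the former, a gauge argument the latter.

  The series \<open>\<Sum>i. i^n * x^i\<close> diverges at nodes that matter:
  \<open>exp (\<sigma> h)\<close> lies on the unit circle and the reciprocals of the
  \<open>q k\<close> lie outside it. The moments are therefore rational functions from the start,
  and what would be a shift of a series is proved with finite differences. The special coefficients
  at 0 and at \<open>N\<close> are such rational values of sums over half-lines, chosen so that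
  moments of order 0 cancel.

  A factor \<open>\<kappa>\<close> in front of the integral is carried along:
  \<open>\<kappa> = 1\<close> is the quadrature problem, and \<open>\<kappa> = 0\<close> gives with
  the same computations the homogeneous problem needed for unique solvability. For small
  \<open>N\<close> there are more unknowns, \<open>2m - 2\<close>, than nodes, so vanishing node
  coefficients would not determine them. The missing equations come from the polynomial part of the
  spline, whose coefficients are moments of orders \<open>m\<close> to
  \<open>2m - 1\<close>.\<close>

section \<open>Absolutely continuous functions\<close>

text \<open>\<open>E\<close> may be non-measurable, so its size is controlled through a measurable
  superset \<open>T\<close>. Vitali's theorem covers \<open>E\<close> up to a null set by countably
  many disjoint fine intervals, and by continuity of the measure finitely many of them carry all but
  \<open>\<eta>\<close> of the total length.\<close>

lemma vitali_finite:
  fixes E U :: "real set"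
  assumes U: "open U" "U \<in> lmeasurable" "E \<subseteq> U" and eta: "\<eta> > 0"
    and fine: "\<And>x d. x \<in> E \<Longrightarrow> d > 0 \<Longrightarrow> \<exists>u v. u < v \<and> x \<in> {u..v} \<and> v - u < d \<and> P {u..v}"
  obtains \<K> T where "\<K> division_of \<Union>\<K>" "\<And>K. K \<in> \<K> \<Longrightarrow> P K" "\<Union>\<K> \<subseteq> U" "T \<in> lmeasurable" "E \<subseteq> T"
    "measure lebesgue T \<le> measure lebesgue (\<Union>\<K>) + \<eta>"
proof (cases "E = {}")
  case True
  show ?thesis
    by (rule that[of "{}" "{}"]) (use eta True in auto)
next
  case False
  define I where "I = {(u, v). u < v \<and> {u..v} \<subseteq> U \<and> P {u..v}}"
  define a :: "real \<times> real \<Rightarrow> real" where "a = (\<lambda>(u, v). (u + v) / 2)"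
  define r :: "real \<times> real \<Rightarrow> real" where "r = (\<lambda>(u, v). (v - u) / 2)"
  have ball: "cball (a i) (r i) = {fst i..snd i}" for i
    by (cases i) (auto simp: a_def r_def cball_eq_atLeastAtMost field_simps)
  have r: "0 < r i" if "i \<in> I" for i using that by (auto simp: I_def r_def)
  have S: "\<exists>i. i \<in> I \<and> x \<in> cball (a i) (r i) \<and> r i < d" if x: "x \<in> E" and d: "0 < d" for x d
  proof -
    obtain e where e: "e > 0" "cball x e \<subseteq> U"
      using U x by (meson open_contains_cball subset_eq)
    obtain u v where uv: "u < v" "x \<in> {u..v}" "v - u < min e d" "P {u..v}"
      using fine[OF x, of "min e d"] e d by auto
    have "{u..v} \<subseteq> cball x e"
      using uv by (auto simp: dist_real_def)
    then have "(u, v) \<in> I"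
      using uv(1,4) e(2) by (simp add: I_def)
    moreover have "x \<in> cball (a (u, v)) (r (u, v))"
      unfolding ball using uv by simp
    moreover have "r (u, v) < d" using uv by (simp add: r_def)
    ultimately show ?thesis by blast
  qed
  obtain C where C: "countable C" "C \<subseteq> I"
     "pairwise (\<lambda>i j. disjnt (cball (a i) (r i)) (cball (a j) (r j))) C"
     "negligible (E - (\<Union>i\<in>C. cball (a i) (r i)))"
    using Vitali_covering_theorem_cballs[of I r E a, OF r S] by blast
  define D where "D n = (from_nat_into C ` {..n})" for n
  \<comment> \<open>The intersection with \<open>C\<close> matters when \<open>C\<close> is empty:
    \<open>from_nat_into C\<close> then yields an arbitrary index.\<close>
  define A where "A n = (\<Union>i\<in>D n \<inter> C. cball (a i) (r i))" for n
  let ?B = "\<Union>i\<in>C. cball (a i) (r i)"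
  have DC: "D n \<inter> C = D n" if "C \<noteq> {}" for n
    using that by (auto simp: D_def intro: from_nat_into)
  have UA: "(\<Union>n. A n) = ?B"
  proof (intro equalityI subsetI)
    fix x assume "x \<in> ?B"
    then obtain i where i: "i \<in> C" "x \<in> cball (a i) (r i)" by blast
    obtain n where "from_nat_into C n = i" using from_nat_into_surj[OF C(1) i(1)] by blast
    then have "i \<in> D n" by (auto simp: D_def)
    then show "x \<in> (\<Union>n. A n)" using i by (auto simp: A_def simp del: mem_cball)
  qed (auto simp: A_def simp del: mem_cball)
  have sub: "cball (a i) (r i) \<subseteq> U" if "i \<in> C" for i
    using that C(2) by (force simp: I_def ball)
  have Bs: "?B \<in> sets lebesgue"
    using C(1) by (intro sets.countable_UN') auto
  have Bm: "?B \<in> lmeasurable"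
    by (rule fmeasurableI2[OF U(2) _ Bs]) (use sub in blast)
  have Am: "A n \<in> sets lebesgue" for n
    unfolding A_def by (intro sets.countable_UN') (auto simp: D_def intro!: countable_finite)
  have Ame: "emeasure lebesgue (A n) \<noteq> \<infinity>" for n
  proof -
    have "A n \<subseteq> U" using sub unfolding A_def by blast
    from fmeasurableI2[OF U(2) this Am] show ?thesis by (auto simp: fmeasurable_def)
  qed
  have inc: "incseq A"
    unfolding incseq_def
  proof (intro allI impI)
    fix k n :: nat assume "k \<le> n"
    then have "D k \<subseteq> D n" by (auto simp: D_def)
    then show "A k \<subseteq> A n" unfolding A_def by blast
  qed
  have "(\<lambda>n. measure lebesgue (A n)) \<longlonglongrightarrow> measure lebesgue (\<Union>n. A n)"
    using Bm by (intro Lim_measure_incseq Am inc range_subsetD) (auto simp: UA fmeasurable_def Am)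
  then have "eventually (\<lambda>n. measure lebesgue (A n) > measure lebesgue ?B - \<eta>) sequentially"
    unfolding UA using eta by (intro order_tendstoD) auto
  then obtain n where n: "measure lebesgue (A n) > measure lebesgue ?B - \<eta>"
    using eventually_happens' by force
  define \<K> where "\<K> = (\<lambda>i. cball (a i) (r i)) ` (D n \<inter> C)"
  have KA: "\<Union>\<K> = A n" by (auto simp: \<K>_def A_def)
  have fin: "finite \<K>" by (auto simp: \<K>_def D_def)
  show ?thesis
  proof (rule that[of \<K> "?B \<union> (E - ?B)"])
    show "\<K> division_of \<Union>\<K>"
    proof (rule division_ofI)
      fix K assume "K \<in> \<K>"
      then obtain i where i: "i \<in> C" "K = cball (a i) (r i)" by (auto simp: \<K>_def)
      show "K \<noteq> {}" using i r[of i] C(2) by force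
      show "\<exists>a b. K = cbox a b" using i by (auto simp: ball)
    next
      fix K1 K2 assume *: "K1 \<in> \<K>" "K2 \<in> \<K>" "K1 \<noteq> K2"
      then obtain i j where ij: "i \<in> C" "j \<in> C" "K1 = cball (a i) (r i)" "K2 = cball (a j) (r j)"
        unfolding \<K>_def by fast
      then have "disjnt K1 K2"
        using pairwiseD[OF C(3) ij(1,2)] *(3) by fastforce
      then have "K1 \<inter> K2 = {}" by (simp add: disjnt_def)
      then show "interior K1 \<inter> interior K2 = {}"
        using interior_subset[of K1] interior_subset[of K2] by blast
    qed (auto simp: fin)
    show "P K" if "K \<in> \<K>" for K
      using that C(2) by (auto simp: \<K>_def ball I_def)
    show "\<Union>\<K> \<subseteq> U" using sub by (auto simp: \<K>_def)
    show "?B \<union> (E - ?B) \<in> lmeasurable"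
      by (rule fmeasurable.Un[OF Bm negligible_imp_measurable[OF C(4)]])
    show "measure lebesgue (?B \<union> (E - ?B)) \<le> measure lebesgue (\<Union>\<K>) + \<eta>"
    proof -
      have "measure lebesgue (?B \<union> (E - ?B)) \<le> measure lebesgue ?B + measure lebesgue (E - ?B)"
        by (rule measure_Un_le[OF Bs negligible_imp_sets[OF C(4)]])
      also have "measure lebesgue (E - ?B) = 0"
        by (rule negligible_imp_measure0[OF C(4)])
      finally show ?thesis using n unfolding KA by linarith
    qed
  qed auto
qed

section \<open>Absolute continuity over divisions of intervals\<close>

text \<open>Finite divisions replace the indexed families of \<open>abs_continuous_on\<close>,
  because Vitali coverings and gauge partitions deliver their intervals in this form. The measure of
  the union is the total length, and \<open>Inf K\<close>, \<open>Sup K\<close> are the end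
  points.\<close>

definition ac_on :: "real \<Rightarrow> real \<Rightarrow> (real \<Rightarrow> 'a::real_normed_vector) \<Rightarrow> bool" where
  "ac_on a b f \<longleftrightarrow>
     (\<forall>\<epsilon>>0. \<exists>\<delta>>0. \<forall>\<K>. \<K> division_of \<Union>\<K> \<and> \<Union>\<K> \<subseteq> {a..b} \<and> measure lebesgue (\<Union>\<K>) < \<delta> \<longrightarrow>
        (\<Sum>K\<in>\<K>. norm (f (Sup K) - f (Inf K))) < \<epsilon>)"

lemma division_interval:
  fixes \<K> :: "real set set"
  assumes "\<K> division_of S" "K \<in> \<K>"
  shows "K = {Inf K..Sup K}" "Inf K \<le> Sup K" "measure lebesgue K = Sup K - Inf K"
    "interior K = {Inf K<..<Sup K}"
proof -
  obtain u v where "K = cbox u v" "K \<noteq> {}" using assms division_ofD by metis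
  then have K: "K = {u..v}" "u \<le> v" by auto
  show 1: "K = {Inf K..Sup K}" "Inf K \<le> Sup K" "measure lebesgue K = Sup K - Inf K" using K by auto
  show "interior K = {Inf K<..<Sup K}"
    using 1(1) interior_atLeastAtMost_real by metis
qed

lemma division_measure:
  fixes \<K> :: "real set set"
  assumes "\<K> division_of S"
  shows "measure lebesgue S = (\<Sum>K\<in>\<K>. Sup K - Inf K)"
proof -
  have "measure lebesgue S = (\<Sum>K\<in>\<K>. measure lebesgue K)"
    using content_division[OF assms] by simp
  also have "\<dots> = (\<Sum>K\<in>\<K>. Sup K - Inf K)"
    by (intro sum.cong) (use division_interval[OF assms] in auto)
  finally show ?thesis .
qed

text \<open>Tagging each interval with its left end point gives a tagged division, over which
  increments telescope.\<close>

lemma division_sum: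
  fixes f :: "real \<Rightarrow> 'a::real_normed_vector"
  assumes "\<K> division_of {a..b}" "a \<le> b"
  shows "(\<Sum>K\<in>\<K>. f (Sup K) - f (Inf K)) = f b - f a"
proof -
  let ?p = "(\<lambda>K. (Inf K, K)) ` \<K>"
  have "?p tagged_division_of {a..b}"
  proof (rule tagged_division_ofI)
    show "finite ?p" using assms by auto
    fix x K assume "(x, K) \<in> ?p"
    then have K: "K \<in> \<K>" "x = Inf K" by auto
    show "x \<in> K" using division_interval[OF assms(1) K(1)] K(2)
      by (metis atLeastAtMost_iff order_refl)
    show "K \<subseteq> {a..b}" using assms(1) K by auto
    show "\<exists>a b. K = cbox a b" using division_ofD(4)[OF assms(1)] K by blast
  next
    fix x1 K1 x2 K2 assume "(x1, K1) \<in> ?p" "(x2, K2) \<in> ?p" "(x1, K1) \<noteq> (x2, K2)"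
    then show "interior K1 \<inter> interior K2 = {}" using division_ofD(5)[OF assms(1)] by fast
  next
    have "{K. \<exists>x. (x, K) \<in> ?p} = \<K>" by auto
    then show "\<Union> {K. \<exists>x. (x, K) \<in> ?p} = {a..b}" using division_ofD(6)[OF assms(1)] by simp
  qed
  from additive_tagged_division_1[OF assms(2) this, of f] show ?thesis
    by (subst (asm) sum.reindex) (auto simp: inj_on_def)
qed

lemma abs_continuous_on_imp_ac_on:
  assumes "abs_continuous_on a b f" shows "ac_on a b f"
  unfolding ac_on_def
proof (intro allI impI)
  fix \<epsilon> :: real assume "\<epsilon> > 0"
  then obtain \<delta> where \<delta>: "\<delta> > 0" "\<And>(n::nat) u v. \<lbrakk>\<forall>i<n. a \<le> u i \<and> u i \<le> v i \<and> v i \<le> b;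
        \<forall>i<n. \<forall>j<n. i \<noteq> j \<longrightarrow> {u i<..<v i} \<inter> {u j<..<v j} = {};
        (\<Sum>i<n. v i - u i) < \<delta>\<rbrakk>
        \<Longrightarrow> (\<Sum>i<n. norm (f (v i) - f (u i))) < \<epsilon>"
    using assms[unfolded abs_continuous_on_def, rule_format, of \<epsilon>] by blast
  show "\<exists>\<delta>>0. \<forall>\<K>. \<K> division_of \<Union>\<K> \<and> \<Union>\<K> \<subseteq> {a..b} \<and> measure lebesgue (\<Union>\<K>) < \<delta> \<longrightarrow>
        (\<Sum>K\<in>\<K>. norm (f (Sup K) - f (Inf K))) < \<epsilon>"
  proof (intro exI[of _ \<delta>] conjI allI impI \<open>\<delta> > 0\<close>, elim conjE)
    fix \<K> :: "real set set" assume K: "\<K> division_of \<Union>\<K>" "\<Union>\<K> \<subseteq> {a..b}" "measure lebesgue (\<Union>\<K>) < \<delta>"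
    obtain g where g: "bij_betw g {..<card \<K>} \<K>"
      using ex_bij_betw_nat_finite[of \<K>] K(1) by (auto simp: atLeast0LessThan)
    have gK: "g i \<in> \<K>" if "i < card \<K>" for i using g that by (auto simp: bij_betw_def)
    have sm: "(\<Sum>i<card \<K>. F (g i)) = sum F \<K>" for F :: "real set \<Rightarrow> real"
      by (rule sum.reindex_bij_betw[OF g])
    have "(\<Sum>i<card \<K>. norm (f (Sup (g i)) - f (Inf (g i)))) < \<epsilon>"
    proof (rule \<delta>(2))
      show "\<forall>i<card \<K>. a \<le> Inf (g i) \<and> Inf (g i) \<le> Sup (g i) \<and> Sup (g i) \<le> b"
      proof (intro allI impI)
        fix i assume "i < card \<K>"
        then have "{Inf (g i)..Sup (g i)} \<subseteq> {a..b}" "Inf (g i) \<le> Sup (g i)"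
          using division_interval[OF K(1) gK] K(2) gK[of i] by blast+
        then show "a \<le> Inf (g i) \<and> Inf (g i) \<le> Sup (g i) \<and> Sup (g i) \<le> b" by auto
      qed
      show "\<forall>i<card \<K>. \<forall>j<card \<K>. i \<noteq> j \<longrightarrow>
          {Inf (g i)<..<Sup (g i)} \<inter> {Inf (g j)<..<Sup (g j)} = {}"
      proof (intro allI impI)
        fix i j assume ij: "i < card \<K>" "j < card \<K>" "i \<noteq> j"
        then have "g i \<noteq> g j" using g by (auto simp: bij_betw_def inj_on_def)
        then have "interior (g i) \<inter> interior (g j) = {}"
          using division_ofD(5)[OF K(1)] gK ij by blast
        then show "{Inf (g i)<..<Sup (g i)} \<inter> {Inf (g j)<..<Sup (g j)} = {}"
          using division_interval(4)[OF K(1) gK] ij by auto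
      qed
      show "(\<Sum>i<card \<K>. Sup (g i) - Inf (g i)) < \<delta>"
        using K(3) division_measure[OF K(1)] sm[of "\<lambda>K. Sup K - Inf K"] by simp
    qed
    then show "(\<Sum>K\<in>\<K>. norm (f (Sup K) - f (Inf K))) < \<epsilon>"
      using sm[of "\<lambda>K. norm (f (Sup K) - f (Inf K))"] by simp
  qed
qed

text \<open>\<open>G\<close> consists of the gaps that the intervals of \<open>J\<close> leave
  inside those of \<open>I\<close>. As it does not depend on \<open>f\<close>, the identity can be
  read for \<open>f = id\<close>, giving lengths, and for the function under study, giving
  increments.\<close>

lemma division_gaps:
  fixes I J :: "real set set"
  assumes I: "I division_of \<Union>I" and J: "J division_of \<Union>J"
    and JI: "\<And>L. L \<in> J \<Longrightarrow> Inf L < Sup L \<and> (\<exists>K\<in>I. L \<subseteq> K)"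
  shows "\<exists>G. G division_of \<Union>G \<and> \<Union>G \<subseteq> \<Union>I \<and>
    (\<forall>f :: real \<Rightarrow> real. (\<Sum>K\<in>I. f (Sup K) - f (Inf K)) =
       (\<Sum>K\<in>J. f (Sup K) - f (Inf K)) + (\<Sum>K\<in>G. f (Sup K) - f (Inf K)))"
proof -
  define JJ where "JJ K = {L \<in> J. L \<subseteq> K}" for K
  have "\<exists>q. JJ K \<subseteq> q \<and> q division_of K" if K: "K \<in> I" for K
  proof -
    have "JJ K division_of \<Union>(JJ K)"
      using division_of_subset[OF J] by (auto simp: JJ_def)
    moreover obtain u v where "K = cbox u v" using division_ofD(4)[OF I K] by blast
    moreover have "\<Union>(JJ K) \<subseteq> K" by (auto simp: JJ_def)
    ultimately show ?thesis by (metis partial_division_extend_interval)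
  qed
  then obtain q where q: "\<And>K. K \<in> I \<Longrightarrow> JJ K \<subseteq> q K" "\<And>K. K \<in> I \<Longrightarrow> q K division_of K"
    by metis
  \<comment> \<open>Degenerate intervals are dropped: a common end point of two members of
    \<open>I\<close> could occur as a one-point interval in both of their divisions, and the sets
    \<open>GG K\<close> would not be disjoint.\<close>
  define GG where "GG K = {L \<in> q K - JJ K. Inf L < Sup L}" for K
  define G where "G = (\<Union>K\<in>I. GG K)"
  have fI: "finite I" and fJ: "finite J" using I J by auto
  have fq: "finite (q K)" if "K \<in> I" for K using q(2)[OF that] by auto
  have disj: "L \<notin> q K'" if "K \<in> I" "K' \<in> I" "K \<noteq> K'" "L \<in> q K" "Inf L < Sup L" for K K' L
  proof
    assume "L \<in> q K'"
    then have "L \<subseteq> K" "L \<subseteq> K'" using that q(2) by blast+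
    then have "interior L \<subseteq> interior K \<inter> interior K'"
      by (simp add: interior_mono)
    also have "\<dots> = {}" using division_ofD(5)[OF I] that by blast
    finally show False
      using division_interval(4)[OF q(2)[OF that(1)] that(4)] that(5)
      by (simp add: greaterThanLessThan_empty_iff)
  qed
  have JU: "J = (\<Union>K\<in>I. JJ K)" using JI by (auto simp: JJ_def)
  show ?thesis
  proof (intro exI[of _ G] conjI allI)
    show "G division_of \<Union>G"
    proof (rule division_ofI)
      show "finite G" using fI fq by (auto simp: G_def GG_def)
      fix L assume "L \<in> G"
      then obtain K where K: "K \<in> I" "L \<in> q K" by (auto simp: G_def GG_def)
      show "L \<noteq> {}" using division_ofD(3)[OF q(2)] K by blast
      show "\<exists>a b. L = cbox a b" using division_ofD(4)[OF q(2)] K by blast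
    next
      fix L L' assume *: "L \<in> G" "L' \<in> G" "L \<noteq> L'"
      then obtain K K' where K: "K \<in> I" "L \<in> q K" "K' \<in> I" "L' \<in> q K'"
        by (auto simp: G_def GG_def)
      show "interior L \<inter> interior L' = {}"
      proof (cases "K = K'")
        case True
        then show ?thesis using K * division_ofD(5)[OF q(2)] by blast
      next
        case False
        then have "interior K \<inter> interior K' = {}" using division_ofD(5)[OF I] K by blast
        moreover have "L \<subseteq> K" "L' \<subseteq> K'" using K division_ofD(2)[OF q(2)] by blast+
        ultimately show ?thesis using interior_mono by blast
      qed
    qed auto
    show "\<Union>G \<subseteq> \<Union>I"
      using division_ofD(2)[OF q(2)] by (fastforce simp: G_def GG_def)
    fix f :: "real \<Rightarrow> real"
    let ?D = "\<lambda>K. f (Sup K) - f (Inf K)"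
    have "sum ?D I = (\<Sum>K\<in>I. sum ?D (JJ K) + sum ?D (GG K))"
    proof (intro sum.cong refl)
      fix K assume K: "K \<in> I"
      have "?D K = sum ?D (q K)"
        using division_sum[of "q K" "Inf K" "Sup K" f] q(2)[OF K] division_interval[OF I K] by simp
      also have "\<dots> = sum ?D (JJ K) + sum ?D (q K - JJ K)"
        using q(1)[OF K] fq[OF K] by (simp add: sum.subset_diff)
      also have "sum ?D (q K - JJ K) = sum ?D (GG K)"
      proof (rule sum.mono_neutral_right)
        show "\<forall>i\<in>q K - JJ K - GG K. f (Sup i) - f (Inf i) = 0"
          using division_interval(2)[OF q(2)[OF K]] by (force simp: GG_def)
      qed (use fq[OF K] in \<open>auto simp: GG_def\<close>)
      finally show "?D K = sum ?D (JJ K) + sum ?D (GG K)" .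
    qed
    also have "\<dots> = (\<Sum>K\<in>I. sum ?D (JJ K)) + (\<Sum>K\<in>I. sum ?D (GG K))"
      by (rule sum.distrib)
    also have "(\<Sum>K\<in>I. sum ?D (JJ K)) = sum ?D J"
      unfolding JU
    proof (rule sum.UNION_disjoint[symmetric])
      show "\<forall>i\<in>I. \<forall>j\<in>I. i \<noteq> j \<longrightarrow> JJ i \<inter> JJ j = {}"
      proof (intro ballI impI equals0I)
        fix K K' L assume "K \<in> I" "K' \<in> I" "K \<noteq> K'" "L \<in> JJ K \<inter> JJ K'"
        then show False using disj[of K K' L] q(1)[of K] q(1)[of K'] JI[of L] by (auto simp: JJ_def)
      qed
    qed (use fI fJ in \<open>auto simp: JJ_def\<close>)
    also have "(\<Sum>K\<in>I. sum ?D (GG K)) = sum ?D G"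
      unfolding G_def
    proof (rule sum.UNION_disjoint[symmetric])
      show "\<forall>i\<in>I. \<forall>j\<in>I. i \<noteq> j \<longrightarrow> GG i \<inter> GG j = {}"
      proof (intro ballI impI equals0I)
        fix K K' L assume "K \<in> I" "K' \<in> I" "K \<noteq> K'" "L \<in> GG K \<inter> GG K'"
        then show False using disj[of K K' L] by (auto simp: GG_def)
      qed
    qed (use fI fq in \<open>auto simp: GG_def\<close>)
    finally show "sum ?D I = sum ?D J + sum ?D G" .
  qed
qed

lemma ac_onD:
  assumes "ac_on a b f" "\<epsilon> > 0"
  shows "\<exists>\<delta>>0. \<forall>\<K>. \<K> division_of \<Union>\<K> \<longrightarrow> \<Union>\<K> \<subseteq> {a..b} \<longrightarrow> measure lebesgue (\<Union>\<K>) < \<delta> \<longrightarrow>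
        (\<Sum>K\<in>\<K>. norm (f (Sup K) - f (Inf K))) < \<epsilon>"
  using assms unfolding ac_on_def by meson

text \<open>The infimum \<open>e\<close> of the measures of measurable supersets is the outer
  measure of \<open>E\<close>; outer regularity makes nearly optimal supersets open.\<close>

lemma lmeasurable_open_approx:
  fixes E :: "real set"
  assumes "E \<subseteq> {a<..<b}"
  shows "\<exists>e\<ge>0. (\<forall>T. T \<in> lmeasurable \<longrightarrow> E \<subseteq> T \<longrightarrow> e \<le> measure lebesgue T) \<and>
    (\<forall>\<eta>>0. \<exists>U. open U \<and> U \<in> lmeasurable \<and> E \<subseteq> U \<and> U \<subseteq> {a<..<b} \<and> measure lebesgue U < e + \<eta>)"
proof -
  define S where "S = measure lebesgue ` {T. T \<in> lmeasurable \<and> E \<subseteq> T}"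
  have bdd: "bdd_below S" by (rule bdd_belowI[of _ 0]) (auto simp: S_def)
  have ne: "S \<noteq> {}" using assms by (auto simp: S_def intro!: exI[of _ "{a<..<b}"])
  show ?thesis
  proof (intro exI[of _ "Inf S"] conjI allI impI)
    show "Inf S \<ge> 0" by (rule cInf_greatest[OF ne]) (auto simp: S_def)
    show "Inf S \<le> measure lebesgue T" if "T \<in> lmeasurable" "E \<subseteq> T" for T
      using that by (intro cInf_lower bdd) (auto simp: S_def)
    fix \<eta> :: real assume \<eta>: "\<eta> > 0"
    obtain T where T: "T \<in> lmeasurable" "E \<subseteq> T" "measure lebesgue T < Inf S + \<eta> / 2"
      using cInf_lessD[OF ne, of "Inf S + \<eta> / 2"] \<eta> by (auto simp: S_def)
    obtain V where V: "open V" "T \<subseteq> V" "(V - T) \<in> lmeasurable" "emeasure lebesgue (V - T) < ennreal (\<eta> / 2)"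
      using sets_lebesgue_outer_open[of T "\<eta> / 2"] T(1) \<eta> by (auto simp: fmeasurableD)
    have "V = T \<union> (V - T)" using V(2) by blast
    then have Vm: "V \<in> lmeasurable" "measure lebesgue V \<le> measure lebesgue T + measure lebesgue (V - T)"
      using T(1) V(3) measure_Un_le[of T lebesgue "V - T"] fmeasurable.Un[of T lebesgue "V - T"]
      by (auto simp: fmeasurableD)
    have "measure lebesgue (V - T) < \<eta> / 2"
      using V(3,4) \<eta> by (simp add: emeasure_eq_measure2 fmeasurableD2 ennreal_less_iff)
    then have "measure lebesgue V < Inf S + \<eta>" using Vm T(3) by linarith
    moreover have "measure lebesgue (V \<inter> {a<..<b}) \<le> measure lebesgue V"
      using Vm(1) V(1) by (intro measure_mono_fmeasurable) auto
    moreover have "V \<inter> {a<..<b} \<in> lmeasurable"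
      using Vm by (intro fmeasurableI2[OF Vm(1)]) (auto simp: V)
    ultimately show "\<exists>U. open U \<and> U \<in> lmeasurable \<and> E \<subseteq> U \<and> U \<subseteq> {a<..<b} \<and> measure lebesgue U < Inf S + \<eta>"
      using T V assms by (intro exI[of _ "V \<inter> {a<..<b}"]) auto
  qed
qed

section \<open>Differentiability almost everywhere\<close>

text \<open>Inside a nearly optimal open set, cover \<open>E\<close> by intervals \<open>I\<close>
  on which \<open>f\<close> rises with slope above \<open>s\<close>, and inside these cover
  \<open>E\<close> again by intervals \<open>J\<close> on which \<open>f\<close> falls. Both
  families nearly exhaust \<open>E\<close>, so the gaps between them are short and \<open>f\<close>
  varies little over them. The rise over \<open>I\<close> is at least \<open>s\<close> times its
  length, but it equals a fall over \<open>J\<close> plus the small variation over the gaps, which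
  forces the outer measure of \<open>E\<close> to be zero.\<close>

lemma ac_on_two_slopes_negligible:
  fixes f :: "real \<Rightarrow> real"
  assumes f: "ac_on a b f" and s: "s > 0" and E: "E \<subseteq> {a<..<b}"
    and up: "\<And>x d. x \<in> E \<Longrightarrow> d > 0 \<Longrightarrow> \<exists>u v. u < v \<and> x \<in> {u..v} \<and> v - u < d \<and> f v - f u > s * (v - u)"
    and dn: "\<And>x d. x \<in> E \<Longrightarrow> d > 0 \<Longrightarrow> \<exists>u v. u < v \<and> x \<in> {u..v} \<and> v - u < d \<and> f v - f u < - s * (v - u)"
  shows "negligible E"
proof -
  obtain e where e: "e \<ge> 0" "\<forall>T. T \<in> lmeasurable \<longrightarrow> E \<subseteq> T \<longrightarrow> e \<le> measure lebesgue T"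
    "\<forall>\<eta>>0. \<exists>U. open U \<and> U \<in> lmeasurable \<and> E \<subseteq> U \<and> U \<subseteq> {a<..<b} \<and> measure lebesgue U < e + \<eta>"
    using lmeasurable_open_approx[OF E] by blast
  have key: "s * e \<le> \<epsilon> * (1 + s)" if \<epsilon>: "\<epsilon> > 0" for \<epsilon>
  proof -
    obtain \<delta> where \<delta>: "\<delta> > 0" "\<forall>\<K>. \<K> division_of \<Union>\<K> \<longrightarrow> \<Union>\<K> \<subseteq> {a..b} \<longrightarrow> measure lebesgue (\<Union>\<K>) < \<delta> \<longrightarrow>
        (\<Sum>K\<in>\<K>. norm (f (Sup K) - f (Inf K))) < \<epsilon>"
      using ac_onD[OF f \<epsilon>] by blast
    define \<eta> where "\<eta> = min \<epsilon> (\<delta> / 8)"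
    have \<eta>: "\<eta> > 0" "\<eta> \<le> \<epsilon>" "4 * \<eta> < \<delta>" using \<epsilon> \<delta>(1) by (auto simp: \<eta>_def)
    obtain U where U: "open U" "U \<in> lmeasurable" "E \<subseteq> U" "U \<subseteq> {a<..<b}" "measure lebesgue U < e + \<eta>"
      using e(3)[rule_format, OF \<eta>(1)] by blast
    define P where "P K \<longleftrightarrow> f (Sup K) - f (Inf K) > s * (Sup K - Inf K)" for K
    obtain I T where I: "I division_of \<Union>I" "\<And>K. K \<in> I \<Longrightarrow> P K" "\<Union>I \<subseteq> U"
      and T: "T \<in> lmeasurable" "E \<subseteq> T" "measure lebesgue T \<le> measure lebesgue (\<Union>I) + \<eta>"
    proof (rule vitali_finite[OF U(1-3) \<eta>(1), of P])
      fix x d :: real assume "x \<in> E" "d > 0"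
      from up[OF this] obtain u v where "u < v" "x \<in> {u..v}" "v - u < d" "f v - f u > s * (v - u)" by blast
      then show "\<exists>u v. u < v \<and> x \<in> {u..v} \<and> v - u < d \<and> P {u..v}"
        by (intro exI[of _ u] exI[of _ v]) (auto simp: P_def)
    qed blast
    \<comment> \<open>The second covering needs an open set; passing to interiors loses only
      finitely many end points.\<close>
    define U' where "U' = (\<Union>K\<in>I. interior K)"
    have U'I: "U' \<subseteq> \<Union>I" using interior_subset by (auto simp: U'_def)
    have fI: "finite I" using I(1) by auto
    have Im: "\<Union>I \<in> lmeasurable" using lmeasurable_division[OF I(1)] .
    have U'm: "U' \<in> lmeasurable"
    proof (rule lmeasurable_open)
      have "U' \<subseteq> {a<..<b}" using U'I I(3) U(4) by blast
      then show "bounded U'" by (rule bounded_subset[rotated]) simp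
    qed (simp add: U'_def open_UN)
    define Q where "Q L \<longleftrightarrow> f (Sup L) - f (Inf L) < - s * (Sup L - Inf L) \<and> Inf L < Sup L \<and> (\<exists>K\<in>I. L \<subseteq> K)" for L
    obtain J T' where J: "J division_of \<Union>J" "\<And>K. K \<in> J \<Longrightarrow> Q K" "\<Union>J \<subseteq> U'"
      and T': "T' \<in> lmeasurable" "E \<inter> U' \<subseteq> T'" "measure lebesgue T' \<le> measure lebesgue (\<Union>J) + \<eta>"
    proof (rule vitali_finite[of U' "E \<inter> U'" \<eta> Q])
      show "open U'" by (auto simp: U'_def)
      fix x d :: real assume x: "x \<in> E \<inter> U'" and d: "d > 0"
      then obtain K where K: "K \<in> I" "x \<in> interior K" by (auto simp: U'_def)
      then obtain r where r: "r > 0" "ball x r \<subseteq> K" by (auto simp: mem_interior)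
      from dn[of x "min d r"] x d r obtain u v where uv: "u < v" "x \<in> {u..v}" "v - u < min d r"
        "f v - f u < - s * (v - u)" by auto
      have "{u..v} \<subseteq> ball x r" using uv by (auto simp: dist_real_def)
      then show "\<exists>u v. u < v \<and> x \<in> {u..v} \<and> v - u < d \<and> Q {u..v}"
        using uv r K by (intro exI[of _ u] exI[of _ v]) (auto simp: Q_def)
    qed (use U'm \<eta> in auto)
    obtain G where G: "G division_of \<Union>G" "\<Union>G \<subseteq> \<Union>I"
      "\<forall>f :: real \<Rightarrow> real. (\<Sum>K\<in>I. f (Sup K) - f (Inf K)) =
       (\<Sum>K\<in>J. f (Sup K) - f (Inf K)) + (\<Sum>K\<in>G. f (Sup K) - f (Inf K))"
      using division_gaps[OF I(1) J(1)] J(2) unfolding Q_def by blast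
    have mG: "measure lebesgue (\<Union>I) = measure lebesgue (\<Union>J) + measure lebesgue (\<Union>G)"
      using G(3)[rule_format, of id] by (simp add: division_measure[OF I(1)] division_measure[OF J(1)] division_measure[OF G(1)])
    have neg: "negligible (\<Union>I - U')"
    proof (rule negligible_subset)
      show "negligible (\<Union>K\<in>I. K - interior K)"
      proof (rule negligible_Union)
        show "finite ((\<lambda>K. K - interior K) ` I)" using fI by simp
        fix Z assume "Z \<in> (\<lambda>K. K - interior K) ` I"
        then obtain K where Z: "Z = K - interior K" and "K \<in> I" by blast
        then have "K - interior K \<subseteq> {Inf K, Sup K}"
          using division_interval(1,4)[OF I(1) \<open>K \<in> I\<close>] by fastforce
        then have "finite Z" unfolding Z by (rule finite_subset) simp
        then show "negligible Z" by (rule negligible_finite)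
      qed
      show "\<Union>I - U' \<subseteq> (\<Union>K\<in>I. K - interior K)" by (auto simp: U'_def)
    qed
    have mU: "measure lebesgue (U - \<Union>I) = measure lebesgue U - measure lebesgue (\<Union>I)"
      using I(3) U(2) Im by (simp add: measurable_measure_Diff fmeasurableD)
    have UIm: "U - \<Union>I \<in> lmeasurable" using U(2) Im by (simp add: fmeasurable.Diff)
    have "e \<le> measure lebesgue (T' \<union> ((U - \<Union>I) \<union> (\<Union>I - U')))"
    proof (rule e(2)[rule_format])
      show "T' \<union> ((U - \<Union>I) \<union> (\<Union>I - U')) \<in> lmeasurable"
        using T'(1) UIm neg by (intro fmeasurable.Un) (auto simp: negligible_imp_measurable)
    qed (use U T' in auto)
    also have "\<dots> \<le> measure lebesgue T' + (measure lebesgue (U - \<Union>I) + measure lebesgue (\<Union>I - U'))"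
      using T'(1) UIm neg
      by (intro order_trans[OF measure_Un_le] add_left_mono measure_Un_le sets.Un)
        (auto simp: negligible_imp_measurable fmeasurableD)
    finally have "e \<le> measure lebesgue (\<Union>J) + \<eta> + (measure lebesgue U - measure lebesgue (\<Union>I))"
      using T'(3) mU negligible_imp_measure0[OF neg] by linarith
    moreover have "e \<le> measure lebesgue (\<Union>I) + \<eta>" using e(2)[rule_format, OF T(1,2)] T(3) by linarith
    \<comment> \<open>The gaps have the length of \<open>I\<close> minus that of \<open>J\<close>,
      which the two covering estimates bound by \<open>2 * \<eta>\<close>.\<close>
    ultimately have "measure lebesgue (\<Union>G) < \<delta>" and eI: "e \<le> measure lebesgue (\<Union>I) + \<eta>"
      using mG U(5) \<eta> by linarith+
    then have Ge: "(\<Sum>K\<in>G. norm (f (Sup K) - f (Inf K))) < \<epsilon>"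
      using \<delta>(2)[rule_format, OF G(1)] G(2) I(3) U(4) greaterThanLessThan_subseteq_atLeastAtMost_iff by (meson order_trans order_refl)
    have "s * measure lebesgue (\<Union>I) \<le> (\<Sum>K\<in>I. f (Sup K) - f (Inf K))"
      unfolding division_measure[OF I(1)] sum_distrib_left
      by (intro sum_mono) (use I(2) in \<open>force simp: P_def\<close>)
    also have "\<dots> = (\<Sum>K\<in>J. f (Sup K) - f (Inf K)) + (\<Sum>K\<in>G. f (Sup K) - f (Inf K))"
      by (rule G(3)[rule_format])
    also have "(\<Sum>K\<in>J. f (Sup K) - f (Inf K)) \<le> 0"
    proof (rule sum_nonpos)
      fix K assume "K \<in> J"
      then have "f (Sup K) - f (Inf K) < - s * (Sup K - Inf K)" "Sup K - Inf K \<ge> 0"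
        using J(2) by (auto simp: Q_def less_imp_le)
      then show "f (Sup K) - f (Inf K) \<le> 0" using s by (smt (verit) mult_minus_left mult_nonneg_nonneg)
    qed
    also have "(\<Sum>K\<in>G. f (Sup K) - f (Inf K)) \<le> (\<Sum>K\<in>G. norm (f (Sup K) - f (Inf K)))"
      by (intro sum_mono) auto
    also have "0 + (\<Sum>K\<in>G. norm (f (Sup K) - f (Inf K))) \<le> \<epsilon>" using Ge by simp
    finally have *: "s * measure lebesgue (\<Union>I) \<le> \<epsilon>" by simp
    have "s * e \<le> s * (measure lebesgue (\<Union>I) + \<epsilon>)"
      using eI \<eta> s by (intro mult_left_mono) auto
    then show ?thesis using * by (simp add: algebra_simps)
  qed
  have "e \<le> 0"
  proof (rule ccontr)
    assume "\<not> e \<le> 0"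
    \<comment> \<open>This value of \<open>\<epsilon>\<close> turns \<open>key\<close> into
      \<open>s * e \<le> s * e / 2\<close>.\<close>
    then have "s * e \<le> (s * e / (2 * (1 + s))) * (1 + s)" using s by (intro key) auto
    also have "\<dots> = s * e / 2" using s by (simp add: field_simps)
    finally show False using s \<open>\<not> e \<le> 0\<close> by (simp add: mult_le_0_iff)
  qed
  show ?thesis
    unfolding negligible_outer
  proof (intro allI impI)
    fix \<eta> :: real assume "\<eta> > 0"
    from e(3)[rule_format, OF this] obtain U where U: "U \<in> lmeasurable" "E \<subseteq> U" "measure lebesgue U < e + \<eta>"
      by blast
    then have "measure lebesgue U < \<eta>" using \<open>e \<le> 0\<close> by linarith
    then show "\<exists>T. E \<subseteq> T \<and> T \<in> lmeasurable \<and> measure lebesgue T < \<eta>"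
      using U by blast
  qed
qed

text \<open>Take the \<open>\<delta>\<close> that belongs to variation 1. In a neighbourhood shorter
  than \<open>\<delta>\<close>, non-overlapping intervals with slope above \<open>n\<close> have
  total length below \<open>1 / n\<close>, so the set is locally null.\<close>

lemma ac_on_unbounded_slope_negligible:
  fixes f :: "real \<Rightarrow> real"
  assumes f: "ac_on a b f" and E: "E \<subseteq> {a<..<b}"
    and up: "\<And>x d n. x \<in> E \<Longrightarrow> d > 0 \<Longrightarrow> \<exists>u v. u < v \<and> x \<in> {u..v} \<and> v - u < d \<and> \<bar>f v - f u\<bar> > real n * (v - u)"
  shows "negligible E"
proof (rule locally_negligible_alt[THEN iffD2], rule ballI)
  fix x assume x: "x \<in> E"
  obtain \<delta> where \<delta>: "\<delta> > 0" "\<forall>\<K>. \<K> division_of \<Union>\<K> \<longrightarrow> \<Union>\<K> \<subseteq> {a..b} \<longrightarrow> measure lebesgue (\<Union>\<K>) < \<delta> \<longrightarrow>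
      (\<Sum>K\<in>\<K>. norm (f (Sup K) - f (Inf K))) < 1"
    using ac_onD[OF f zero_less_one] by blast
  define U where "U = {x - \<delta> / 3<..<x + \<delta> / 3} \<inter> {a<..<b}"
  have U: "open U" "U \<in> lmeasurable" by (auto simp: U_def intro!: fmeasurable.Int)
  have "measure lebesgue U \<le> measure lebesgue {x - \<delta> / 3<..<x + \<delta> / 3}"
    by (intro measure_mono_fmeasurable) (auto simp: U_def)
  then have mU: "measure lebesgue U < \<delta>" using \<delta>(1) by simp
  have "negligible (E \<inter> U)"
    unfolding negligible_outer
  proof (intro allI impI)
    fix \<eta> :: real assume \<eta>: "\<eta> > 0"
    obtain n :: nat where n: "real n > 2 / \<eta>" using reals_Archimedean2 by blast
    have n0: "real n > 0" using \<eta> n by (smt (verit) divide_pos_pos)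
    then have n1: "1 / real n < \<eta> / 2" using n \<eta> by (simp add: field_simps)
    define P where "P K \<longleftrightarrow> \<bar>f (Sup K) - f (Inf K)\<bar> > real n * (Sup K - Inf K)" for K
    obtain I T where I: "I division_of \<Union>I" "\<And>K. K \<in> I \<Longrightarrow> P K" "\<Union>I \<subseteq> U"
      and T: "T \<in> lmeasurable" "E \<inter> U \<subseteq> T" "measure lebesgue T \<le> measure lebesgue (\<Union>I) + \<eta> / 2"
    proof (rule vitali_finite[of U "E \<inter> U" "\<eta> / 2" P])
      fix x d :: real assume "x \<in> E \<inter> U" "d > 0"
      then obtain u v where "u < v" "x \<in> {u..v}" "v - u < d" "\<bar>f v - f u\<bar> > real n * (v - u)"
        using up[of x d n] by auto
      then show "\<exists>u v. u < v \<and> x \<in> {u..v} \<and> v - u < d \<and> P {u..v}"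
        by (intro exI[of _ u] exI[of _ v]) (auto simp: P_def)
    qed (use U \<eta> in auto)
    have "measure lebesgue (\<Union>I) \<le> measure lebesgue U"
      using I(3) U lmeasurable_division[OF I(1)] by (intro measure_mono_fmeasurable) auto
    then have "(\<Sum>K\<in>I. norm (f (Sup K) - f (Inf K))) < 1"
      using mU I(1,3) by (intro \<delta>(2)[rule_format]) (auto simp: U_def)
    moreover have "real n * measure lebesgue (\<Union>I) \<le> (\<Sum>K\<in>I. norm (f (Sup K) - f (Inf K)))"
      unfolding division_measure[OF I(1)] sum_distrib_left
      by (intro sum_mono) (use I(2) in \<open>force simp: P_def\<close>)
    ultimately have "measure lebesgue (\<Union>I) < 1 / real n" using n0 by (simp add: field_simps)
    then show "\<exists>S. E \<inter> U \<subseteq> S \<and> S \<in> lmeasurable \<and> measure lebesgue S < \<eta>"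
      using T n0 n1 by (intro exI[of _ T]) auto
  qed
  moreover have "x \<in> E \<inter> U" using x E \<delta>(1) by (auto simp: U_def)
  ultimately show "\<exists>V. openin (top_of_set E) V \<and> x \<in> V \<and> negligible V"
    using openin_open_Int[OF U(1)] by blast
qed

text \<open>Absolute continuity is transferred through this estimate to real and imaginary parts, to
  sums with linear functions, to products with Lipschitz functions and, with \<open>A = 0\<close>,
  to Lipschitz functions themselves.\<close>

lemma ac_on_dominated:
  assumes f: "ac_on a b f"
    and g: "\<And>u v. a \<le> u \<Longrightarrow> u \<le> v \<Longrightarrow> v \<le> b \<Longrightarrow> norm (g v - g u) \<le> A * norm (f v - f u) + B * (v - u)"
    and AB: "A \<ge> 0" "B \<ge> 0"
  shows "ac_on a b g"
  unfolding ac_on_def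
proof (intro allI impI)
  fix \<epsilon> :: real assume \<epsilon>: "\<epsilon> > 0"
  define e1 where "e1 = \<epsilon> / (2 * (A + 1))"
  have e1: "e1 > 0" "A * e1 \<le> \<epsilon> / 2" using \<epsilon> AB by (auto simp: e1_def field_simps)
  obtain \<delta> where \<delta>: "\<delta> > 0" "\<forall>\<K>. \<K> division_of \<Union>\<K> \<longrightarrow> \<Union>\<K> \<subseteq> {a..b} \<longrightarrow> measure lebesgue (\<Union>\<K>) < \<delta> \<longrightarrow>
      (\<Sum>K\<in>\<K>. norm (f (Sup K) - f (Inf K))) < e1"
    using ac_onD[OF f e1(1)] by blast
  define d where "d = min \<delta> (\<epsilon> / (2 * (B + 1)))"
  have d: "d > 0" "d \<le> \<delta>" "B * d < \<epsilon> / 2"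
  proof -
    have "B * d \<le> B * (\<epsilon> / (2 * (B + 1)))" unfolding d_def using AB by (intro mult_left_mono) auto
    also have "\<dots> < \<epsilon> / 2" using AB \<epsilon> by (simp add: field_simps)
    finally show "B * d < \<epsilon> / 2" .
  qed (use \<delta> \<epsilon> AB in \<open>auto simp: d_def\<close>)
  show "\<exists>\<delta>>0. \<forall>\<K>. \<K> division_of \<Union>\<K> \<and> \<Union>\<K> \<subseteq> {a..b} \<and> measure lebesgue (\<Union>\<K>) < \<delta> \<longrightarrow>
        (\<Sum>K\<in>\<K>. norm (g (Sup K) - g (Inf K))) < \<epsilon>"
  proof (intro exI[of _ d] conjI allI impI d(1), elim conjE)
    fix \<K> :: "real set set" assume K: "\<K> division_of \<Union>\<K>" "\<Union>\<K> \<subseteq> {a..b}" "measure lebesgue (\<Union>\<K>) < d"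
    have "(\<Sum>K\<in>\<K>. norm (g (Sup K) - g (Inf K))) \<le>
        (\<Sum>K\<in>\<K>. A * norm (f (Sup K) - f (Inf K)) + B * (Sup K - Inf K))"
    proof (intro sum_mono g)
      fix L assume L: "L \<in> \<K>"
      have "L \<subseteq> {a..b}" using L K(2) by blast
      then have "{Inf L..Sup L} \<subseteq> {a..b}" "Inf L \<le> Sup L"
        using division_interval(1,2)[OF K(1) L] by auto
      then show "a \<le> Inf L" "Inf L \<le> Sup L" "Sup L \<le> b" by auto
    qed
    also have "\<dots> = A * (\<Sum>K\<in>\<K>. norm (f (Sup K) - f (Inf K))) + B * measure lebesgue (\<Union>\<K>)"
      by (simp add: sum.distrib sum_distrib_left division_measure[OF K(1)])
    also have "\<dots> \<le> A * e1 + B * d"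
      using AB K \<delta>(2) d(2) by (intro add_mono mult_left_mono) (auto simp: less_imp_le)
    also have "\<dots> < \<epsilon>" using e1 d by linarith
    finally show "(\<Sum>K\<in>\<K>. norm (g (Sup K) - g (Inf K))) < \<epsilon>" .
  qed
qed

lemma ac_on_continuous:
  assumes "ac_on a b f" shows "continuous_on {a..b} f"
  unfolding continuous_on_iff
proof (intro ballI allI impI)
  fix x e :: real assume x: "x \<in> {a..b}" and e: "e > 0"
  obtain \<delta> where \<delta>: "\<delta> > 0" "\<forall>\<K>. \<K> division_of \<Union>\<K> \<longrightarrow> \<Union>\<K> \<subseteq> {a..b} \<longrightarrow> measure lebesgue (\<Union>\<K>) < \<delta> \<longrightarrow>
      (\<Sum>K\<in>\<K>. norm (f (Sup K) - f (Inf K))) < e"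
    using ac_onD[OF assms e] by blast
  show "\<exists>d>0. \<forall>x'\<in>{a..b}. dist x' x < d \<longrightarrow> dist (f x') (f x) < e"
  proof (intro exI[of _ \<delta>] conjI ballI impI \<delta>(1))
    fix y assume y: "y \<in> {a..b}" "dist y x < \<delta>"
    have "{{min x y..max x y}} division_of \<Union>{{min x y..max x y}}"
      using division_of_self[of "min x y" "max x y"] by simp
    moreover have "measure lebesgue {min x y..max x y} < \<delta>" using y by (auto simp: dist_real_def)
    ultimately have "(\<Sum>K\<in>{{min x y..max x y}}. norm (f (Sup K) - f (Inf K))) < e"
      using x y by (intro \<delta>(2)[rule_format]) auto
    then have "norm (f (max x y) - f (min x y)) < e" by simp
    then show "dist (f y) (f x) < e"
      by (auto simp: dist_norm max_def min_def norm_minus_commute split: if_splits)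
  qed
qed

lemma ac_on_mult:
  fixes f g :: "real \<Rightarrow> 'a::real_normed_algebra"
  assumes f: "ac_on a b f" and ab: "a \<le> b" and g: "\<And>u v. a \<le> u \<Longrightarrow> u \<le> v \<Longrightarrow> v \<le> b \<Longrightarrow> norm (g v - g u) \<le> L * (v - u)"
    and gB: "\<And>u. a \<le> u \<Longrightarrow> u \<le> b \<Longrightarrow> norm (g u) \<le> L"
  shows "ac_on a b (\<lambda>x. g x * f x)"
proof -
  have "bounded (f ` {a..b})"
    using ac_on_continuous[OF f] compact_continuous_image compact_imp_bounded by blast
  then obtain M where M: "M > 0" "\<And>x. x \<in> {a..b} \<Longrightarrow> norm (f x) \<le> M"
    unfolding bounded_pos by auto
  have L: "L \<ge> 0" using gB[of a] ab norm_ge_zero order_trans by blast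
  show ?thesis
  proof (rule ac_on_dominated[OF f])
    fix u v assume uv: "a \<le> u" "u \<le> v" "v \<le> b"
    have "g v * f v - g u * f u = g v * (f v - f u) + (g v - g u) * f u" by (simp add: algebra_simps)
    also have "norm \<dots> \<le> norm (g v) * norm (f v - f u) + norm (g v - g u) * norm (f u)"
      by (intro order_trans[OF norm_triangle_ineq] add_mono norm_mult_ineq)
    also have "\<dots> \<le> L * norm (f v - f u) + (L * (v - u)) * M"
      using uv M gB g L by (intro add_mono mult_mono) auto
    finally show "norm (g v * f v - g u * f u) \<le> L * norm (f v - f u) + (L * M) * (v - u)"
      by (simp add: mult_ac)
  qed (use L M in auto)
qed

lemma ac_on_lipschitz:
  assumes "\<And>u v. a \<le> u \<Longrightarrow> u \<le> v \<Longrightarrow> v \<le> b \<Longrightarrow> norm (g v - g u) \<le> L * (v - u)" "L \<ge> 0"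
  shows "ac_on a b g"
proof (rule ac_on_dominated[of _ _ "\<lambda>_. 0::real" _ 0 L])
  show "ac_on a b (\<lambda>_. 0 :: real)" by (auto simp: ac_on_def intro: exI[of _ 1])
qed (use assms in auto)

text \<open>A real function fails to be differentiable at \<open>x\<close> only if its difference quotients at \<open>x\<close>
  are unbounded or oscillate across some interval with rational end points.\<close>

lemma ac_on_ae_differentiable_real:
  fixes f :: "real \<Rightarrow> real"
  assumes f: "ac_on a b f"
  shows "\<exists>S. negligible S \<and> (\<forall>x\<in>{a<..<b} - S. \<exists>D. (f has_real_derivative D) (at x))"
proof -
  define Q where "Q x y = (f y - f x) / (y - x)" for x y
  define E where "E p q = {x \<in> {a<..<b}. (\<exists>\<^sub>F y in at x. Q x y > q) \<and> (\<exists>\<^sub>F y in at x. Q x y < p)}" for p q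
  define F where "F = {x \<in> {a<..<b}. \<forall>n::nat. \<exists>\<^sub>F y in at x. \<bar>Q x y\<bar> > real n}"
  have freq: "\<exists>u v. u < v \<and> x \<in> {u..v} \<and> v - u < d \<and> R ((f v - f u) / (v - u))"
    if fr: "\<exists>\<^sub>F y in at x. R (Q x y)" and d: "d > 0" for x d R
  proof -
    have "\<exists>\<^sub>F y in at x. R (Q x y) \<and> (y \<noteq> x \<and> dist y x < d)"
      using d by (intro frequently_eventually_frequently[OF fr]) (auto simp: eventually_at)
    then obtain y where y: "R (Q x y)" "y \<noteq> x" "dist y x < d" using frequently_ex by force
    \<comment> \<open>The difference quotient is symmetric in its points, so \<open>x\<close> may be
      either end of the interval.\<close>
    have "(f (max x y) - f (min x y)) / (max x y - min x y) = Q x y"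
      using y(2) by (auto simp: Q_def max_def min_def divide_simps) (simp add: algebra_simps)
    then show ?thesis using y
      by (intro exI[of _ "min x y"] exI[of _ "max x y"]) (auto simp: dist_real_def)
  qed
  have negE: "negligible (E p q)" if pq: "p < q" for p q
  proof -
    \<comment> \<open>Subtracting the mean slope \<open>c\<close> turns slopes above
      \<open>q\<close> and below \<open>p\<close> into slopes above \<open>s\<close> and below
      \<open>- s\<close>.\<close>
    define c where "c = (p + q) / 2"
    define s where "s = (q - p) / 2"
    have s: "s > 0" using pq by (simp add: s_def)
    show ?thesis
    proof (rule ac_on_two_slopes_negligible[of a b "\<lambda>x. f x - c * x" s])
      show "ac_on a b (\<lambda>x. f x - c * x)"
      proof (rule ac_on_dominated[OF f, of _ 1 "\<bar>c\<bar>"])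
        fix u v :: real assume uv: "u \<le> v"
        have "norm (f v - c * v - (f u - c * u)) \<le> norm (f v - f u) + norm (c * (v - u))"
          using norm_triangle_ineq4[of "f v - f u" "c * (v - u)"] by (simp add: algebra_simps)
        then show "norm (f v - c * v - (f u - c * u)) \<le> 1 * norm (f v - f u) + \<bar>c\<bar> * (v - u)"
          using uv by (simp add: abs_mult)
      qed auto
      show "E p q \<subseteq> {a<..<b}" by (auto simp: E_def)
      fix x d :: real assume x: "x \<in> E p q" and d: "d > 0"
      obtain u v where uv: "u < v" "x \<in> {u..v}" "v - u < d" "(f v - f u) / (v - u) > q"
        using freq[where R="\<lambda>t. t > q", OF _ d, of x] x by (auto simp: E_def)
      then have "f v - f u > q * (v - u)" by (simp add: field_simps)
      then have "f v - c * v - (f u - c * u) > s * (v - u)" by (simp add: c_def s_def field_simps)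
      then show "\<exists>u v. u < v \<and> x \<in> {u..v} \<and> v - u < d \<and> f v - c * v - (f u - c * u) > s * (v - u)"
        using uv by blast
      obtain u v where uv: "u < v" "x \<in> {u..v}" "v - u < d" "(f v - f u) / (v - u) < p"
        using freq[where R="\<lambda>t. t < p", OF _ d, of x] x by (auto simp: E_def)
      then have "f v - f u < p * (v - u)" by (simp add: field_simps)
      then have "f v - c * v - (f u - c * u) < - s * (v - u)" by (simp add: c_def s_def field_simps)
      then show "\<exists>u v. u < v \<and> x \<in> {u..v} \<and> v - u < d \<and> f v - c * v - (f u - c * u) < - s * (v - u)"
        using uv by blast
    qed (fact s)
  qed
  have negF: "negligible F"
  proof (rule ac_on_unbounded_slope_negligible[OF f])
    show "F \<subseteq> {a<..<b}" by (auto simp: F_def)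
    fix x d :: real and n :: nat assume x: "x \<in> F" and d: "d > 0"
    obtain u v where uv: "u < v" "x \<in> {u..v}" "v - u < d" "\<bar>(f v - f u) / (v - u)\<bar> > real n"
      using freq[where R="\<lambda>t. \<bar>t\<bar> > real n", OF _ d, of x] x by (auto simp: F_def)
    then have "\<bar>f v - f u\<bar> > real n * (v - u)" by (simp add: field_simps)
    then show "\<exists>u v. u < v \<and> x \<in> {u..v} \<and> v - u < d \<and> \<bar>f v - f u\<bar> > real n * (v - u)"
      using uv by blast
  qed
  define S where "S = F \<union> (\<Union>(p, q)\<in>{(p, q). p \<in> \<rat> \<and> q \<in> \<rat> \<and> p < q}. E p q)"
  have "negligible (\<Union>((\<lambda>(p, q). E p q) ` {(p, q). p \<in> \<rat> \<and> q \<in> \<rat> \<and> p < q}))"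
  proof (rule negligible_countable_Union)
    have "countable (\<rat> \<times> \<rat> :: (real \<times> real) set)" using countable_rat by blast
    then show "countable ((\<lambda>(p, q). E p q) ` {(p, q). p \<in> \<rat> \<and> q \<in> \<rat> \<and> p < q})"
      by (intro countable_image) (rule countable_subset[rotated], auto)
  qed (auto simp: negE)
  then have "negligible S" unfolding S_def using negF by simp
  moreover have "\<exists>D. (f has_real_derivative D) (at x)" if x: "x \<in> {a<..<b} - S" for x
  proof -
    have osc: "\<not> ((\<exists>\<^sub>F y in at x. Q x y > q) \<and> (\<exists>\<^sub>F y in at x. Q x y < p))" if "p \<in> \<rat>" "q \<in> \<rat>" "p < q" for p q
      using x that by (auto simp: S_def E_def)
    \<comment> \<open>Boundedness of the quotients makes their upper and lower limits finite; if
      these differed, two rationals would fit between them.\<close>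
    obtain n :: nat where "\<not> (\<exists>\<^sub>F y in at x. \<bar>Q x y\<bar> > real n)"
      using x by (auto simp: S_def F_def)
    then have n: "\<forall>\<^sub>F y in at x. \<bar>Q x y\<bar> \<le> real n"
      by (simp add: frequently_def not_less)
    define ls where "ls = Limsup (at x) (\<lambda>y. ereal (Q x y))"
    define li where "li = Liminf (at x) (\<lambda>y. ereal (Q x y))"
    have nt: "at x \<noteq> bot" by simp
    have "ls \<le> ereal (real n)" unfolding ls_def
      by (rule Limsup_bounded) (use n in \<open>auto elim: eventually_mono\<close>)
    moreover have "ereal (- real n) \<le> li" unfolding li_def
      by (rule Liminf_bounded) (use n in \<open>auto elim!: eventually_mono\<close>)
    moreover have le: "li \<le> ls" unfolding li_def ls_def by (rule Liminf_le_Limsup[OF nt])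
    ultimately have fin: "\<bar>ls\<bar> \<noteq> \<infinity>" "\<bar>li\<bar> \<noteq> \<infinity>" by (cases ls; cases li; auto)+
    have "\<not> li < ls"
    proof
      assume lt: "li < ls"
      obtain l1 l2 where l: "li = ereal l1" "ls = ereal l2" using fin by (metis ereal_real')
      then have "l1 < l2" using lt by simp
      then obtain p where p: "p \<in> \<rat>" "l1 < p" "p < l2" using Rats_dense_in_real by blast
      obtain q where q: "q \<in> \<rat>" "p < q" "q < l2" using Rats_dense_in_real p(3) by blast
      have "\<exists>\<^sub>F y in at x. Q x y > q"
      proof (rule ccontr)
        assume "\<not> ?thesis"
        then have "\<forall>\<^sub>F y in at x. ereal (Q x y) \<le> ereal q" by (simp add: frequently_def not_less)
        then have "ls \<le> ereal q" unfolding ls_def by (rule Limsup_bounded)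
        then show False using q l by simp
      qed
      moreover have "\<exists>\<^sub>F y in at x. Q x y < p"
      proof (rule ccontr)
        assume "\<not> ?thesis"
        then have "\<forall>\<^sub>F y in at x. ereal p \<le> ereal (Q x y)" by (simp add: frequently_def not_less)
        then have "ereal p \<le> li" unfolding li_def by (rule Liminf_bounded)
        then show False using p l by simp
      qed
      ultimately show False using osc p q by blast
    qed
    then have "li = ls" using le by simp
    then have "((\<lambda>y. ereal (Q x y)) \<longlongrightarrow> ls) (at x)"
      unfolding li_def ls_def using tendsto_iff_Liminf_eq_Limsup[OF nt, of "\<lambda>y. ereal (Q x y)"] by simp
    moreover obtain D where "ls = ereal D" using fin by (metis ereal_real')
    ultimately have "(Q x \<longlongrightarrow> D) (at x)" by simp
    then have "(f has_real_derivative D) (at x)"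
      unfolding has_field_derivative_iff Q_def[abs_def] .
    then show ?thesis by blast
  qed
  ultimately show ?thesis by blast
qed

lemma ac_on_ae_differentiable:
  fixes f :: "real \<Rightarrow> complex"
  assumes f: "ac_on a b f"
  shows "\<exists>S. negligible S \<and> (\<forall>x\<in>{a<..<b} - S. \<exists>D. (f has_vector_derivative D) (at x))"
proof -
  have "ac_on a b (\<lambda>x. Re (f x))" "ac_on a b (\<lambda>x. Im (f x))"
    by (rule ac_on_dominated[OF f, of _ 1 0];
        auto simp flip: minus_complex.sel simp: abs_Re_le_cmod abs_Im_le_cmod)+
  from this[THEN ac_on_ae_differentiable_real]
  obtain S T where S: "negligible S" "\<forall>x\<in>{a<..<b} - S. \<exists>D. ((\<lambda>x. Re (f x)) has_real_derivative D) (at x)"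
    and T: "negligible T" "\<forall>x\<in>{a<..<b} - T. \<exists>D. ((\<lambda>x. Im (f x)) has_real_derivative D) (at x)" by blast
  show ?thesis
  proof (intro exI[of _ "S \<union> T"] conjI ballI)
    fix x assume "x \<in> {a<..<b} - (S \<union> T)"
    then obtain D1 D2 where D: "((\<lambda>x. Re (f x)) has_real_derivative D1) (at x)"
      "((\<lambda>x. Im (f x)) has_real_derivative D2) (at x)" using S T by blast
    have "((\<lambda>x. of_real (Re (f x)) + \<i> * of_real (Im (f x))) has_vector_derivative (of_real D1 + \<i> * of_real D2)) (at x)"
    proof (intro has_vector_derivative_add has_vector_derivative_mult_right)
      show "((\<lambda>x. complex_of_real (Re (f x))) has_vector_derivative of_real D1) (at x)"
        "((\<lambda>x. complex_of_real (Im (f x))) has_vector_derivative of_real D2) (at x)"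
        using D by (auto intro!: bounded_linear.has_vector_derivative[OF bounded_linear_of_real]
          simp: has_real_derivative_iff_has_vector_derivative)
    qed
    then show "\<exists>D. (f has_vector_derivative D) (at x)"
      by (simp flip: complex_eq) blast
  qed (use S T in auto)
qed

section \<open>The fundamental theorem of calculus for absolutely continuous functions\<close>

text \<open>At tags outside \<open>S\<close> the gauge enforces the differential estimate with error
  \<open>\<epsilon>\<close>. At tags in \<open>S\<close> it confines the intervals to an open set of
  small measure, where absolute continuity bounds the increments of \<open>f\<close>; the integrand
  is put to zero on \<open>S\<close>, so that these tags contribute nothing else.\<close>

lemma ac_on_has_integral:
  fixes f :: "real \<Rightarrow> 'a::banach"
  assumes f: "ac_on a b f" and ab: "a \<le> b" and S: "negligible S"
    and D: "\<And>x. x \<in> {a..b} - S \<Longrightarrow> (f has_vector_derivative g x) (at x within {a..b})"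
  shows "(g has_integral (f b - f a)) {a..b}"
proof (rule has_integral_spike[OF S])
  define g' where "g' x = (if x \<in> S then 0 else g x)" for x
  show "g x = g' x" if "x \<in> {a..b} - S" for x using that by (simp add: g'_def)
  show "(g' has_integral (f b - f a)) {a..b}"
    unfolding has_integral_real
  proof (intro allI impI)
    fix e :: real assume e: "e > 0"
    define \<epsilon> where "\<epsilon> = e / (2 * (b - a + 1))"
    have \<epsilon>: "\<epsilon> > 0" "\<epsilon> * (b - a) \<le> e / 2" using e ab by (auto simp: \<epsilon>_def field_simps)
    obtain \<delta> where \<delta>: "\<delta> > 0" "\<forall>\<K>. \<K> division_of \<Union>\<K> \<longrightarrow> \<Union>\<K> \<subseteq> {a..b} \<longrightarrow> measure lebesgue (\<Union>\<K>) < \<delta> \<longrightarrow>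
        (\<Sum>K\<in>\<K>. norm (f (Sup K) - f (Inf K))) < e / 2"
      using ac_onD[OF f, of "e / 2"] e by auto
    obtain U where U: "open U" "S \<subseteq> U" "U \<in> lmeasurable" "measure lebesgue U < \<delta>"
    proof -
      obtain V where V: "open V" "S \<subseteq> V" "(V - S) \<in> lmeasurable" "emeasure lebesgue (V - S) < ennreal \<delta>"
        using sets_lebesgue_outer_open[OF negligible_imp_sets[OF S] \<delta>(1)] by metis
      have "V = S \<union> (V - S)" using V(2) by blast
      then have "V \<in> lmeasurable" "measure lebesgue V \<le> measure lebesgue S + measure lebesgue (V - S)"
        using measure_Un_le[of S lebesgue "V - S"] fmeasurable.Un[OF negligible_imp_measurable[OF S] V(3)]
          negligible_imp_sets[OF S] V(3) by (auto simp: fmeasurableD)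
      moreover have "measure lebesgue (V - S) < \<delta>"
        using V(3,4) \<delta>(1) by (simp add: emeasure_eq_measure2 fmeasurableD2 ennreal_less_iff)
      ultimately show ?thesis using that[of V] V negligible_imp_measure0[OF S] by simp
    qed
    have "\<exists>d>0. x \<in> {a..b} - S \<longrightarrow> (\<forall>y\<in>{a..b}. norm (y - x) < d \<longrightarrow>
        norm (f y - f x - (y - x) *\<^sub>R g x) \<le> \<epsilon> * norm (y - x))" for x
    proof (cases "x \<in> {a..b} - S")
      case True
      from D[OF True] \<epsilon>(1) show ?thesis
        unfolding has_vector_derivative_def has_derivative_within_alt by blast
    qed (auto intro: exI[of _ 1])
    then obtain d where d: "\<And>x. d x > 0" "\<And>x y. x \<in> {a..b} - S \<Longrightarrow> y \<in> {a..b} \<Longrightarrow> norm (y - x) < d x \<Longrightarrow>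
        norm (f y - f x - (y - x) *\<^sub>R g x) \<le> \<epsilon> * norm (y - x)"
      by metis
    define \<gamma> where "\<gamma> x = (if x \<in> S then U else ball x (d x))" for x
    have "gauge \<gamma>" using U d(1) by (auto simp: \<gamma>_def gauge_def)
    moreover have "norm ((\<Sum>(x, K)\<in>\<D>. measure lborel K *\<^sub>R g' x) - (f b - f a)) < e"
      if \<D>: "\<D> tagged_division_of {a..b}" "\<gamma> fine \<D>" for \<D>
    proof -
      note td = tagged_division_ofD[OF \<D>(1)]
      have K: "K = {Inf K..Sup K}" "Inf K \<le> Sup K" "measure lborel K = Sup K - Inf K" "K \<subseteq> {a..b}" "x \<in> K"
        "K \<subseteq> \<gamma> x" if xK: "(x, K) \<in> \<D>" for x K
      proof -
        show "K \<subseteq> {a..b}" "x \<in> K" "K \<subseteq> \<gamma> x" using td(2,3)[OF xK] fineD[OF \<D>(2) xK] by auto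
        obtain u v where "K = cbox u v" using td(4)[OF xK] by blast
        then have "K = {u..v}" "u \<le> v" using \<open>x \<in> K\<close> by auto
        then show "K = {Inf K..Sup K}" "Inf K \<le> Sup K" "measure lborel K = Sup K - Inf K" by auto
      qed
      define D1 where "D1 = {p \<in> \<D>. fst p \<in> S}"
      have fin: "finite \<D>" by (rule td(1))
      have "(\<Sum>(x, K)\<in>\<D>. measure lborel K *\<^sub>R g' x) - (f b - f a)
          = (\<Sum>(x, K)\<in>\<D>. measure lborel K *\<^sub>R g' x - (f (Sup K) - f (Inf K)))"
        using additive_tagged_division_1[OF ab \<D>(1), of f] by (simp add: sum_subtractf case_prod_unfold)
      also have "\<dots> = (\<Sum>(x, K)\<in>\<D> - D1. measure lborel K *\<^sub>R g' x - (f (Sup K) - f (Inf K)))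
          + (\<Sum>(x, K)\<in>D1. measure lborel K *\<^sub>R g' x - (f (Sup K) - f (Inf K)))"
        by (rule sum.subset_diff) (auto simp: D1_def fin)
      also have "norm \<dots> \<le> \<epsilon> * (b - a) + (\<Sum>(x, K)\<in>D1. norm (f (Sup K) - f (Inf K)))"
      proof (rule order_trans[OF norm_triangle_ineq], rule add_mono)
        have "norm (\<Sum>(x, K)\<in>\<D> - D1. measure lborel K *\<^sub>R g' x - (f (Sup K) - f (Inf K)))
            \<le> (\<Sum>(x, K)\<in>\<D> - D1. \<epsilon> * (Sup K - Inf K))"
        proof (rule sum_norm_le, clarify)
          fix x K assume xK: "(x, K) \<in> \<D>" "(x, K) \<notin> D1"
          then have x: "x \<in> {a..b} - S" "x \<notin> S" using td(2,3)[OF xK(1)] by (auto simp: D1_def)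
          note KK = K[OF xK(1)]
          have "{Inf K..Sup K} \<subseteq> ball x (d x)" using KK(1,6) x(2) by (simp add: \<gamma>_def)
          moreover have "Inf K \<in> {Inf K..Sup K}" "Sup K \<in> {Inf K..Sup K}" using KK(2) by auto
          ultimately have b: "Inf K \<in> ball x (d x)" "Sup K \<in> ball x (d x)" by blast+
          have i: "Inf K \<in> {a..b}" "Sup K \<in> {a..b}" "x \<in> {Inf K..Sup K}"
            using KK(1,2,4,5) by (metis atLeastAtMost_iff order_refl subsetD)+
          have 1: "norm (f (Inf K) - f x - (Inf K - x) *\<^sub>R g x) \<le> \<epsilon> * (x - Inf K)"
            using d(2)[OF x(1) i(1)] b i(3) by (simp add: dist_real_def)
          have 2: "norm (f (Sup K) - f x - (Sup K - x) *\<^sub>R g x) \<le> \<epsilon> * (Sup K - x)"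
            using d(2)[OF x(1) i(2)] b i(3) by (simp add: dist_real_def)
          have "measure lborel K *\<^sub>R g' x - (f (Sup K) - f (Inf K))
              = (f (Inf K) - f x - (Inf K - x) *\<^sub>R g x) - (f (Sup K) - f x - (Sup K - x) *\<^sub>R g x)"
            unfolding KK(3) g'_def using x(2) by (simp add: algebra_simps)
          also have "norm \<dots> \<le> \<epsilon> * (x - Inf K) + \<epsilon> * (Sup K - x)"
            by (rule order_trans[OF norm_triangle_ineq4 add_mono[OF 1 2]])
          finally show "norm (measure lborel K *\<^sub>R g' x - (f (Sup K) - f (Inf K))) \<le> \<epsilon> * (Sup K - Inf K)"
            by (simp add: algebra_simps)
        qed
        also have "\<dots> \<le> (\<Sum>(x, K)\<in>\<D>. \<epsilon> * (Sup K - Inf K))"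
          using K(2) \<epsilon>(1) by (intro sum_mono2 fin) (auto simp: D1_def)
        also have "\<dots> = \<epsilon> * (b - a)"
          using additive_tagged_division_1[OF ab \<D>(1), of id]
          by (simp add: case_prod_unfold flip: sum_distrib_left)
        finally show "norm (\<Sum>(x, K)\<in>\<D> - D1. measure lborel K *\<^sub>R g' x - (f (Sup K) - f (Inf K))) \<le> \<epsilon> * (b - a)" .
        show "norm (\<Sum>(x, K)\<in>D1. measure lborel K *\<^sub>R g' x - (f (Sup K) - f (Inf K)))
            \<le> (\<Sum>(x, K)\<in>D1. norm (f (Sup K) - f (Inf K)))"
          by (rule sum_norm_le) (auto simp: D1_def g'_def norm_minus_commute)
      qed
      also have "(\<Sum>(x, K)\<in>D1. norm (f (Sup K) - f (Inf K))) < e / 2"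
      proof -
        have "D1 tagged_partial_division_of {a..b}"
          using \<D>(1) by (auto simp: D1_def tagged_division_of_def intro: tagged_partial_division_subset)
        then have D1: "D1 tagged_division_of \<Union>(snd ` D1)"
          by (rule tagged_partial_division_of_Union_self)
        have div: "snd ` D1 division_of \<Union>(snd ` D1)"
          by (rule division_of_tagged_division[OF D1])
        \<comment> \<open>\<open>Sup\<close> and \<open>Inf\<close> of the empty set are
          unspecified. The value 0 there makes \<open>h\<close> vanish on all intervals with empty
          interior, which allows the sum over tagged intervals to become a sum over the set of
          intervals.\<close>
        define h where "h K = (if K = {} then 0 else norm (f (Sup K) - f (Inf K)))" for K
        have h: "h K = norm (f (Sup K) - f (Inf K))" if "(x, K) \<in> D1" for x K
          using that K(5) by (auto simp: h_def D1_def)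
        have "(\<Sum>(x, K)\<in>D1. norm (f (Sup K) - f (Inf K))) = (\<Sum>(x, K)\<in>D1. h K)"
          by (intro sum.cong refl) (auto simp: h)
        also have "\<dots> = (\<Sum>K\<in>snd ` D1. h K)"
        proof (rule sum.over_tagged_division_lemma[OF D1])
          fix u v :: real assume "box u v = {}"
          then show "h (cbox u v) = 0" by (cases "u = v") (auto simp: h_def)
        qed
        also have "\<dots> = (\<Sum>K\<in>snd ` D1. norm (f (Sup K) - f (Inf K)))"
          by (intro sum.cong refl) (auto simp: h)
        also have "\<dots> < e / 2"
        proof (intro \<delta>(2)[rule_format] div)
          have "L \<subseteq> {a..b}" if "(x, L) \<in> D1" for x L
            using that K(4)[of x L] by (simp add: D1_def)
          then show "\<Union>(snd ` D1) \<subseteq> {a..b}" by (intro Union_least) (metis imageE prod.collapse)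
          have "L \<subseteq> U" if "(x, L) \<in> D1" for x L
            using that K(6)[of x L] by (simp add: D1_def \<gamma>_def)
          then have "\<Union>(snd ` D1) \<subseteq> U" by (intro Union_least) (metis imageE prod.collapse)
          then have "measure lebesgue (\<Union>(snd ` D1)) \<le> measure lebesgue U"
            using U(3) fmeasurableD[OF lmeasurable_division[OF div]] by (intro measure_mono_fmeasurable)
          then show "measure lebesgue (\<Union>(snd ` D1)) < \<delta>" using U(4) by linarith
        qed
        finally show ?thesis .
      qed
      finally show ?thesis using \<epsilon>(2) by simp
    qed
    ultimately show "\<exists>\<gamma>. gauge \<gamma> \<and> (\<forall>\<D>. \<D> tagged_division_of {a..b} \<and> \<gamma> fine \<D> \<longrightarrow>
        norm ((\<Sum>(x, K)\<in>\<D>. measure lborel K *\<^sub>R g' x) - (f b - f a)) < e)"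
      by (intro exI[of _ \<gamma>]) simp
  qed
qed

section \<open>The Peano kernel\<close>

text \<open>One constant bounds both slopes and values, in the form that \<open>ac_on_mult\<close>
  asks for.\<close>

lemma C1_lipschitz:
  fixes g :: "real \<Rightarrow> 'a::real_normed_vector"
  assumes "\<And>x. x \<in> {a..b} \<Longrightarrow> (g has_vector_derivative g' x) (at x within {a..b})"
    and "continuous_on {a..b} g'"
  shows "\<exists>L\<ge>0. \<forall>u v. a \<le> u \<longrightarrow> u \<le> v \<longrightarrow> v \<le> b \<longrightarrow> norm (g v - g u) \<le> L * (v - u) \<and> norm (g u) \<le> L"
proof -
  have "continuous_on {a..b} g"
    by (auto simp: continuous_on_eq_continuous_within intro: has_vector_derivative_continuous[OF assms(1)])
  then have "bounded (g ` {a..b})" "bounded (g' ` {a..b})"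
    using assms(2) compact_continuous_image compact_imp_bounded compact_Icc by blast+
  then obtain B1 B2 where B: "\<forall>x\<in>{a..b}. norm (g x) \<le> B1" "\<forall>x\<in>{a..b}. norm (g' x) \<le> B2"
    unfolding bounded_iff by auto
  define L where "L = max 0 (max B1 B2)"
  have "norm (g v - g u) \<le> L * (v - u) \<and> norm (g u) \<le> L" if uv: "a \<le> u" "u \<le> v" "v \<le> b" for u v
  proof
    have "norm (g v - g u) \<le> L * norm (v - u)"
    proof (rule differentiable_bound[of "{a..b}" g "\<lambda>x h. h *\<^sub>R g' x"])
      show "(g has_derivative (\<lambda>h. h *\<^sub>R g' x)) (at x within {a..b})" if "x \<in> {a..b}" for x
        using assms(1)[OF that] by (simp add: has_vector_derivative_def)
      show "onorm (\<lambda>h. h *\<^sub>R g' x) \<le> L" if "x \<in> {a..b}" for x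
      proof (rule onorm_le)
        fix h :: real
        have "norm (g' x) \<le> L" using B(2)[rule_format, OF that] by (simp add: L_def)
        then have "\<bar>h\<bar> * norm (g' x) \<le> \<bar>h\<bar> * L" by (intro mult_left_mono) auto
        then show "norm (h *\<^sub>R g' x) \<le> L * norm h" by (simp add: mult.commute)
      qed
    qed (use uv in auto)
    then show "norm (g v - g u) \<le> L * (v - u)" using uv by simp
    show "norm (g u) \<le> L" using B(1)[rule_format, of u] uv by (simp add: L_def)
  qed
  then show ?thesis by (intro exI[of _ L]) (auto simp: L_def)
qed

lemma ac_on_subinterval: "ac_on a b f \<Longrightarrow> a \<le> c \<Longrightarrow> ac_on c b f"
proof -
  assume f: "ac_on a b f" and "a \<le> c"
  then have sub: "{c..b} \<subseteq> {a..b}" by auto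
  show ?thesis
    unfolding ac_on_def
  proof (intro allI impI)
    fix \<epsilon> :: real assume "\<epsilon> > 0"
    from ac_onD[OF f this] obtain \<delta> where \<delta>: "\<delta> > 0"
      "\<forall>\<K>. \<K> division_of \<Union>\<K> \<longrightarrow> \<Union>\<K> \<subseteq> {a..b} \<longrightarrow> measure lebesgue (\<Union>\<K>) < \<delta> \<longrightarrow>
        (\<Sum>K\<in>\<K>. norm (f (Sup K) - f (Inf K))) < \<epsilon>" by blast
    show "\<exists>\<delta>>0. \<forall>\<K>. \<K> division_of \<Union>\<K> \<and> \<Union>\<K> \<subseteq> {c..b} \<and> measure lebesgue (\<Union>\<K>) < \<delta> \<longrightarrow>
        (\<Sum>K\<in>\<K>. norm (f (Sup K) - f (Inf K))) < \<epsilon>"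
    proof (intro exI[of _ \<delta>] conjI allI impI \<delta>(1), elim conjE)
      fix \<K> :: "real set set" assume "\<K> division_of \<Union>\<K>" "\<Union>\<K> \<subseteq> {c..b}" "measure lebesgue (\<Union>\<K>) < \<delta>"
      then show "(\<Sum>K\<in>\<K>. norm (f (Sup K) - f (Inf K))) < \<epsilon>"
        by (intro \<delta>(2)[rule_format] order_trans[OF _ sub])
    qed
  qed
qed

text \<open>The derivatives are carried along as a sequence instead of being computed from
  \<open>f 0\<close>. Then \<open>f m\<close> may be any function that is almost everywhere the
  derivative of \<open>f (m - 1)\<close>, and Sobolev functions, polynomials and splines are treated
  alike.\<close>

definition ac_chain :: "nat \<Rightarrow> (nat \<Rightarrow> real \<Rightarrow> complex) \<Rightarrow> bool" where
  "ac_chain m f \<longleftrightarrow> (\<forall>k<m. ac_on 0 1 (f k)) \<and>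
     (\<exists>S. negligible S \<and>
       (\<forall>k<m. \<forall>x\<in>{0..1} - S. (f k has_vector_derivative f (Suc k) x) (at x within {0..1})))"

text \<open>Here \<open>G k\<close> is a \<open>k\<close>-fold antiderivative of \<open>G 0\<close>.
  The freedom in the constants of integration is used: the choices \<open>exp_rem \<sigma>\<close>,
  powers with \<open>G 0 = 0\<close>, and plain exponentials give the kernel, Taylor's formula and
  the integrals of monomials.\<close>

lemma ac_chain_by_parts:
  assumes f: "ac_chain m f" and c: "0 \<le> c" "c \<le> 1" and m: "m \<ge> 1"
    and G0: "continuous_on UNIV (G 0)"
    and G: "\<And>k z. (G (Suc k) has_field_derivative G k z) (at z)"
    and k: "k \<le> m"
  shows "(\<lambda>x. G k (complex_of_real x) * f k x) integrable_on {c..1} \<and>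
    integral {c..1} (\<lambda>x. G 0 (of_real x) * f 0 x) =
      (\<Sum>i<k. (- 1) ^ i * (G (Suc i) 1 * f i 1 - G (Suc i) (of_real c) * f i c))
      + (- 1) ^ k * integral {c..1} (\<lambda>x. G k (of_real x) * f k x)"
  using k
proof (induction k)
  case 0
  have "ac_on c 1 (f 0)" using f m c by (auto simp: ac_chain_def intro: ac_on_subinterval)
  then have "continuous_on {c..1} (f 0)" by (rule ac_on_continuous)
  moreover have "continuous_on {c..1} (\<lambda>x. G 0 (of_real x))"
    by (rule continuous_on_compose2[OF G0]) (auto intro: continuous_intros)
  ultimately show ?case by (simp add: integrable_continuous_real continuous_on_mult)
next
  case (Suc k)
  then have IH: "(\<lambda>x. G k (of_real x) * f k x) integrable_on {c..1}"
    "integral {c..1} (\<lambda>x. G 0 (of_real x) * f 0 x) =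
      (\<Sum>i<k. (- 1) ^ i * (G (Suc i) 1 * f i 1 - G (Suc i) (of_real c) * f i c))
      + (- 1) ^ k * integral {c..1} (\<lambda>x. G k (of_real x) * f k x)" and km: "k < m" by auto
  obtain S where S: "negligible S" "\<And>x. x \<in> {0..1} - S \<Longrightarrow> (f k has_vector_derivative f (Suc k) x) (at x within {0..1})"
    using f km unfolding ac_chain_def by blast
  have contG: "continuous_on UNIV (G j)" for j
  proof (cases j)
    case (Suc i)
    then show ?thesis using DERIV_isCont[OF G] by (simp add: continuous_at_imp_continuous_on)
  qed (simp add: G0)
  have dG: "((\<lambda>x. G (Suc k) (of_real x)) has_vector_derivative G k (of_real x)) (at x within T)" for x T
    by (rule has_vector_derivative_real_field[OF G])
  have "continuous_on {c..1} (\<lambda>x. G k (of_real x))"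
    by (rule continuous_on_compose2[OF contG[of k]]) (auto intro: continuous_intros)
  from C1_lipschitz[OF dG this] obtain L where L: "\<And>u v. c \<le> u \<Longrightarrow> u \<le> v \<Longrightarrow> v \<le> 1 \<Longrightarrow>
      norm (G (Suc k) (of_real v) - G (Suc k) (of_real u)) \<le> L * (v - u)"
    "\<And>u. c \<le> u \<Longrightarrow> u \<le> 1 \<Longrightarrow> norm (G (Suc k) (of_real u)) \<le> L" by blast
  have "ac_on c 1 (f k)" using f km c by (auto simp: ac_chain_def intro: ac_on_subinterval)
  then have ac: "ac_on c 1 (\<lambda>x. G (Suc k) (of_real x) * f k x)" by (rule ac_on_mult) (use L c in auto)
  have "((\<lambda>x. G (Suc k) (of_real x) * f (Suc k) x + G k (of_real x) * f k x) has_integral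
      (G (Suc k) (of_real 1) * f k 1 - G (Suc k) (of_real c) * f k c)) {c..1}"
  proof (rule ac_on_has_integral[OF ac c(2) S(1)])
    fix x assume x: "x \<in> {c..1} - S"
    have "(f k has_vector_derivative f (Suc k) x) (at x within {c..1})"
      by (rule has_vector_derivative_within_subset[OF S(2)]) (use x c in auto)
    then show "((\<lambda>x. G (Suc k) (of_real x) * f k x) has_vector_derivative
        G (Suc k) (of_real x) * f (Suc k) x + G k (of_real x) * f k x) (at x within {c..1})"
      by (rule has_vector_derivative_mult[OF dG])
  qed
  from has_integral_diff[OF this integrable_integral[OF IH(1)]]
  have I: "((\<lambda>x. G (Suc k) (of_real x) * f (Suc k) x) has_integral
      (G (Suc k) 1 * f k 1 - G (Suc k) (of_real c) * f k c - integral {c..1} (\<lambda>x. G k (of_real x) * f k x))) {c..1}"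
    by simp
  then show ?case
    unfolding IH(2) integral_unique[OF I] by (auto simp: has_integral_integrable algebra_simps)
qed

section \<open>Truncated powers, exponential remainders and the error functional\<close>

text \<open>The truncated power of spline theory, divided by \<open>fact j\<close>. For
  \<open>j = 0\<close> it is a step function, with value 0 at the jump.\<close>

definition tpow :: "nat \<Rightarrow> real \<Rightarrow> complex" where
  "tpow j t = (if t \<le> 0 then 0 else of_real (t ^ j / fact j))"

lemma tpow_nonpos [simp]: "t \<le> 0 \<Longrightarrow> tpow j t = 0" by (simp add: tpow_def)

lemma tpow_has_vector_derivative:
  assumes "j \<ge> 1 \<or> t \<noteq> 0"
  shows "(tpow (Suc j) has_vector_derivative tpow j t) (at t)"
proof -
  define g where "g s = (if s \<le> 0 then 0 else s ^ Suc j / fact (Suc j))" for s :: real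
  define g' where "g' s = (if s \<le> 0 then 0 else s ^ j / fact j)" for s :: real
  have "(g has_real_derivative g' t) (at t)"
  proof -
    consider "t > 0" | "t < 0" | "t = 0" "j \<ge> 1" using assms by linarith
    then show ?thesis
    proof cases
      case 1
      have "((\<lambda>s. s ^ Suc j / fact (Suc j)) has_real_derivative (of_nat (Suc j) * t ^ j / fact (Suc j))) (at t)"
        by (intro DERIV_cdivide) (use DERIV_pow[of "Suc j" t UNIV] in simp)
      also have "of_nat (Suc j) * t ^ j / fact (Suc j) = g' t" using 1 by (simp add: g'_def del: of_nat_Suc)
      finally show ?thesis
        by (rule has_field_derivative_transform_within_open[of _ _ _ "{0<..}"]) (use 1 in \<open>auto simp: g_def\<close>)
    next
      case 2
      have "((\<lambda>s. 0) has_real_derivative 0) (at t)" by simp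
      then have "(g has_real_derivative 0) (at t)"
        by (rule has_field_derivative_transform_within_open[of _ _ _ "{..<0}"]) (use 2 in \<open>auto simp: g_def\<close>)
      then show ?thesis using 2 by (simp add: g'_def)
    next
      case 3
      have "((\<lambda>s. (g s - g 0) / (s - 0)) \<longlongrightarrow> 0) (at 0)"
      proof (rule Lim_null_comparison)
        show "\<forall>\<^sub>F s in at 0. norm ((g s - g 0) / (s - 0)) \<le> \<bar>s\<bar> ^ j"
        proof (intro always_eventually allI)
          fix s :: real
          show "norm ((g s - g 0) / (s - 0)) \<le> \<bar>s\<bar> ^ j"
          proof (cases "s \<le> 0")
            case False
            have "s ^ j / fact (Suc j) \<le> s ^ j / 1"
              using False by (intro divide_left_mono) (auto simp del: fact_Suc)
            then show ?thesis using False by (simp add: g_def abs_mult del: fact_Suc)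
          qed (auto simp: g_def)
        qed
        have "((\<lambda>s::real. \<bar>s\<bar> ^ j) \<longlongrightarrow> \<bar>0\<bar> ^ j) (at 0)" by (intro tendsto_intros)
        moreover have "\<bar>0 :: real\<bar> ^ j = 0" using 3 by (simp add: zero_power)
        ultimately show "((\<lambda>s::real. \<bar>s\<bar> ^ j) \<longlongrightarrow> 0) (at 0)" by (simp only:)
      qed
      then show ?thesis using 3 by (simp add: has_field_derivative_iff g'_def)
    qed
  qed
  then have "((\<lambda>s. complex_of_real (g s)) has_vector_derivative of_real (g' t)) (at t)"
    by (auto intro!: bounded_linear.has_vector_derivative[OF bounded_linear_of_real]
          simp: has_real_derivative_iff_has_vector_derivative)
  moreover have "(\<lambda>s. complex_of_real (g s)) = tpow (Suc j)" "of_real (g' t) = tpow j t"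
    by (auto simp: g_def g'_def tpow_def)
  ultimately show ?thesis by simp
qed

lemma tpow_measurable [measurable]: "tpow j \<in> borel_measurable borel"
  unfolding tpow_def[abs_def] by measurable

text \<open>This Taylor remainder is the \<open>j\<close>-fold iterated integral of
  \<open>exp (\<sigma> * z)\<close> from 0. It vanishes at 0 for \<open>j \<ge> 1\<close>, so
  integration by parts leaves boundary terms only at 1.\<close>

definition exp_rem :: "complex \<Rightarrow> nat \<Rightarrow> complex \<Rightarrow> complex" where
  "exp_rem \<sigma> j z = (exp (\<sigma> * z) - (\<Sum>i<j. (\<sigma> * z) ^ i / fact i)) / \<sigma> ^ j"

lemma exp_rem_deriv:
  assumes "\<sigma> \<noteq> 0"
  shows "(exp_rem \<sigma> (Suc j) has_field_derivative exp_rem \<sigma> j z) (at z)"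
proof -
  have p: "((\<lambda>z. \<Sum>i<Suc j. (\<sigma> * z) ^ i / fact i) has_field_derivative \<sigma> * (\<Sum>i<j. (\<sigma> * z) ^ i / fact i)) (at z)"
  proof -
    have "((\<lambda>z. \<Sum>i<Suc j. (\<sigma> * z) ^ i / fact i) has_field_derivative
        (\<Sum>i<Suc j. of_nat i * (\<sigma> * (\<sigma> * z) ^ (i - Suc 0)) / fact i)) (at z)"
    proof (intro DERIV_sum DERIV_cdivide)
      fix i
      have "((\<lambda>z. \<sigma> * z) has_field_derivative \<sigma>) (at z)" by (auto intro!: derivative_eq_intros)
      from DERIV_power[where n=i, OF this]
      show "((\<lambda>z. (\<sigma> * z) ^ i) has_field_derivative of_nat i * (\<sigma> * (\<sigma> * z) ^ (i - Suc 0))) (at z)" .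
    qed
    also have "(\<Sum>i<Suc j. of_nat i * (\<sigma> * (\<sigma> * z) ^ (i - Suc 0)) / fact i) = \<sigma> * (\<Sum>i<j. (\<sigma> * z) ^ i / fact i)"
      by (subst sum.lessThan_Suc_shift) (simp add: sum_distrib_left field_simps del: of_nat_Suc)
    finally show ?thesis .
  qed
  have e: "((\<lambda>z. exp (\<sigma> * z)) has_field_derivative \<sigma> * exp (\<sigma> * z)) (at z)"
    by (auto intro!: derivative_eq_intros)
  have "(exp_rem \<sigma> (Suc j) has_field_derivative
      (\<sigma> * exp (\<sigma> * z) - \<sigma> * (\<Sum>i<j. (\<sigma> * z) ^ i / fact i)) / \<sigma> ^ Suc j) (at z)"
    unfolding exp_rem_def[abs_def] by (intro DERIV_cdivide DERIV_diff e p)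
  also have "(\<sigma> * exp (\<sigma> * z) - \<sigma> * (\<Sum>i<j. (\<sigma> * z) ^ i / fact i)) / \<sigma> ^ Suc j = exp_rem \<sigma> j z"
    using assms by (simp add: exp_rem_def right_diff_distrib[symmetric])
  finally show ?thesis .
qed

lemma exp_rem_0 [simp]: "exp_rem \<sigma> (Suc j) 0 = 0"
  by (simp add: exp_rem_def sum.lessThan_Suc_shift del: sum.lessThan_Suc)

lemma exp_rem_zero_index: "exp_rem \<sigma> 0 z = exp (\<sigma> * z)" by (simp add: exp_rem_def)

lemma exp_rem_continuous: "\<sigma> \<noteq> 0 \<Longrightarrow> continuous_on UNIV (exp_rem \<sigma> j)"
  by (cases j) (auto simp: exp_rem_zero_index[abs_def] intro!: continuous_intros
      continuous_at_imp_continuous_on DERIV_isCont[OF exp_rem_deriv])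

text \<open>The factor \<open>\<kappa>\<close> lets the same lemmas serve the quadrature problem,
  \<open>\<kappa> = 1\<close>, and its homogeneous version, \<open>\<kappa> = 0\<close>.\<close>

definition quad_err :: "complex \<Rightarrow> complex \<Rightarrow> nat \<Rightarrow> (nat \<Rightarrow> complex) \<Rightarrow> (real \<Rightarrow> complex) \<Rightarrow> complex" where
  "quad_err \<kappa> \<sigma> N C \<phi> = \<kappa> * integral {0..1} (\<lambda>x. exp (\<sigma> * of_real x) * \<phi> x) - (\<Sum>\<gamma>\<le>N. C \<gamma> * \<phi> (real \<gamma> / real N))"

text \<open>The \<open>m\<close>-fold integral from the left of the density
  \<open>\<kappa> * exp (\<sigma> * x)\<close> with point masses \<open>- C \<gamma>\<close> at the
  nodes.\<close>

definition peano :: "complex \<Rightarrow> complex \<Rightarrow> nat \<Rightarrow> nat \<Rightarrow> (nat \<Rightarrow> complex) \<Rightarrow> real \<Rightarrow> complex" where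
  "peano \<kappa> \<sigma> N m C x = \<kappa> * exp_rem \<sigma> m (of_real x) - (\<Sum>\<gamma>\<le>N. C \<gamma> * tpow (m - 1) (x - real \<gamma> / real N))"

text \<open>The integral is integrated by parts \<open>m\<close> times, and each node value is
  replaced by its Taylor formula around 1 with integral remainder. The remainders make up the
  kernel; the coefficient of \<open>f i 1\<close> is, up to sign, the error at
  \<open>(1 - x) ^ i / fact i\<close>.\<close>

lemma quad_err_kernel:
  assumes f: "ac_chain m f" and m: "m \<ge> 1" and \<sigma>: "\<sigma> \<noteq> 0" and N: "N \<ge> 1"
  shows "(\<lambda>x. peano \<kappa> \<sigma> N m C x * f m x) integrable_on {0..1}"
    and "quad_err \<kappa> \<sigma> N C (f 0) =
      (\<Sum>i<m. (- 1) ^ i * f i 1 * (\<kappa> * exp_rem \<sigma> (Suc i) 1 - (\<Sum>\<gamma>\<le>N. C \<gamma> * of_real ((1 - real \<gamma> / real N) ^ i / fact i))))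
      + (- 1) ^ m * integral {0..1} (\<lambda>x. peano \<kappa> \<sigma> N m C x * f m x)"
proof -
  have E: "(\<lambda>x. exp_rem \<sigma> m (of_real x) * f m x) integrable_on {0..1}"
    "integral {0..1} (\<lambda>x. exp (\<sigma> * of_real x) * f 0 x) =
      (\<Sum>i<m. (- 1) ^ i * (exp_rem \<sigma> (Suc i) 1 * f i 1)) + (- 1) ^ m * integral {0..1} (\<lambda>x. exp_rem \<sigma> m (of_real x) * f m x)"
    using ac_chain_by_parts[where G="exp_rem \<sigma>" and c=0, OF f order_refl zero_le_one m
        exp_rem_continuous[OF \<sigma>] exp_rem_deriv[OF \<sigma>] order_refl]
    by (simp_all add: exp_rem_zero_index)
  have T: "((\<lambda>x. tpow (m - 1) (x - c) * f m x) has_integral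
      (- 1) ^ m * (f 0 c - (\<Sum>i<m. (- 1) ^ i * of_real ((1 - c) ^ i / fact i) * f i 1))) {0..1}"
    if c: "0 \<le> c" "c \<le> 1" for c
  proof -
    \<comment> \<open>With \<open>G 0 = 0\<close> and the constant 1 as its antiderivative,
      integration by parts over \<open>{c..1}\<close> becomes Taylor's formula.\<close>
    define G where "G k z = (if k = 0 then 0 else (z - of_real c) ^ (k - 1) / fact (k - 1))" for k and z :: complex
    have G: "(G (Suc k) has_field_derivative G k z) (at z)" for k z
    proof -
      have "((\<lambda>z. z - of_real c) has_field_derivative 1) (at z)" by (auto intro!: derivative_eq_intros)
      from DERIV_cdivide[OF DERIV_power[where n=k, OF this], of "fact k"]
      have "(G (Suc k) has_field_derivative of_nat k * (1 * (z - of_real c) ^ (k - Suc 0)) / fact k) (at z)"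
        by (simp add: G_def[abs_def])
      also have "of_nat k * (1 * (z - of_real c) ^ (k - Suc 0)) / fact k = G k z"
        by (cases k) (simp_all add: G_def field_simps del: of_nat_Suc)
      finally show ?thesis .
    qed
    have Gc: "G (Suc i) (of_real c) = (if i = 0 then 1 else 0)" for i by (simp add: G_def)
    have I: "(\<lambda>x. G m (of_real x) * f m x) integrable_on {c..1}"
      "0 = (\<Sum>i<m. (- 1) ^ i * (G (Suc i) 1 * f i 1 - G (Suc i) (of_real c) * f i c))
      + (- 1) ^ m * integral {c..1} (\<lambda>x. G m (of_real x) * f m x)"
      using ac_chain_by_parts[where G=G, OF f c m _ G order_refl] by (simp_all add: G_def[of 0])
    define I0 where "I0 = integral {c..1} (\<lambda>x. G m (of_real x) * f m x)"
    have "(\<Sum>i<m. (- 1) ^ i * (G (Suc i) 1 * f i 1 - G (Suc i) (of_real c) * f i c)) =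
        (\<Sum>i<m. (- 1) ^ i * of_real ((1 - c) ^ i / fact i) * f i 1 - (if i = 0 then f 0 c else 0))"
      unfolding Gc by (intro sum.cong refl) (auto simp: G_def algebra_simps)
    also have "\<dots> = (\<Sum>i<m. (- 1) ^ i * of_real ((1 - c) ^ i / fact i) * f i 1) - f 0 c"
      using m by (simp add: sum_subtractf)
    finally have S: "(\<Sum>i<m. (- 1) ^ i * (G (Suc i) 1 * f i 1 - G (Suc i) (of_real c) * f i c)) =
        (\<Sum>i<m. (- 1) ^ i * of_real ((1 - c) ^ i / fact i) * f i 1) - f 0 c" .
    have neg: "0 = x - y + z \<Longrightarrow> z = y - x" for x y z :: complex by (simp add: algebra_simps)
    have "(- 1) ^ m * I0 = f 0 c - (\<Sum>i<m. (- 1) ^ i * of_real ((1 - c) ^ i / fact i) * f i 1)"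
      by (rule neg) (use I(2) in \<open>simp only: S I0_def\<close>)
    moreover have "(- 1) ^ m * ((- 1) ^ m * I0) = I0"
      by (simp add: mult.assoc[symmetric] power_mult_distrib[symmetric])
    ultimately have I0: "I0 = (- 1) ^ m * (f 0 c - (\<Sum>i<m. (- 1) ^ i * of_real ((1 - c) ^ i / fact i) * f i 1))"
      by simp
    have "((\<lambda>x. G m (of_real x) * f m x) has_integral I0) {c..1}"
      unfolding I0_def by (rule integrable_integral[OF I(1)])
    then have "((\<lambda>x. if x \<in> {c..1} then G m (of_real x) * f m x else 0) has_integral I0) {0..1}"
      using c by (subst has_integral_restrict) auto
    then show ?thesis
      unfolding I0[symmetric]
    \<comment> \<open>The point \<open>c\<close> is excluded because for \<open>m = 1\<close> the
      step function is 0 there while \<open>G 1\<close> is 1.\<close>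
    proof (rule has_integral_spike_finite[of "{c}", rotated -1])
      fix x assume "x \<in> {0..1} - {c}"
      then show "tpow (m - 1) (x - c) * f m x = (if x \<in> {c..1} then G m (of_real x) * f m x else 0)"
        using m by (auto simp: tpow_def G_def)
    qed simp
  qed
  have node: "0 \<le> real \<gamma> / real N" "real \<gamma> / real N \<le> 1" if "\<gamma> \<in> {..N}" for \<gamma>
    using that N by auto
  have H: "((\<lambda>x. peano \<kappa> \<sigma> N m C x * f m x) has_integral
      (\<kappa> * integral {0..1} (\<lambda>x. exp_rem \<sigma> m (of_real x) * f m x) -
      (\<Sum>\<gamma>\<le>N. C \<gamma> * ((- 1) ^ m * (f 0 (real \<gamma> / real N) -
        (\<Sum>i<m. (- 1) ^ i * of_real ((1 - real \<gamma> / real N) ^ i / fact i) * f i 1)))))) {0..1}"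
  proof -
    have "((\<lambda>x. \<kappa> * (exp_rem \<sigma> m (of_real x) * f m x) - (\<Sum>\<gamma>\<le>N. C \<gamma> * (tpow (m - 1) (x - real \<gamma> / real N) * f m x))) has_integral
      (\<kappa> * integral {0..1} (\<lambda>x. exp_rem \<sigma> m (of_real x) * f m x) -
      (\<Sum>\<gamma>\<le>N. C \<gamma> * ((- 1) ^ m * (f 0 (real \<gamma> / real N) -
        (\<Sum>i<m. (- 1) ^ i * of_real ((1 - real \<gamma> / real N) ^ i / fact i) * f i 1)))))) {0..1}"
      by (intro has_integral_diff has_integral_mult_right integrable_integral[OF E(1)] has_integral_sum T)
        (use node in auto)
    then show ?thesis
      by (simp add: peano_def left_diff_distrib sum_distrib_right mult.assoc)
  qed
  then show "(\<lambda>x. peano \<kappa> \<sigma> N m C x * f m x) integrable_on {0..1}" by blast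
  have s2: "(- 1 :: complex) ^ m * ((- 1) ^ m * y) = y" for y
    by (simp add: mult.assoc[symmetric] power_mult_distrib[symmetric])
  have "(- 1) ^ m * integral {0..1} (\<lambda>x. peano \<kappa> \<sigma> N m C x * f m x) =
      \<kappa> * ((- 1) ^ m * integral {0..1} (\<lambda>x. exp_rem \<sigma> m (of_real x) * f m x)) -
      (\<Sum>\<gamma>\<le>N. C \<gamma> * f 0 (real \<gamma> / real N)) +
      (\<Sum>\<gamma>\<le>N. C \<gamma> * (\<Sum>i<m. (- 1) ^ i * of_real ((1 - real \<gamma> / real N) ^ i / fact i) * f i 1))"
    unfolding integral_unique[OF H]
    by (simp add: right_diff_distrib sum_distrib_left mult.left_commute[of "(- 1) ^ m"] s2 sum_subtractf)
  also have "(\<Sum>\<gamma>\<le>N. C \<gamma> * (\<Sum>i<m. (- 1) ^ i * of_real ((1 - real \<gamma> / real N) ^ i / fact i) * f i 1)) =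
      (\<Sum>i<m. (- 1) ^ i * f i 1 * (\<Sum>\<gamma>\<le>N. C \<gamma> * of_real ((1 - real \<gamma> / real N) ^ i / fact i)))"
    unfolding sum_distrib_left by (subst sum.swap) (simp add: mult_ac)
  finally show "quad_err \<kappa> \<sigma> N C (f 0) =
      (\<Sum>i<m. (- 1) ^ i * f i 1 * (\<kappa> * exp_rem \<sigma> (Suc i) 1 - (\<Sum>\<gamma>\<le>N. C \<gamma> * of_real ((1 - real \<gamma> / real N) ^ i / fact i))))
      + (- 1) ^ m * integral {0..1} (\<lambda>x. peano \<kappa> \<sigma> N m C x * f m x)"
    unfolding quad_err_def E(2)
    by (simp add: right_diff_distrib sum_subtractf sum_distrib_left distrib_left mult_ac)
qed

section \<open>Members of the Sobolev space\<close>

lemma higher_pderiv_degree: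
  fixes p :: "complex poly"
  shows "degree p \<le> j \<Longrightarrow> (pderiv ^^ j) p = [:fact j * coeff p j:]"
proof (induction j arbitrary: p)
  case 0
  then show ?case by (auto elim!: degree_eq_zeroE)
next
  case (Suc j)
  have "degree (pderiv p) \<le> j" using Suc.prems by (simp add: degree_pderiv)
  from Suc.IH[OF this] show ?case by (simp add: funpow_swap1 coeff_pderiv algebra_simps)
qed

lemma higher_pderiv_eq_0: "degree (p :: complex poly) < k \<Longrightarrow> (pderiv ^^ k) p = 0"
  using higher_pderiv_degree[of p "k - 1"] by (cases k) auto

definition poly_chain :: "complex poly \<Rightarrow> nat \<Rightarrow> real \<Rightarrow> complex" where
  "poly_chain p k x = poly ((pderiv ^^ k) p) (of_real x)"

lemma poly_chain_has_vector_derivative: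
  "(poly_chain p k has_vector_derivative poly_chain p (Suc k) x) (at x within T)"
  unfolding poly_chain_def[abs_def] funpow.simps o_def
  by (rule has_vector_derivative_real_field) (rule poly_DERIV)

lemma poly_chain_continuous: "continuous_on T (poly_chain p k)"
  unfolding poly_chain_def[abs_def] by (intro continuous_intros)

text \<open>A class that contains polynomials and splines and is closed under linear combinations
  and conjugation. The finite exceptional set provides for splines with \<open>m = 1\<close>, whose
  first derivative jumps at the nodes.\<close>

definition smooth_chain :: "nat \<Rightarrow> (nat \<Rightarrow> real \<Rightarrow> complex) \<Rightarrow> bool" where
  "smooth_chain m f \<longleftrightarrow>
     (\<forall>k. Suc k < m \<longrightarrow> (\<forall>x\<in>{0..1}. (f k has_vector_derivative f (Suc k) x) (at x within {0..1}))) \<and>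
     (\<exists>S. finite S \<and> (\<forall>x\<in>{0..1} - S. (f (m - 1) has_vector_derivative f m x) (at x within {0..1}))) \<and>
     (\<exists>L\<ge>0. \<forall>u v. 0 \<le> u \<longrightarrow> u \<le> v \<longrightarrow> v \<le> 1 \<longrightarrow> norm (f (m - 1) v - f (m - 1) u) \<le> L * (v - u)) \<and>
     f m \<in> borel_measurable borel \<and> (\<exists>B. \<forall>x\<in>{0..1}. norm (f m x) \<le> B)"

lemma smooth_chain_poly:
  assumes "m \<ge> 1" shows "smooth_chain m (poly_chain p)"
proof -
  have "\<exists>L\<ge>0. \<forall>u v. 0 \<le> u \<longrightarrow> u \<le> v \<longrightarrow> v \<le> 1 \<longrightarrow> norm (poly_chain p (m - 1) v - poly_chain p (m - 1) u) \<le> L * (v - u)"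
    using C1_lipschitz[OF poly_chain_has_vector_derivative poly_chain_continuous, of 0 1 p "m - 1"] by blast
  moreover have "poly_chain p m \<in> borel_measurable borel"
    by (intro borel_measurable_continuous_onI poly_chain_continuous)
  moreover have "\<exists>B. \<forall>x\<in>{0..1}. norm (poly_chain p m x) \<le> B"
    using compact_imp_bounded[OF compact_continuous_image[OF poly_chain_continuous[of "{0..1}" p m] compact_Icc]]
    by (simp add: bounded_iff)
  moreover have "(poly_chain p (m - 1) has_vector_derivative poly_chain p m x) (at x within {0..1})" for x
    using poly_chain_has_vector_derivative[of p "m - 1"] assms by simp
  ultimately show ?thesis
    unfolding smooth_chain_def using poly_chain_has_vector_derivative by blast
qed

lemma smooth_chain_add:
  assumes "smooth_chain m f" "smooth_chain m g"
  shows "smooth_chain m (\<lambda>k x. f k x + t * g k x)"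
proof -
  obtain S L B where f: "\<forall>k. Suc k < m \<longrightarrow> (\<forall>x\<in>{0..1}. (f k has_vector_derivative f (Suc k) x) (at x within {0..1}))"
    "finite S" "\<forall>x\<in>{0..1} - S. (f (m - 1) has_vector_derivative f m x) (at x within {0..1})"
    "L \<ge> 0" "\<forall>u v. 0 \<le> u \<longrightarrow> u \<le> v \<longrightarrow> v \<le> 1 \<longrightarrow> norm (f (m - 1) v - f (m - 1) u) \<le> L * (v - u)"
    "f m \<in> borel_measurable borel" "\<forall>x\<in>{0..1}. norm (f m x) \<le> B"
    using assms(1) unfolding smooth_chain_def by blast
  obtain S' L' B' where g: "\<forall>k. Suc k < m \<longrightarrow> (\<forall>x\<in>{0..1}. (g k has_vector_derivative g (Suc k) x) (at x within {0..1}))"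
    "finite S'" "\<forall>x\<in>{0..1} - S'. (g (m - 1) has_vector_derivative g m x) (at x within {0..1})"
    "L' \<ge> 0" "\<forall>u v. 0 \<le> u \<longrightarrow> u \<le> v \<longrightarrow> v \<le> 1 \<longrightarrow> norm (g (m - 1) v - g (m - 1) u) \<le> L' * (v - u)"
    "g m \<in> borel_measurable borel" "\<forall>x\<in>{0..1}. norm (g m x) \<le> B'"
    using assms(2) unfolding smooth_chain_def by blast
  show ?thesis
    unfolding smooth_chain_def
  proof (intro conjI)
    show "\<forall>k. Suc k < m \<longrightarrow> (\<forall>x\<in>{0..1}. ((\<lambda>x. f k x + t * g k x) has_vector_derivative f (Suc k) x + t * g (Suc k) x) (at x within {0..1}))"
      using f(1) g(1) by (auto intro!: has_vector_derivative_add has_vector_derivative_mult_right)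
    show "\<exists>S. finite S \<and> (\<forall>x\<in>{0..1} - S. ((\<lambda>x. f (m - 1) x + t * g (m - 1) x) has_vector_derivative f m x + t * g m x) (at x within {0..1}))"
      using f(2,3) g(2,3) by (intro exI[of _ "S \<union> S'"]) (auto intro!: has_vector_derivative_add has_vector_derivative_mult_right)
    show "\<exists>L\<ge>0. \<forall>u v. 0 \<le> u \<longrightarrow> u \<le> v \<longrightarrow> v \<le> 1 \<longrightarrow>
        norm (f (m - 1) v + t * g (m - 1) v - (f (m - 1) u + t * g (m - 1) u)) \<le> L * (v - u)"
    proof (intro exI[of _ "L + norm t * L'"] conjI allI impI)
      fix u v :: real assume uv: "0 \<le> u" "u \<le> v" "v \<le> 1"
      have "f (m - 1) v + t * g (m - 1) v - (f (m - 1) u + t * g (m - 1) u) =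
          (f (m - 1) v - f (m - 1) u) + t * (g (m - 1) v - g (m - 1) u)" by (simp add: algebra_simps)
      also have "norm \<dots> \<le> norm (f (m - 1) v - f (m - 1) u) + norm t * norm (g (m - 1) v - g (m - 1) u)"
        by (metis norm_mult norm_triangle_ineq)
      also have "\<dots> \<le> L * (v - u) + norm t * (L' * (v - u))"
        using f(5) g(5) uv by (intro add_mono mult_left_mono) auto
      finally show "norm (f (m - 1) v + t * g (m - 1) v - (f (m - 1) u + t * g (m - 1) u)) \<le> (L + norm t * L') * (v - u)"
        by (simp add: algebra_simps)
    qed (use f(4) g(4) in auto)
    show "(\<lambda>x. f m x + t * g m x) \<in> borel_measurable borel" using f(6) g(6) by measurable
    show "\<exists>B. \<forall>x\<in>{0..1}. norm (f m x + t * g m x) \<le> B"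
    proof (intro exI[of _ "B + norm t * B'"] ballI)
      fix x :: real assume "x \<in> {0..1}"
      then have "norm (f m x) + norm t * norm (g m x) \<le> B + norm t * B'"
        using f(7) g(7) by (intro add_mono mult_left_mono) auto
      then show "norm (f m x + t * g m x) \<le> B + norm t * B'"
        by (metis norm_mult norm_triangle_ineq order_trans)
    qed
  qed
qed

lemma smooth_chain_cnj:
  assumes "smooth_chain m f"
  shows "smooth_chain m (\<lambda>k x. c * cnj (f k x))"
proof -
  obtain S L B where f: "\<forall>k. Suc k < m \<longrightarrow> (\<forall>x\<in>{0..1}. (f k has_vector_derivative f (Suc k) x) (at x within {0..1}))"
    "finite S" "\<forall>x\<in>{0..1} - S. (f (m - 1) has_vector_derivative f m x) (at x within {0..1})"
    "L \<ge> 0" "\<forall>u v. 0 \<le> u \<longrightarrow> u \<le> v \<longrightarrow> v \<le> 1 \<longrightarrow> norm (f (m - 1) v - f (m - 1) u) \<le> L * (v - u)"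
    "f m \<in> borel_measurable borel" "\<forall>x\<in>{0..1}. norm (f m x) \<le> B"
    using assms(1) unfolding smooth_chain_def by blast
  note cnjd = bounded_linear.has_vector_derivative[OF bounded_linear_cnj]
  show ?thesis
    unfolding smooth_chain_def
  proof (intro conjI)
    show "\<forall>k. Suc k < m \<longrightarrow> (\<forall>x\<in>{0..1}. ((\<lambda>x. c * cnj (f k x)) has_vector_derivative c * cnj (f (Suc k) x)) (at x within {0..1}))"
      using f(1) by (auto intro!: has_vector_derivative_mult_right cnjd)
    show "\<exists>S. finite S \<and> (\<forall>x\<in>{0..1} - S. ((\<lambda>x. c * cnj (f (m - 1) x)) has_vector_derivative c * cnj (f m x)) (at x within {0..1}))"
      using f(2,3) by (intro exI[of _ S]) (auto intro!: has_vector_derivative_mult_right cnjd)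
    show "\<exists>L\<ge>0. \<forall>u v. 0 \<le> u \<longrightarrow> u \<le> v \<longrightarrow> v \<le> 1 \<longrightarrow>
        norm (c * cnj (f (m - 1) v) - c * cnj (f (m - 1) u)) \<le> L * (v - u)"
    proof (intro exI[of _ "norm c * L"] conjI allI impI)
      fix u v :: real assume uv: "0 \<le> u" "u \<le> v" "v \<le> 1"
      have "norm (c * cnj (f (m - 1) v) - c * cnj (f (m - 1) u)) = norm c * norm (f (m - 1) v - f (m - 1) u)"
        by (metis complex_cnj_diff complex_mod_cnj norm_mult right_diff_distrib)
      also have "\<dots> \<le> norm c * (L * (v - u))" using f(5) uv by (intro mult_left_mono) auto
      finally show "norm (c * cnj (f (m - 1) v) - c * cnj (f (m - 1) u)) \<le> norm c * L * (v - u)"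
        by (simp add: mult.assoc)
    qed (use f(4) in auto)
    have "cnj \<in> borel_measurable borel"
      by (intro borel_measurable_continuous_onI continuous_intros)
    then show "(\<lambda>x. c * cnj (f m x)) \<in> borel_measurable borel" using f(6)
      by (intro borel_measurable_times measurable_compose[OF f(6)]) auto
    show "\<exists>B. \<forall>x\<in>{0..1}. norm (c * cnj (f m x)) \<le> B"
      using f(7) by (intro exI[of _ "norm c * B"] ballI) (auto simp: norm_mult intro!: mult_left_mono)
  qed
qed

lemma smooth_chain_lipschitz:
  assumes f: "smooth_chain m f" and k: "k < m"
  shows "\<exists>L\<ge>0. \<forall>u v. 0 \<le> u \<longrightarrow> u \<le> v \<longrightarrow> v \<le> 1 \<longrightarrow> norm (f k v - f k u) \<le> L * (v - u)"
  using k
proof (induction "m - 1 - k" arbitrary: k)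
  case 0
  then have "k = m - 1" by simp
  then show ?case using f unfolding smooth_chain_def by blast
next
  case (Suc d)
  then have km: "Suc k < m" and dk: "d = m - 1 - Suc k" by simp_all
  from Suc.hyps(1)[OF dk km]
  obtain L where "L \<ge> 0" "\<forall>u v. 0 \<le> u \<longrightarrow> u \<le> v \<longrightarrow> v \<le> 1 \<longrightarrow> norm (f (Suc k) v - f (Suc k) u) \<le> L * (v - u)"
    by blast
  then have "continuous_on {0..1} (f (Suc k))" by (intro ac_on_continuous ac_on_lipschitz[of 0 1 _ L]) auto
  moreover have "\<And>x. x \<in> {0..1} \<Longrightarrow> (f k has_vector_derivative f (Suc k) x) (at x within {0..1})"
    using f km unfolding smooth_chain_def by blast
  ultimately show ?case using C1_lipschitz[of 0 1 "f k" "f (Suc k)"] by blast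
qed

lemma smooth_chain_imp_ac_chain:
  assumes f: "smooth_chain m f" shows "ac_chain m f"
proof -
  obtain S where S: "finite S" "\<forall>x\<in>{0..1} - S. (f (m - 1) has_vector_derivative f m x) (at x within {0..1})"
    using f unfolding smooth_chain_def by blast
  have "ac_on 0 1 (f k)" if "k < m" for k
    using smooth_chain_lipschitz[OF f that] ac_on_lipschitz[of 0 1 "f k"] by blast
  moreover have "(f k has_vector_derivative f (Suc k) x) (at x within {0..1})" if "k < m" "x \<in> {0..1} - S" for k x
  proof (cases "Suc k < m")
    case True
    then show ?thesis using f that unfolding smooth_chain_def by blast
  next
    case False
    then have "k = m - 1" "Suc k = m" using that by auto
    then show ?thesis using S(2) that by simp
  qed
  ultimately show ?thesis
    unfolding ac_chain_def using negligible_finite[OF S(1)] by blast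
qed

lemma deriv_on_Suc: "deriv_on a b (Suc k) \<phi> x = vector_derivative (deriv_on a b k \<phi>) (at x within {a..b})"
  by (simp add: deriv_on_def)

text \<open>Membership gives only absolute continuity of the derivative of order
  \<open>m - 1\<close>. That \<open>deriv_on 0 1 m \<phi>\<close> is its derivative almost
  everywhere comes from \<open>ac_on_ae_differentiable\<close>; the end points join the exceptional
  set because that result concerns interior points.\<close>

lemma sobolev_imp_ac_chain:
  assumes \<phi>: "\<phi> \<in> sobolev_space m 0 1"
  shows "ac_chain m (\<lambda>k. deriv_on 0 1 k \<phi>)"
proof -
  have d: "(deriv_on 0 1 k \<phi> has_vector_derivative deriv_on 0 1 (Suc k) \<phi> x) (at x within {0..1})"
    if "k < m - 1" "x \<in> {0..1}" for k x
    using \<phi> that unfolding sobolev_space_def deriv_on_Suc by (auto simp: vector_derivative_works[symmetric])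
  have top: "ac_on 0 1 (deriv_on 0 1 (m - 1) \<phi>)"
    using \<phi> by (auto simp: sobolev_space_def intro: abs_continuous_on_imp_ac_on)
  then have cont: "continuous_on {0..1} (deriv_on 0 1 (m - 1) \<phi>)" by (rule ac_on_continuous)
  have ac: "ac_on 0 1 (deriv_on 0 1 k \<phi>)" if "k < m" for k
  proof (cases "k = m - 1")
    case False
    then have km: "k < m - 1" using that by simp
    have "continuous_on {0..1} (deriv_on 0 1 (Suc k) \<phi>)"
    proof (cases "Suc k = m - 1")
      case False
      then have "Suc k < m - 1" using km by simp
      from has_vector_derivative_continuous[OF d[OF this]] show ?thesis
        by (simp add: continuous_on_eq_continuous_within)
    qed (use cont in simp)
    from C1_lipschitz[OF d[OF km] this] show ?thesis
      using ac_on_lipschitz[of 0 1 "deriv_on 0 1 k \<phi>"] by blast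
  qed (use top in simp)
  obtain S where S: "negligible S" "\<forall>x\<in>{0<..<1} - S. \<exists>D. (deriv_on 0 1 (m - 1) \<phi> has_vector_derivative D) (at x)"
    using ac_on_ae_differentiable[OF top] by blast
  have "(deriv_on 0 1 k \<phi> has_vector_derivative deriv_on 0 1 (Suc k) \<phi> x) (at x within {0..1})"
    if k: "k < m" and x: "x \<in> {0..1} - (S \<union> {0, 1})" for k x
  proof (cases "k = m - 1")
    case True
    have "x \<in> {0<..<1} - S" using x by auto
    then obtain D where "(deriv_on 0 1 k \<phi> has_vector_derivative D) (at x)" using S(2) True by blast
    then have "(deriv_on 0 1 k \<phi> has_vector_derivative D) (at x within {0..1})"
      by (rule has_vector_derivative_at_within)
    then show ?thesis unfolding deriv_on_Suc vector_derivative_works[symmetric]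
      by (auto simp: differentiable_def has_vector_derivative_def)
  qed (use d k x in auto)
  moreover have "negligible (S \<union> {0, 1})" using S(1) by (simp add: negligible_Un)
  ultimately show ?thesis unfolding ac_chain_def using ac by blast
qed

lemma bounded_borel_set_integrable:
  fixes g :: "real \<Rightarrow> complex"
  assumes g: "g \<in> borel_measurable borel" and B: "\<forall>x\<in>{0..1}. norm (g x) \<le> B"
  shows "set_integrable lebesgue {0..1} g"
proof (rule set_integrable_bound[of lebesgue "{0..1}" "\<lambda>_. complex_of_real (max B 0)"])
  show "set_integrable lebesgue {0..1::real} (\<lambda>_. complex_of_real (max B 0))"
    by (rule absolutely_integrable_continuous_real) simp
  show "set_borel_measurable lebesgue {0..1} g"
    unfolding set_borel_measurable_def using g by (intro borel_measurable_scaleR borel_measurable_indicator) (auto intro: measurable_completion)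
  show "AE x in lebesgue. x \<in> {0..1} \<longrightarrow> norm (g x) \<le> norm (complex_of_real (max B 0))"
    by (intro AE_I2 impI order_trans[OF B[rule_format]]) auto
qed

definition l2_inner :: "(real \<Rightarrow> complex) \<Rightarrow> (real \<Rightarrow> complex) \<Rightarrow> complex" where
  "l2_inner f g = integral {0..1} (\<lambda>x. f x * cnj (g x))"

text \<open>Derivatives within \<open>{0..1}\<close> are unique, so \<open>deriv_on\<close>
  reproduces the chain, except for unknown values of the \<open>m\<close>-th derivative at finitely
  many points.\<close>

lemma smooth_chain_sobolev:
  assumes f: "smooth_chain m f" and m: "m \<ge> 1"
  shows "f 0 \<in> sobolev_space m 0 1" and "sobolev_norm m 0 1 (f 0) = sqrt (Re (l2_inner (f m) (f m)))"
proof -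
  obtain S L B where S: "finite S" "\<forall>x\<in>{0..1} - S. (f (m - 1) has_vector_derivative f m x) (at x within {0..1})"
    and L: "L \<ge> 0" "\<forall>u v. 0 \<le> u \<longrightarrow> u \<le> v \<longrightarrow> v \<le> 1 \<longrightarrow> norm (f (m - 1) v - f (m - 1) u) \<le> L * (v - u)"
    and B: "f m \<in> borel_measurable borel" "\<forall>x\<in>{0..1}. norm (f m x) \<le> B"
    using f unfolding smooth_chain_def by blast
  have D: "deriv_on 0 1 k (f 0) x = f k x" if "k < m" "x \<in> {0..1}" for k x
    using that
  proof (induction k arbitrary: x)
    case (Suc k)
    have "(f k has_vector_derivative f (Suc k) x) (at x within {0..1})"
      using f Suc.prems unfolding smooth_chain_def by blast
    then have "(deriv_on 0 1 k (f 0) has_vector_derivative f (Suc k) x) (at x within {0..1})"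
      using Suc by (intro has_vector_derivative_transform[of x "{0..1}" "deriv_on 0 1 k (f 0)" "f k"]) auto
    then show ?case
      unfolding deriv_on_Suc using vector_derivative_within_cbox[of 0 1 x] Suc.prems by simp
  qed (simp add: deriv_on_def)
  have Dm: "deriv_on 0 1 m (f 0) x = f m x" if "x \<in> {0..1} - S" for x
  proof -
    have "(deriv_on 0 1 (m - 1) (f 0) has_vector_derivative f m x) (at x within {0..1})"
      using S(2) that D[of "m - 1"] m
      by (intro has_vector_derivative_transform[of x "{0..1}" "deriv_on 0 1 (m - 1) (f 0)" "f (m - 1)"]) auto
    then have "deriv_on 0 1 (Suc (m - 1)) (f 0) x = f m x"
      unfolding deriv_on_Suc using vector_derivative_within_cbox[of 0 1 x] that by simp
    then show ?thesis using m by simp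
  qed
  have AES: "AE x in lebesgue. x \<notin> S"
    using S(1) by (intro AE_not_in) (simp add: negligible_finite flip: negligible_iff_null_sets)
  let ?d = "deriv_on 0 1 m (f 0)"
  have meas: "set_borel_measurable lebesgue {0..1} ?d"
  proof -
    \<comment> \<open>The unknown values enter as a finite combination of indicators of points,
      which keeps the function measurable.\<close>
    have "(\<lambda>x. indicator {0..1} x *\<^sub>R ?d x) =
        (\<lambda>x. indicator {0..1} x *\<^sub>R f m x + (\<Sum>s\<in>S. indicator {s} x *\<^sub>R (indicator {0..1} s *\<^sub>R (?d s - f m s))))"
    proof
      fix x
      have "(\<Sum>s\<in>S. indicator {s} x *\<^sub>R (indicator {0..1} s *\<^sub>R (?d s - f m s))) =
          (\<Sum>s\<in>S. if s = x then indicator {0..1} x *\<^sub>R (?d x - f m x) else 0)"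
        by (intro sum.cong refl) (auto simp: indicator_def)
      also have "\<dots> = (if x \<in> S then indicator {0..1} x *\<^sub>R (?d x - f m x) else 0)"
        using S(1) by simp
      finally show "indicator {0..1} x *\<^sub>R ?d x = indicator {0..1} x *\<^sub>R f m x +
          (\<Sum>s\<in>S. indicator {s} x *\<^sub>R (indicator {0..1} s *\<^sub>R (?d s - f m s)))"
        using Dm[of x] by (auto simp: indicator_def)
    qed
    moreover have "(\<lambda>x. indicator {0..1} x *\<^sub>R f m x + (\<Sum>s\<in>S. indicator {s} x *\<^sub>R (indicator {0..1} s *\<^sub>R (?d s - f m s)))) \<in> borel_measurable borel"
      using B(1) by measurable
    ultimately show ?thesis
      unfolding set_borel_measurable_def by (auto intro: measurable_completion)
  qed
  have ae: "AE x in lebesgue. indicator {0..1} x *\<^sub>R (?d x * cnj (?d x)) = indicator {0..1} x *\<^sub>R (f m x * cnj (f m x))"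
    using AES by eventually_elim (auto simp: indicator_def Dm)
  have mc: "(\<lambda>x. f m x * cnj (f m x)) \<in> borel_measurable borel"
    using B(1) by (intro borel_measurable_times measurable_compose[OF B(1)] borel_measurable_continuous_onI continuous_intros)
  have "\<forall>x\<in>{0..1}. norm (f m x * cnj (f m x)) \<le> B * B"
    using B(2) by (auto simp: norm_mult intro!: mult_mono) (meson norm_ge_zero order_trans atLeastAtMost_iff)
  from bounded_borel_set_integrable[OF mc this]
  have int: "set_integrable lebesgue {0..1} (\<lambda>x. f m x * cnj (f m x))" .
  have mdc: "(\<lambda>x. indicator {0..1} x *\<^sub>R (?d x * cnj (?d x))) \<in> borel_measurable lebesgue"
  proof -
    have "(\<lambda>x. (indicator {0..1} x *\<^sub>R ?d x) * cnj (indicator {0..1} x *\<^sub>R ?d x)) \<in> borel_measurable lebesgue"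
      using meas unfolding set_borel_measurable_def
      by (intro borel_measurable_times measurable_compose[of _ lebesgue borel cnj] borel_measurable_continuous_onI continuous_intros)
    moreover have "(\<lambda>x. (indicator {0..1} x *\<^sub>R ?d x) * cnj (indicator {0..1} x *\<^sub>R ?d x)) =
        (\<lambda>x. indicator {0..1} x *\<^sub>R (?d x * cnj (?d x)))" by (auto simp: indicator_def)
    ultimately show ?thesis by simp
  qed
  have intd: "set_integrable lebesgue {0..1} (\<lambda>x. ?d x * cnj (?d x))"
    using int ae mdc unfolding set_integrable_def
    by (subst integrable_cong_AE[where g="\<lambda>x. indicator {0..1} x *\<^sub>R (f m x * cnj (f m x))"])
      (auto dest: borel_measurable_integrable)
  have sq: "z * cnj z = complex_of_real ((cmod z)\<^sup>2)" for z
    by (rule complex_norm_square[symmetric])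
  have "set_integrable lebesgue {0..1} (\<lambda>x. (cmod (?d x))\<^sup>2)"
    using integrable_Re[OF intd[unfolded set_integrable_def]] unfolding set_integrable_def sq by simp
  moreover have "abs_continuous_on 0 1 (deriv_on 0 1 (m - 1) (f 0))"
    unfolding abs_continuous_on_def
  proof (intro allI impI)
    fix \<epsilon> :: real assume \<epsilon>: "\<epsilon> > 0"
    show "\<exists>\<delta>>0. \<forall>(n::nat) u v.
        (\<forall>i<n. 0 \<le> u i \<and> u i \<le> v i \<and> v i \<le> 1) \<and>
        (\<forall>i<n. \<forall>j<n. i \<noteq> j \<longrightarrow> {u i<..<v i} \<inter> {u j<..<v j} = {}) \<and>
        (\<Sum>i<n. v i - u i) < \<delta>
        \<longrightarrow> (\<Sum>i<n. norm (deriv_on 0 1 (m - 1) (f 0) (v i) - deriv_on 0 1 (m - 1) (f 0) (u i))) < \<epsilon>"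
    proof (intro exI[of _ "\<epsilon> / (L + 1)"] conjI allI impI, goal_cases)
      case (2 n u v)
      then have uv: "\<And>i. i < n \<Longrightarrow> 0 \<le> u i \<and> u i \<le> v i \<and> v i \<le> 1" and s: "(\<Sum>i<n. v i - u i) < \<epsilon> / (L + 1)" by auto
      have "(\<Sum>i<n. norm (deriv_on 0 1 (m - 1) (f 0) (v i) - deriv_on 0 1 (m - 1) (f 0) (u i))) \<le> (\<Sum>i<n. L * (v i - u i))"
      proof (rule sum_mono)
        fix i assume "i \<in> {..<n}"
        then have i: "0 \<le> u i" "u i \<le> v i" "v i \<le> 1" using uv[of i] by auto
        have "deriv_on 0 1 (m - 1) (f 0) (v i) = f (m - 1) (v i)" "deriv_on 0 1 (m - 1) (f 0) (u i) = f (m - 1) (u i)"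
          using i m by (auto intro!: D)
        then show "norm (deriv_on 0 1 (m - 1) (f 0) (v i) - deriv_on 0 1 (m - 1) (f 0) (u i)) \<le> L * (v i - u i)"
          using L(2) i by simp
      qed
      also have "\<dots> = L * (\<Sum>i<n. v i - u i)" by (simp add: sum_distrib_left)
      also have "\<dots> \<le> L * (\<epsilon> / (L + 1))" using s L(1) by (intro mult_left_mono) auto
      also have "\<dots> < \<epsilon>" using L(1) \<epsilon> by (simp add: field_simps)
      finally show ?case .
    qed (use L \<epsilon> in auto)
  qed
  moreover have "deriv_on 0 1 k (f 0) differentiable (at x within {0..1})" if "k < m - 1" "x \<in> {0..1}" for k x
  proof -
    have "Suc k < m" using that by simp
    then have "(f k has_vector_derivative f (Suc k) x) (at x within {0..1})"
      using f that unfolding smooth_chain_def by blast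
    then have "(deriv_on 0 1 k (f 0) has_vector_derivative f (Suc k) x) (at x within {0..1})"
      using D[of k] that by (intro has_vector_derivative_transform[of x "{0..1}" "deriv_on 0 1 k (f 0)" "f k"]) auto
    then show ?thesis by (auto simp: differentiable_def has_vector_derivative_def)
  qed
  ultimately show "f 0 \<in> sobolev_space m 0 1" using meas by (simp add: sobolev_space_def)
  have "sobolev_inner m 0 1 (f 0) (f 0) = (LINT x:{0..1}|lebesgue. f m x * cnj (f m x))"
    unfolding sobolev_inner_def set_lebesgue_integral_def
    using ae mdc int unfolding set_integrable_def by (intro integral_cong_AE) auto
  also have "\<dots> = l2_inner (f m) (f m)"
    unfolding l2_inner_def by (rule set_lebesgue_integral_eq_integral(2)[OF int])
  finally show "sobolev_norm m 0 1 (f 0) = sqrt (Re (l2_inner (f m) (f m)))"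
    by (simp add: sobolev_norm_def)
qed

lemma error_functional_eq_quad_err:
  assumes "ac_on 0 1 \<phi>"
  shows "error_functional 0 1 N \<omega> C \<phi> = quad_err 1 (2 * of_real pi * \<i> * of_real \<omega>) N C \<phi>"
proof -
  have "continuous_on {0..1} (\<lambda>x. exp (2 * of_real pi * \<i> * of_real \<omega> * complex_of_real x) * \<phi> x)"
    by (intro continuous_on_mult ac_on_continuous[OF assms] continuous_intros)
  from set_lebesgue_integral_eq_integral(2)[OF absolutely_integrable_continuous_real[OF this]]
  show ?thesis by (simp add: error_functional_def quad_err_def atMost_atLeast0)
qed

lemma error_functional_sobolev:
  assumes "\<phi> \<in> sobolev_space m 0 1" "m \<ge> 1"
  shows "error_functional 0 1 N \<omega> C \<phi> = quad_err 1 (2 * of_real pi * \<i> * of_real \<omega>) N C \<phi>"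
proof (rule error_functional_eq_quad_err)
  have "ac_on 0 1 (deriv_on 0 1 0 \<phi>)"
    using sobolev_imp_ac_chain[OF assms(1)] assms(2) unfolding ac_chain_def by auto
  then show "ac_on 0 1 \<phi>" by (simp add: deriv_on_def)
qed

section \<open>Splines and optimality\<close>

lemma smooth_chain_C1:
  assumes d: "\<And>k x. k < m \<Longrightarrow> x \<in> {0..1} \<Longrightarrow> (f k has_vector_derivative f (Suc k) x) (at x within {0..1})"
    and c: "continuous_on UNIV (f m)" and m: "m \<ge> 1"
  shows "smooth_chain m f"
  unfolding smooth_chain_def
proof (intro conjI)
  have c1: "continuous_on {0..1} (f m)" using c by (rule continuous_on_subset) simp
  have dm: "(f (m - 1) has_vector_derivative f m x) (at x within {0..1})" if "x \<in> {0..1}" for x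
    using d[of "m - 1" x] m that by simp
  show "\<exists>S. finite S \<and> (\<forall>x\<in>{0..1} - S. (f (m - 1) has_vector_derivative f m x) (at x within {0..1}))"
    using dm by (intro exI[of _ "{}"]) auto
  show "\<exists>L\<ge>0. \<forall>u v. 0 \<le> u \<longrightarrow> u \<le> v \<longrightarrow> v \<le> 1 \<longrightarrow> norm (f (m - 1) v - f (m - 1) u) \<le> L * (v - u)"
    using C1_lipschitz[OF dm c1] by blast
  show "\<exists>B. \<forall>x\<in>{0..1}. norm (f m x) \<le> B"
    using compact_imp_bounded[OF compact_continuous_image[OF c1 compact_Icc]] by (simp add: bounded_iff)
qed (use d c in \<open>auto intro: borel_measurable_continuous_onI\<close>)

lemma smooth_chain_exp_rem:
  assumes "\<sigma> \<noteq> 0" "m \<ge> 1"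
  shows "smooth_chain m (\<lambda>k x. exp_rem \<sigma> (2 * m - k) (of_real x))"
proof (rule smooth_chain_C1)
  fix k and x :: real assume "k < m"
  then have "2 * m - k = Suc (2 * m - Suc k)" by simp
  then show "((\<lambda>x. exp_rem \<sigma> (2 * m - k) (of_real x)) has_vector_derivative exp_rem \<sigma> (2 * m - Suc k) (of_real x)) (at x within {0..1})"
    using has_vector_derivative_real_field[OF exp_rem_deriv[OF assms(1)]] by simp
next
  show "continuous_on UNIV (\<lambda>x. exp_rem \<sigma> (2 * m - m) (complex_of_real x))"
    by (rule continuous_on_compose2[OF exp_rem_continuous[OF assms(1)]]) (auto intro: continuous_intros)
qed (fact assms)

lemma smooth_chain_tpow:
  assumes c: "0 \<le> c" "c \<le> 1" and m: "m \<ge> 1"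
  shows "smooth_chain m (\<lambda>k x. tpow (2 * m - 1 - k) (x - c))"
  unfolding smooth_chain_def
proof (intro conjI allI impI ballI)
  have d: "((\<lambda>x. tpow (2 * m - 1 - k) (x - c)) has_vector_derivative tpow (2 * m - 1 - Suc k) (x - c)) (at x within {0..1})"
    if k: "Suc k < 2 * m" and x: "2 * m - 1 - Suc k \<ge> 1 \<or> x \<noteq> c" for k x
  proof -
    have S: "2 * m - 1 - k = Suc (2 * m - 1 - Suc k)" using k by simp
    have t: "(tpow (Suc (2 * m - 1 - Suc k)) has_vector_derivative tpow (2 * m - 1 - Suc k) (x - c)) (at (x - c))"
      using x by (intro tpow_has_vector_derivative) auto
    have "((\<lambda>x. x - c) has_vector_derivative 1) (at x within {0..1})"
      by (auto intro!: derivative_eq_intros)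
    from vector_diff_chain_within[OF this has_vector_derivative_at_within[OF t]]
    have "(tpow (Suc (2 * m - 1 - Suc k)) \<circ> (\<lambda>x. x - c) has_vector_derivative 1 *\<^sub>R tpow (2 * m - 1 - Suc k) (x - c)) (at x within {0..1})"
      .
    then show ?thesis unfolding S by (simp add: o_def)
  qed
  show "((\<lambda>x. tpow (2 * m - 1 - k) (x - c)) has_vector_derivative tpow (2 * m - 1 - Suc k) (x - c)) (at x within {0..1})"
    if "Suc k < m" for k x
  proof (rule d)
    show "2 * m - 1 - Suc k \<ge> 1 \<or> x \<noteq> c" using that by (intro disjI1) linarith
  qed (use that in simp)
  show "\<exists>S. finite S \<and> (\<forall>x\<in>{0..1} - S. ((\<lambda>x. tpow (2 * m - 1 - (m - 1)) (x - c)) has_vector_derivative tpow (2 * m - 1 - m) (x - c)) (at x within {0..1}))"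
  proof (intro exI[of _ "{c}"] conjI ballI)
    fix x assume "x \<in> {0..1} - {c}"
    then have "x \<noteq> c" "m < 2 * m" using m by auto
    moreover have e: "Suc (m - 1) = m" using m by simp
    ultimately show "((\<lambda>x. tpow (2 * m - 1 - (m - 1)) (x - c)) has_vector_derivative tpow (2 * m - 1 - m) (x - c)) (at x within {0..1})"
      by (intro d[of "m - 1" x, unfolded e] disjI2)
  qed simp
  show "\<exists>L\<ge>0. \<forall>u v. 0 \<le> u \<longrightarrow> u \<le> v \<longrightarrow> v \<le> 1 \<longrightarrow>
      norm (tpow (2 * m - 1 - (m - 1)) (v - c) - tpow (2 * m - 1 - (m - 1)) (u - c)) \<le> L * (v - u)"
  proof (intro exI[of _ "real m"] conjI allI impI)
    fix u v :: real assume uv: "0 \<le> u" "u \<le> v" "v \<le> 1"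
    \<comment> \<open>\<open>tpow m\<close> is a power of the positive part, and the
      \<open>m\<close>-th power has Lipschitz constant \<open>m\<close> on
      \<open>{0..1}\<close>.\<close>
    define a where "a = max 0 (u - c)" define b where "b = max 0 (v - c)"
    have ab: "0 \<le> a" "a \<le> b" "b \<le> 1" "b - a \<le> v - u" using uv c by (auto simp: a_def b_def)
    have t: "tpow m (u - c) = of_real (a ^ m / fact m)" "tpow m (v - c) = of_real (b ^ m / fact m)"
      using m by (auto simp: tpow_def a_def b_def zero_power)
    have "norm (tpow m (v - c) - tpow m (u - c)) = norm (b ^ m - a ^ m) / fact m"
      unfolding t of_real_diff[symmetric] norm_of_real diff_divide_distrib[symmetric] by simp
    also have "\<dots> \<le> norm (b ^ m - a ^ m) / 1"
      by (intro divide_left_mono) auto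
    also have "\<dots> \<le> real m * norm (b - a)" using ab norm_power_diff[of b a m] by simp
    also have "\<dots> \<le> real m * (v - u)" using ab by (intro mult_left_mono) auto
    finally show "norm (tpow (2 * m - 1 - (m - 1)) (v - c) - tpow (2 * m - 1 - (m - 1)) (u - c)) \<le> real m * (v - u)"
      using m by (simp add: Suc_diff_le)
  qed simp
  show "(\<lambda>x. tpow (2 * m - 1 - m) (x - c)) \<in> borel_measurable borel" by measurable
  show "\<exists>B. \<forall>x\<in>{0..1}. norm (tpow (2 * m - 1 - m) (x - c)) \<le> B"
  proof (intro exI[of _ 1] ballI)
    fix x :: real assume "x \<in> {0..1}"
    then have x: "x - c \<le> 1" using c by auto
    show "norm (tpow (2 * m - 1 - m) (x - c)) \<le> 1"
    proof (cases "x - c \<le> 0")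
      case False
      have "(x - c) ^ (2 * m - 1 - m) / fact (2 * m - 1 - m) \<le> 1 / 1"
        using False x by (intro frac_le power_le_one) auto
      then show ?thesis using False by (simp add: tpow_def norm_divide norm_power flip: of_real_diff)
    qed simp
  qed
qed

lemma smooth_chain_sum:
  assumes "finite A" "smooth_chain m f" "\<And>a. a \<in> A \<Longrightarrow> smooth_chain m (g a)"
  shows "smooth_chain m (\<lambda>k x. f k x + (\<Sum>a\<in>A. t a * g a k x))"
  using assms(1,3)
proof (induction A rule: finite_induct)
  case (insert a A)
  then have "smooth_chain m (\<lambda>k x. (f k x + (\<Sum>a\<in>A. t a * g a k x)) + t a * g a k x)"
    by (intro smooth_chain_add) auto
  then show ?case using insert.hyps by (simp add: algebra_simps)
qed (use assms(2) in simp)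

text \<open>The index \<open>k\<close> counts derivatives. For \<open>\<kappa> = 0\<close>,
  \<open>degree P < m\<close> and coefficients that annihilate polynomials of degree less than
  \<open>m\<close>, this is a natural spline of degree \<open>2m - 1\<close>.\<close>

definition spline :: "complex \<Rightarrow> complex \<Rightarrow> nat \<Rightarrow> nat \<Rightarrow> (nat \<Rightarrow> complex) \<Rightarrow> complex poly \<Rightarrow> nat \<Rightarrow> real \<Rightarrow> complex" where
  "spline \<kappa> \<sigma> N m C P k x = \<kappa> * exp_rem \<sigma> (2 * m - k) (of_real x) + poly_chain P k x
     - (\<Sum>\<gamma>\<le>N. C \<gamma> * tpow (2 * m - 1 - k) (x - real \<gamma> / real N))"

lemma smooth_chain_spline:
  assumes "\<sigma> \<noteq> 0" "m \<ge> 1" "N \<ge> 1"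
  shows "smooth_chain m (spline \<kappa> \<sigma> N m C P)"
proof -
  have "smooth_chain m (\<lambda>k x. (poly_chain P k x + \<kappa> * exp_rem \<sigma> (2 * m - k) (of_real x)) +
      (\<Sum>\<gamma>\<in>{..N}. - C \<gamma> * tpow (2 * m - 1 - k) (x - real \<gamma> / real N)))"
    using assms by (intro smooth_chain_sum smooth_chain_add smooth_chain_poly smooth_chain_exp_rem smooth_chain_tpow) auto
  then show ?thesis
    by (simp add: spline_def[abs_def] sum_negf algebra_simps)
qed

lemma spline_eq_peano:
  assumes "degree P < m"
  shows "spline \<kappa> \<sigma> N m C P m = peano \<kappa> \<sigma> N m C"
  using assms by (auto simp: spline_def peano_def poly_chain_def higher_pderiv_eq_0 mult_2)

section \<open>The inner product of derivatives and extremal elements\<close>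

lemma l2_integrable:
  assumes "smooth_chain m f" "smooth_chain m g"
  shows "set_integrable lebesgue {0..1} (\<lambda>x. f m x * cnj (g m x))"
proof -
  obtain B B' where B: "f m \<in> borel_measurable borel" "\<forall>x\<in>{0..1}. norm (f m x) \<le> B"
    "g m \<in> borel_measurable borel" "\<forall>x\<in>{0..1}. norm (g m x) \<le> B'"
    using assms unfolding smooth_chain_def by blast
  show ?thesis
  proof (rule bounded_borel_set_integrable)
    show "(\<lambda>x. f m x * cnj (g m x)) \<in> borel_measurable borel"
      by (intro borel_measurable_times B(1) measurable_compose[OF B(3)] borel_measurable_continuous_onI continuous_intros)
    show "\<forall>x\<in>{0..1}. norm (f m x * cnj (g m x)) \<le> B * B'"
    proof
      fix x :: real assume "x \<in> {0..1}"
      then have "norm (f m x) \<le> B" "norm (g m x) \<le> B'" using B by auto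
      then show "norm (f m x * cnj (g m x)) \<le> B * B'"
        unfolding norm_mult complex_mod_cnj by (intro mult_mono) (auto intro: order_trans[OF norm_ge_zero])
    qed
  qed
qed

lemma l2_inner_self:
  assumes "smooth_chain m f"
  shows "set_integrable lebesgue {0..1} (\<lambda>x. (cmod (f m x))\<^sup>2)"
    "l2_inner (f m) (f m) = of_real (LINT x:{0..1}|lebesgue. (cmod (f m x))\<^sup>2)"
    "Re (l2_inner (f m) (f m)) \<ge> 0" "l2_inner (f m) (f m) = of_real (Re (l2_inner (f m) (f m)))"
proof -
  have sq: "z * cnj z = complex_of_real ((cmod z)\<^sup>2)" for z
    by (rule complex_norm_square[symmetric])
  note int = l2_integrable[OF assms assms, unfolded sq]
  show 1: "set_integrable lebesgue {0..1} (\<lambda>x. (cmod (f m x))\<^sup>2)"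
    using integrable_Re[OF int[unfolded set_integrable_def]] unfolding set_integrable_def by simp
  have "l2_inner (f m) (f m) = (LINT x:{0..1}|lebesgue. complex_of_real ((cmod (f m x))\<^sup>2))"
    unfolding l2_inner_def sq by (rule set_lebesgue_integral_eq_integral(2)[OF int, symmetric])
  also have "\<dots> = of_real (LINT x:{0..1}|lebesgue. (cmod (f m x))\<^sup>2)"
    by (rule set_integral_complex_of_real)
  finally show 2: "l2_inner (f m) (f m) = of_real (LINT x:{0..1}|lebesgue. (cmod (f m x))\<^sup>2)" .
  show "Re (l2_inner (f m) (f m)) \<ge> 0" unfolding 2 Re_complex_of_real set_lebesgue_integral_def
    by (intro Bochner_Integration.integral_nonneg) auto
  show "l2_inner (f m) (f m) = of_real (Re (l2_inner (f m) (f m)))" unfolding 2 by simp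
qed

lemma l2_inner_add_scale:
  assumes f: "smooth_chain m f" and g: "smooth_chain m g"
  shows "Re (l2_inner (\<lambda>x. f m x + t * g m x) (\<lambda>x. f m x + t * g m x)) =
    Re (l2_inner (f m) (f m)) + 2 * Re (t * l2_inner (g m) (f m)) + (cmod t)\<^sup>2 * Re (l2_inner (g m) (g m))"
proof -
  note I = set_lebesgue_integral_eq_integral(1)[OF l2_integrable]
  have "((\<lambda>x. f m x * cnj (f m x) + cnj t * (f m x * cnj (g m x)) + t * (g m x * cnj (f m x)) + (t * cnj t) * (g m x * cnj (g m x)))
      has_integral (l2_inner (f m) (f m) + cnj t * l2_inner (f m) (g m) + t * l2_inner (g m) (f m) + (t * cnj t) * l2_inner (g m) (g m))) {0..1}"
    unfolding l2_inner_def
    by (intro has_integral_add has_integral_mult_right integrable_integral I f g)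
  from integral_unique[OF this]
  have e: "l2_inner (\<lambda>x. f m x + t * g m x) (\<lambda>x. f m x + t * g m x) =
      l2_inner (f m) (f m) + cnj t * l2_inner (f m) (g m) + t * l2_inner (g m) (f m) + (t * cnj t) * l2_inner (g m) (g m)"
    unfolding l2_inner_def[of "\<lambda>x. f m x + t * g m x"] by (simp add: algebra_simps)
  have "l2_inner (f m) (g m) = cnj (l2_inner (g m) (f m))"
    unfolding l2_inner_def Henstock_Kurzweil_Integration.integral_cnj by (simp add: mult.commute)
  moreover have "t * cnj t = of_real ((cmod t)\<^sup>2)" by (rule complex_norm_square[symmetric])
  ultimately show ?thesis unfolding e by (simp add: algebra_simps)
qed

text \<open>Cauchy-Schwarz for a function \<open>g\<close> that is only measurable and square
  integrable. The inequality \<open>2 |f g| \<le> t |f|^2 + |g|^2 / t\<close> also yields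
  integrability of the product; then \<open>t = 1 / sqrt A\<close> is optimal, and for
  \<open>A = 0\<close> the parameter grows without bound.\<close>

lemma l2_bound:
  assumes V: "smooth_chain m f" and g: "set_borel_measurable lebesgue {0..1} g"
    and g2: "set_integrable lebesgue {0..1} (\<lambda>x. (cmod (g x))\<^sup>2)" "(LINT x:{0..1}|lebesgue. (cmod (g x))\<^sup>2) \<le> 1"
  shows "cmod (integral {0..1} (\<lambda>x. f m x * g x)) \<le> sqrt (Re (l2_inner (f m) (f m)))"
proof -
  define A where "A = (LINT x:{0..1}|lebesgue. (cmod (f m x))\<^sup>2)"
  have A: "Re (l2_inner (f m) (f m)) = A" unfolding l2_inner_self(2)[OF V] A_def by simp
  then have A0: "A \<ge> 0" using l2_inner_self(3)[OF V] by simp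
  note fI = l2_inner_self(1)[OF V]
  have fm: "f m \<in> borel_measurable borel" using V unfolding smooth_chain_def by blast
  have bd: "cmod (f m x * g x) \<le> (t * (cmod (f m x))\<^sup>2 + (cmod (g x))\<^sup>2 / t) / 2" if t: "t > 0" for t x
  proof -
    have "0 \<le> (t * cmod (f m x) - cmod (g x))\<^sup>2 / t" using t by simp
    also have "\<dots> = t * (cmod (f m x))\<^sup>2 + (cmod (g x))\<^sup>2 / t - 2 * (cmod (f m x) * cmod (g x))"
      using t by (simp add: power2_eq_square field_simps)
    finally show ?thesis by (simp add: norm_mult)
  qed
  have sI: "set_integrable lebesgue {0..1} (\<lambda>x. (t * (cmod (f m x))\<^sup>2 + (cmod (g x))\<^sup>2 / t) / 2)" for t
    using fI g2(1) by (intro set_integrable_divide set_integral_add(1) set_integrable_mult_right) auto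
  have fgI: "set_integrable lebesgue {0..1} (\<lambda>x. f m x * g x)"
  proof (rule set_integrable_bound[OF sI[of 1]])
    have "(\<lambda>x. f m x * (indicator {0..1} x *\<^sub>R g x)) \<in> borel_measurable lebesgue"
    proof (rule borel_measurable_times)
      show "f m \<in> borel_measurable lebesgue" using fm by (intro measurable_completion) simp
      show "(\<lambda>x. indicator {0..1} x *\<^sub>R g x) \<in> borel_measurable lebesgue"
        using g unfolding set_borel_measurable_def .
    qed
    then show "set_borel_measurable lebesgue {0..1} (\<lambda>x. f m x * g x)"
      unfolding set_borel_measurable_def by (simp add: mult_scaleR_right)
    show "AE x in lebesgue. x \<in> {0..1} \<longrightarrow> cmod (f m x * g x) \<le> norm ((1 * (cmod (f m x))\<^sup>2 + (cmod (g x))\<^sup>2 / 1) / 2)"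
      using bd[of 1] by (intro AE_I2) (auto intro: order_trans)
  qed
  have le: "cmod (integral {0..1} (\<lambda>x. f m x * g x)) \<le> (t * A + 1 / t) / 2" if t: "t > 0" for t
  proof -
    have "cmod (integral {0..1} (\<lambda>x. f m x * g x)) = cmod (LINT x:{0..1}|lebesgue. f m x * g x)"
      using set_lebesgue_integral_eq_integral(2)[OF fgI] by simp
    also have "\<dots> \<le> (LINT x:{0..1}|lebesgue. cmod (f m x * g x))"
      by (rule set_integral_norm_bound[OF fgI])
    also have "\<dots> \<le> (LINT x:{0..1}|lebesgue. (t * (cmod (f m x))\<^sup>2 + (cmod (g x))\<^sup>2 / t) / 2)"
      using bd[OF t] by (intro set_integral_mono sI set_integrable_norm fgI)
    also have "\<dots> = (t * A + (LINT x:{0..1}|lebesgue. (cmod (g x))\<^sup>2) / t) / 2"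
      using fI g2(1) by (simp add: A_def set_integral_add set_integrable_mult_right set_integrable_divide)
    also have "\<dots> \<le> (t * A + 1 / t) / 2" using g2(2) t by (intro divide_right_mono add_left_mono) auto
    finally show ?thesis .
  qed
  show ?thesis
  proof (cases "A = 0")
    case True
    have "cmod (integral {0..1} (\<lambda>x. f m x * g x)) \<le> e" if "e > 0" for e
      using le[of "1 / e"] that True by simp
    then have "cmod (integral {0..1} (\<lambda>x. f m x * g x)) \<le> 0 + e" if "e > 0" for e using that by simp
    then have "cmod (integral {0..1} (\<lambda>x. f m x * g x)) \<le> 0" by (rule field_le_epsilon)
    then show ?thesis using A True by simp
  next
    case False
    then have "sqrt A > 0" using A0 by simp
    then have "(1 / sqrt A * A + 1 / (1 / sqrt A)) / 2 = sqrt A"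
      by (simp add: field_simps)
    then show ?thesis using le[of "1 / sqrt A"] \<open>sqrt A > 0\<close> A by simp
  qed
qed

text \<open>A functional of norm at most \<open>M\<close> takes the value \<open>M^2\<close> at an
  element \<open>u\<close> of norm \<open>M\<close>. The hypothesis is the norm bound at
  \<open>u + t f\<close>, where \<open>L\<close> is the value at \<open>f\<close>, \<open>X\<close>
  the inner product of \<open>f\<close> with \<open>u\<close>, and \<open>Y\<close> the squared norm
  of \<open>f\<close>. Comparing the terms linear in \<open>t\<close> gives
  \<open>L = X\<close>.\<close>

lemma norm_attaining_functional:
  fixes L X :: complex and M Y :: real
  assumes M: "M > 0" and Y: "Y \<ge> 0"
    and le: "\<And>t. (cmod (of_real (M\<^sup>2) + t * L))\<^sup>2 \<le> M\<^sup>2 * (M\<^sup>2 + 2 * Re (t * X) + (cmod t)\<^sup>2 * Y)"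
  shows "L = X"
proof (rule ccontr)
  assume "L \<noteq> X"
  define d where "d = L - X"
  have d: "cmod d > 0" using \<open>L \<noteq> X\<close> by (simp add: d_def)
  \<comment> \<open>The direction \<open>cnj d\<close> makes the linear terms differ by
    \<open>s * |d|^2\<close>, and \<open>s\<close> is small enough that the quadratic term cannot
    make up for it.\<close>
  define s where "s = 1 / (Y + 1)"
  have s: "s > 0" "s * Y < 1" using Y by (auto simp: s_def field_simps)
  define t where "t = of_real s * cnj d"
  have td: "Re (t * L) - Re (t * X) = s * (cmod d)\<^sup>2"
  proof -
    have "t * L - t * X = of_real s * (d * cnj d)" by (simp add: t_def d_def algebra_simps)
    also have "\<dots> = of_real (s * (cmod d)\<^sup>2)" by (simp add: complex_norm_square[symmetric])
    finally show ?thesis by (metis Re_complex_of_real minus_complex.simps(1))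
  qed
  have "(M\<^sup>2 + Re (t * L))\<^sup>2 \<le> (cmod (of_real (M\<^sup>2) + t * L))\<^sup>2"
    by (simp add: cmod_power2)
  also have "\<dots> \<le> M\<^sup>2 * (M\<^sup>2 + 2 * Re (t * X) + (cmod t)\<^sup>2 * Y)" by (rule le)
  finally have b: "(M\<^sup>2 + Re (t * L))\<^sup>2 \<le> M\<^sup>2 * (M\<^sup>2 + 2 * Re (t * X) + (cmod t)\<^sup>2 * Y)" .
  have e1: "(M\<^sup>2 + r)\<^sup>2 = M\<^sup>2 * M\<^sup>2 + M\<^sup>2 * (2 * r) + r\<^sup>2" for r
    by (simp add: power2_eq_square algebra_simps)
  have e2: "M\<^sup>2 * (M\<^sup>2 + 2 * x + y) = M\<^sup>2 * M\<^sup>2 + M\<^sup>2 * (2 * x + y)" for x y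
    by (simp add: algebra_simps)
  have e3: "p \<le> q" if "a + p + r \<le> a + q" "0 \<le> r" for a p q r :: real using that by simp
  have "M\<^sup>2 * (2 * Re (t * L)) \<le> M\<^sup>2 * (2 * Re (t * X) + (cmod t)\<^sup>2 * Y)"
    by (rule e3[OF b[unfolded e1 e2] zero_le_power2])
  then have "2 * Re (t * L) \<le> 2 * Re (t * X) + (cmod t)\<^sup>2 * Y" using M by simp
  then have "2 * (s * (cmod d)\<^sup>2) \<le> (cmod t)\<^sup>2 * Y" using td by linarith
  also have "(cmod t)\<^sup>2 = s\<^sup>2 * (cmod d)\<^sup>2" by (simp add: t_def norm_mult power_mult_distrib)
  finally have "(s * (cmod d)\<^sup>2) * 2 \<le> (s * (cmod d)\<^sup>2) * (s * Y)"
    by (simp add: power2_eq_square mult_ac)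
  moreover have "s * (cmod d)\<^sup>2 > 0" using s d by simp
  ultimately have "2 \<le> s * Y" by (metis mult_le_cancel_left_pos)
  then show False using s by simp
qed

text \<open>The chain of \<open>x ^ j\<close> with \<open>j + 1\<close> steps ends in 0, so its
  kernel integral disappears and exactness becomes an equation between boundary coefficients up to
  order \<open>j\<close>. These equations are triangular with diagonal entries \<open>fact j\<close>
  up to sign.\<close>

lemma exact_imp_peano_boundary:
  assumes ex: "\<And>j. j < m \<Longrightarrow> quad_err \<kappa> \<sigma> N C (\<lambda>x. of_real (x ^ j)) = 0" and \<sigma>: "\<sigma> \<noteq> 0" and N: "N \<ge> 1" and i: "i < m"
  shows "\<kappa> * exp_rem \<sigma> (Suc i) 1 - (\<Sum>\<gamma>\<le>N. C \<gamma> * of_real ((1 - real \<gamma> / real N) ^ i / fact i)) = 0"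
  using i
proof (induction i rule: less_induct)
  case (less j)
  define R where "R i = \<kappa> * exp_rem \<sigma> (Suc i) 1 - (\<Sum>\<gamma>\<le>N. C \<gamma> * of_real ((1 - real \<gamma> / real N) ^ i / fact i))" for i
  define f where "f = poly_chain (monom 1 j)"
  have "ac_chain (Suc j) f" unfolding f_def by (intro smooth_chain_imp_ac_chain smooth_chain_poly) simp
  note K = quad_err_kernel(2)[OF this _ \<sigma> N, of \<kappa> C]
  have "f 0 = (\<lambda>x. of_real (x ^ j))" by (auto simp: f_def poly_chain_def poly_monom)
  moreover have "f (Suc j) = (\<lambda>x. 0)"
    by (auto simp: f_def poly_chain_def higher_pderiv_eq_0 degree_monom_eq simp del: funpow.simps)
  ultimately have "0 = (\<Sum>i<Suc j. (- 1) ^ i * f i 1 * R i)"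
    using K ex[OF less.prems] by (simp add: R_def)
  also have "\<dots> = (- 1) ^ j * f j 1 * R j" using less by (simp add: R_def)
  also have "f j 1 = fact j"
    using higher_pderiv_degree[of "monom 1 j" j] by (simp add: f_def poly_chain_def degree_monom_eq)
  finally show ?case by (simp add: R_def)
qed

lemma exact_kernel:
  assumes ex: "\<And>j. j < m \<Longrightarrow> quad_err \<kappa> \<sigma> N C (\<lambda>x. of_real (x ^ j)) = 0"
    and \<sigma>: "\<sigma> \<noteq> 0" and N: "N \<ge> 1" and m: "m \<ge> 1" and f: "ac_chain m f"
  shows "quad_err \<kappa> \<sigma> N C (f 0) = (- 1) ^ m * integral {0..1} (\<lambda>x. peano \<kappa> \<sigma> N m C x * f m x)"
  using quad_err_kernel(2)[OF f m \<sigma> N, of \<kappa> C] exact_imp_peano_boundary[OF ex \<sigma> N] by simp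

text \<open>The kernel is the \<open>m\<close>-th derivative of the spline, so the error at the
  conjugate of the spline is a squared norm; the factor \<open>(- 1) ^ m\<close> cancels the sign of
  the kernel formula.\<close>

lemma exact_spline_self:
  assumes ex: "\<And>j. j < m \<Longrightarrow> quad_err \<kappa> \<sigma> N C (\<lambda>x. of_real (x ^ j)) = 0"
    and \<sigma>: "\<sigma> \<noteq> 0" and N: "N \<ge> 1" and m: "m \<ge> 1" and P: "degree P < m"
  shows "quad_err \<kappa> \<sigma> N C (\<lambda>x. (- 1) ^ m * cnj (spline \<kappa> \<sigma> N m C P 0 x)) =
    l2_inner (spline \<kappa> \<sigma> N m C P m) (spline \<kappa> \<sigma> N m C P m)"
proof -
  have s2: "(- 1 :: complex) ^ m * ((- 1) ^ m * y) = y" for y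
    by (simp add: mult.assoc[symmetric] power_mult_distrib[symmetric])
  have "ac_chain m (\<lambda>k x. (- 1) ^ m * cnj (spline \<kappa> \<sigma> N m C P k x))"
    by (rule smooth_chain_imp_ac_chain[OF smooth_chain_cnj[OF smooth_chain_spline[OF \<sigma> m N]]])
  from exact_kernel[OF ex \<sigma> N m this]
  have "quad_err \<kappa> \<sigma> N C (\<lambda>x. (- 1) ^ m * cnj (spline \<kappa> \<sigma> N m C P 0 x)) =
      (- 1) ^ m * integral {0..1} (\<lambda>x. peano \<kappa> \<sigma> N m C x * ((- 1) ^ m * cnj (peano \<kappa> \<sigma> N m C x)))"
    by (simp only: spline_eq_peano[OF P])
  also have "(\<lambda>x. peano \<kappa> \<sigma> N m C x * ((- 1) ^ m * cnj (peano \<kappa> \<sigma> N m C x))) =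
      (\<lambda>x. (- 1) ^ m * (peano \<kappa> \<sigma> N m C x * cnj (peano \<kappa> \<sigma> N m C x)))"
    by (rule ext) (rule mult.left_commute)
  finally show ?thesis
    unfolding spline_eq_peano[OF P] l2_inner_def integral_mult_right s2 .
qed

lemma quad_err_scale: "quad_err \<kappa> \<sigma> N C (\<lambda>x. t * f x) = t * quad_err \<kappa> \<sigma> N C f"
proof -
  have "integral {0..1} (\<lambda>x. exp (\<sigma> * of_real x) * (t * f x)) = t * integral {0..1} (\<lambda>x. exp (\<sigma> * of_real x) * f x)"
    by (simp add: mult.left_commute[of _ t])
  then show ?thesis
    by (simp add: quad_err_def right_diff_distrib sum_distrib_left mult_ac)
qed

lemma quad_err_add:
  assumes "continuous_on {0..1} f" "continuous_on {0..1} g"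
  shows "quad_err \<kappa> \<sigma> N C (\<lambda>x. f x + g x) = quad_err \<kappa> \<sigma> N C f + quad_err \<kappa> \<sigma> N C g"
proof -
  have "integral {0..1} (\<lambda>x. exp (\<sigma> * of_real x) * (f x + g x)) =
      integral {0..1} (\<lambda>x. exp (\<sigma> * of_real x) * f x) + integral {0..1} (\<lambda>x. exp (\<sigma> * of_real x) * g x)"
    unfolding distrib_left
    by (intro integral_add integrable_continuous_real continuous_on_mult assms continuous_intros)
  then show ?thesis by (simp add: quad_err_def distrib_left sum.distrib)
qed

lemma smooth_chain_continuous:
  assumes "smooth_chain m f" "m \<ge> 1" shows "continuous_on {0..1} (f 0)"
  using smooth_chain_imp_ac_chain[OF assms(1)] assms(2) unfolding ac_chain_def
  by (auto intro: ac_on_continuous)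

lemma l2_inner_scale:
  "Re (l2_inner (\<lambda>x. t * f x) (\<lambda>x. t * f x)) = (cmod t)\<^sup>2 * Re (l2_inner f f)"
proof -
  have "(\<lambda>x. t * f x * cnj (t * f x)) = (\<lambda>x. of_real ((cmod t)\<^sup>2) * (f x * cnj (f x)))"
    unfolding complex_norm_square by (auto simp: mult_ac)
  then have "l2_inner (\<lambda>x. t * f x) (\<lambda>x. t * f x) = of_real ((cmod t)\<^sup>2) * l2_inner f f"
    unfolding l2_inner_def by simp
  then show ?thesis by simp
qed

text \<open>Scaling carries the bound from the unit ball to all \<open>f\<close>. If the seminorm of
  \<open>f\<close> is 0, all multiples of \<open>f\<close> lie in the unit ball, so a finite norm
  forces the error at \<open>f\<close> to vanish.\<close>

lemma error_norm_smooth_bound: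
  assumes D: "error_norm m 0 1 N \<omega> D \<le> ereal E" and f: "smooth_chain m f" and m: "m \<ge> 1"
  shows "cmod (quad_err 1 (2 * of_real pi * \<i> * of_real \<omega>) N D (f 0)) \<le> E * sqrt (Re (l2_inner (f m) (f m)))"
proof -
  let ?q = "quad_err 1 (2 * of_real pi * \<i> * of_real \<omega>) N D"
  define n where "n = sqrt (Re (l2_inner (f m) (f m)))"
  have n0: "n \<ge> 0" unfolding n_def using l2_inner_self(3)[OF f] by simp
  have scaled: "cmod t * cmod (?q (f 0)) \<le> E" if t: "cmod t * n \<le> 1" for t
  proof -
    have "smooth_chain m (\<lambda>k x. f k x + (t - 1) * f k x)" by (rule smooth_chain_add[OF f f])
    then have tf: "smooth_chain m (\<lambda>k x. t * f k x)" by (simp add: algebra_simps)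
    have "sobolev_norm m 0 1 (\<lambda>x. t * f 0 x) = sqrt ((cmod t)\<^sup>2 * Re (l2_inner (f m) (f m)))"
      using smooth_chain_sobolev(2)[OF tf m] by (simp add: l2_inner_scale)
    also have "\<dots> = cmod t * n" by (simp add: n_def real_sqrt_mult)
    finally have "sobolev_norm m 0 1 (\<lambda>x. t * f 0 x) \<le> 1" using t by simp
    moreover have mem: "(\<lambda>x. t * f 0 x) \<in> sobolev_space m 0 1"
      using smooth_chain_sobolev(1)[OF tf m] .
    ultimately have "ereal (cmod (error_functional 0 1 N \<omega> D (\<lambda>x. t * f 0 x))) \<le> error_norm m 0 1 N \<omega> D"
      unfolding error_norm_def by (intro SUP_upper) simp
    then have "ereal (cmod (error_functional 0 1 N \<omega> D (\<lambda>x. t * f 0 x))) \<le> ereal E"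
      using D by (rule order_trans)
    then show ?thesis
      unfolding error_functional_sobolev[OF mem m] quad_err_scale by (simp add: norm_mult)
  qed
  show ?thesis
  proof (cases "n = 0")
    case True
    have "?q (f 0) = 0"
    proof (rule ccontr)
      assume nz: "?q (f 0) \<noteq> 0"
      have "cmod (of_real ((\<bar>E\<bar> + 1) / cmod (?q (f 0)))) * cmod (?q (f 0)) \<le> E"
        by (rule scaled) (simp add: True)
      then show False using nz by (simp add: norm_divide)
    qed
    then show ?thesis using True unfolding n_def by simp
  next
    case False
    then have n: "n > 0" using n0 by simp
    have "cmod (of_real (1 / n)) * cmod (?q (f 0)) \<le> E"
      by (rule scaled) (use n in \<open>simp add: norm_divide\<close>)
    then show ?thesis using n unfolding n_def[symmetric] by (simp add: norm_divide field_simps)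
  qed
qed

lemma error_norm_nonneg:
  assumes m: "m \<ge> 1" shows "0 \<le> error_norm m 0 1 N \<omega> D"
proof -
  have z: "poly_chain 0 k = (\<lambda>_. 0)" for k
    by (cases "k = 0") (auto simp: poly_chain_def higher_pderiv_eq_0)
  have "smooth_chain m (poly_chain 0)" by (rule smooth_chain_poly[OF m])
  from smooth_chain_sobolev[OF this m]
  have "(\<lambda>_. 0) \<in> sobolev_space m 0 1" "sobolev_norm m 0 1 (\<lambda>_. 0) = 0"
    unfolding z by (simp_all add: l2_inner_def)
  then have "ereal (cmod (error_functional 0 1 N \<omega> D (\<lambda>_. 0))) \<le> error_norm m 0 1 N \<omega> D"
    unfolding error_norm_def by (intro SUP_upper) simp
  then show ?thesis by (rule order_trans[rotated]) simp
qed

lemma poly_exact_iff: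
  "poly_exact m 0 1 N \<omega> C \<longleftrightarrow>
    (\<forall>j<m. quad_err 1 (2 * of_real pi * \<i> * of_real \<omega>) N C (\<lambda>x. of_real (x ^ j)) = 0)"
proof -
  have "ac_on 0 1 (\<lambda>x. complex_of_real (x ^ j))" for j
  proof -
    have "smooth_chain 1 (poly_chain (monom 1 j))" by (rule smooth_chain_poly) simp
    from smooth_chain_imp_ac_chain[OF this] have "ac_on 0 1 (poly_chain (monom 1 j) 0)"
      by (auto simp: ac_chain_def)
    then show ?thesis by (simp add: poly_chain_def[abs_def] poly_monom)
  qed
  then show ?thesis unfolding poly_exact_def by (simp add: error_functional_eq_quad_err)
qed

section \<open>Optimality and uniqueness through interpolating splines\<close>

lemma spline_optimal:
  assumes m: "m \<ge> 1" and N: "N \<ge> 1" and \<omega>: "\<omega> \<noteq> 0" and P: "degree P < m"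
    and ex: "poly_exact m 0 1 N \<omega> C"
    and nodes: "\<And>\<beta>. \<beta> \<le> N \<Longrightarrow> spline 1 (2 * of_real pi * \<i> * of_real \<omega>) N m C P 0 (real \<beta> / real N) = 0"
  shows "sard_optimal m 0 1 N \<omega> D \<longleftrightarrow> (\<forall>\<beta>\<in>{0..N}. D \<beta> = C \<beta>)"
proof -
  define \<sigma> where "\<sigma> = 2 * of_real pi * \<i> * complex_of_real \<omega>"
  have \<sigma>: "\<sigma> \<noteq> 0" using \<omega> by (simp add: \<sigma>_def)
  define s where "s = spline 1 \<sigma> N m C P"
  define u where "u k x = (- 1) ^ m * cnj (s k x)" for k x
  have s: "smooth_chain m s" unfolding s_def by (rule smooth_chain_spline[OF \<sigma> m N])
  have u: "smooth_chain m u" unfolding u_def[abs_def] by (rule smooth_chain_cnj[OF s])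
  have ex': "quad_err 1 \<sigma> N C (\<lambda>x. of_real (x ^ j)) = 0" if "j < m" for j
    using ex that unfolding poly_exact_iff \<sigma>_def by blast
  define M where "M = sqrt (Re (l2_inner (s m) (s m)))"
  have M2: "l2_inner (s m) (s m) = of_real (M\<^sup>2)" and M0: "M \<ge> 0"
    using l2_inner_self(3,4)[OF s] by (auto simp: M_def)
  have um: "Re (l2_inner (u m) (u m)) = M\<^sup>2"
  proof -
    have "u m = (\<lambda>x. (- 1) ^ m * cnj (s m x))" by (auto simp: u_def)
    moreover have "l2_inner (\<lambda>x. cnj (s m x)) (\<lambda>x. cnj (s m x)) = l2_inner (s m) (s m)"
      unfolding l2_inner_def by (simp add: mult.commute)
    ultimately show ?thesis
      using l2_inner_scale[of "(- 1) ^ m" "\<lambda>x. cnj (s m x)"] by (simp add: M2 norm_power)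
  qed
  have qu: "quad_err 1 \<sigma> N D (u 0) = of_real (M\<^sup>2)" for D
  proof -
    have "quad_err 1 \<sigma> N C (u 0) = of_real (M\<^sup>2)"
      using exact_spline_self[OF ex' \<sigma> N m P] unfolding u_def s_def[symmetric] M2 .
    moreover have "u 0 (real \<gamma> / real N) = 0" if "\<gamma> \<le> N" for \<gamma>
      using nodes[OF that] by (simp add: u_def s_def \<sigma>_def)
    ultimately show ?thesis by (simp add: quad_err_def)
  qed
  have upper: "error_norm m 0 1 N \<omega> C \<le> ereal M"
    unfolding error_norm_def
  proof (rule SUP_least)
    fix \<phi> assume "\<phi> \<in> {\<phi> \<in> sobolev_space m 0 1. sobolev_norm m 0 1 \<phi> \<le> 1}"
    then have \<phi>: "\<phi> \<in> sobolev_space m 0 1" "sobolev_norm m 0 1 \<phi> \<le> 1" by auto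
    have sq: "z * cnj z = complex_of_real ((cmod z)\<^sup>2)" for z
      by (rule complex_norm_square[symmetric])
    have mem: "set_borel_measurable lebesgue {0..1} (deriv_on 0 1 m \<phi>)"
      "set_integrable lebesgue {0..1} (\<lambda>x. (cmod (deriv_on 0 1 m \<phi> x))\<^sup>2)"
      using \<phi>(1) by (auto simp: sobolev_space_def)
    have "(LINT x:{0..1}|lebesgue. (cmod (deriv_on 0 1 m \<phi> x))\<^sup>2) \<le> 1"
      using \<phi>(2) unfolding sobolev_norm_def sobolev_inner_def sq set_integral_complex_of_real by simp
    from l2_bound[OF s mem this]
    have "cmod (integral {0..1} (\<lambda>x. s m x * deriv_on 0 1 m \<phi> x)) \<le> M" by (simp add: M_def)
    moreover have "error_functional 0 1 N \<omega> C \<phi> = (- 1) ^ m * integral {0..1} (\<lambda>x. s m x * deriv_on 0 1 m \<phi> x)"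
      using exact_kernel[OF ex' \<sigma> N m sobolev_imp_ac_chain[OF \<phi>(1)]] error_functional_sobolev[OF \<phi>(1) m, of N \<omega> C]
      unfolding s_def spline_eq_peano[OF P] by (simp add: deriv_on_def \<sigma>_def)
    ultimately show "ereal (cmod (error_functional 0 1 N \<omega> C \<phi>)) \<le> ereal M"
      by (simp add: norm_mult norm_power)
  qed
  have lower: "ereal M \<le> error_norm m 0 1 N \<omega> D" for D
  proof (cases "error_norm m 0 1 N \<omega> D")
    case (real E)
    have "cmod (quad_err 1 \<sigma> N D (u 0)) \<le> E * sqrt (Re (l2_inner (u m) (u m)))"
      unfolding \<sigma>_def by (rule error_norm_smooth_bound[OF _ u m]) (simp add: real)
    then have *: "M\<^sup>2 \<le> E * M" unfolding qu um using M0 by (simp add: norm_power)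
    have "0 \<le> E" using error_norm_nonneg[OF m, of N \<omega> D] by (simp add: real)
    then have "M \<le> E" using * M0 by (cases "M = 0") (auto simp: power2_eq_square)
    then show ?thesis by (simp add: real)
  next
    case MInf
    then show ?thesis using error_norm_nonneg[OF m, of N \<omega> D] by simp
  qed simp
  have Copt: "sard_optimal m 0 1 N \<omega> C"
    unfolding sard_optimal_def using ex upper lower order_trans by blast
  show ?thesis
  proof
    assume eq: "\<forall>\<beta>\<in>{0..N}. D \<beta> = C \<beta>"
    have "error_functional 0 1 N \<omega> D \<phi> = error_functional 0 1 N \<omega> C \<phi>" for \<phi>
      using eq by (simp add: error_functional_def)
    then show "sard_optimal m 0 1 N \<omega> D"
      using Copt by (simp add: sard_optimal_def poly_exact_def error_norm_def)
  next
    assume "sard_optimal m 0 1 N \<omega> D"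
    then have D: "error_norm m 0 1 N \<omega> D \<le> ereal M"
      using ex upper unfolding sard_optimal_def by (meson order_trans)
    \<comment> \<open>Every \<open>B\<close> with norm at most \<open>M\<close> has the error
      \<open>M^2\<close> at \<open>u\<close>, which itself has norm \<open>M\<close>; hence its
      error is the inner product with \<open>u\<close>, whatever \<open>B\<close> is. For
      \<open>M = 0\<close> it is 0.\<close>
    have determined: "quad_err 1 \<sigma> N B (f 0) = (if M = 0 then 0 else l2_inner (f m) (u m))"
      if B: "error_norm m 0 1 N \<omega> B \<le> ereal M" and f: "smooth_chain m f" for B f
    proof (cases "M = 0")
      case True
      then show ?thesis using error_norm_smooth_bound[OF B f m] by (simp add: \<sigma>_def)
    next
      case False
      have "quad_err 1 \<sigma> N B (f 0) = l2_inner (f m) (u m)"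
      proof (rule norm_attaining_functional[of M "Re (l2_inner (f m) (f m))"])
        fix t
        have uf: "smooth_chain m (\<lambda>k x. u k x + t * f k x)" by (rule smooth_chain_add[OF u f])
        have "quad_err 1 \<sigma> N B (\<lambda>x. u 0 x + t * f 0 x) = of_real (M\<^sup>2) + t * quad_err 1 \<sigma> N B (f 0)"
          using smooth_chain_continuous[OF u m] smooth_chain_continuous[OF f m]
          by (subst quad_err_add) (auto intro: continuous_on_mult_left simp: quad_err_scale qu)
        moreover have "cmod (quad_err 1 \<sigma> N B (\<lambda>x. u 0 x + t * f 0 x)) \<le>
            M * sqrt (Re (l2_inner (\<lambda>x. u m x + t * f m x) (\<lambda>x. u m x + t * f m x)))"
          using error_norm_smooth_bound[OF B uf m] by (simp add: \<sigma>_def)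
        ultimately have "(cmod (of_real (M\<^sup>2) + t * quad_err 1 \<sigma> N B (f 0)))\<^sup>2 \<le>
            (M * sqrt (Re (l2_inner (\<lambda>x. u m x + t * f m x) (\<lambda>x. u m x + t * f m x))))\<^sup>2"
          by (metis norm_ge_zero power_mono)
        also have "\<dots> = M\<^sup>2 * (Re (l2_inner (\<lambda>x. u m x + t * f m x) (\<lambda>x. u m x + t * f m x)))"
          using l2_inner_self(3)[OF uf] by (simp add: power_mult_distrib)
        also have "\<dots> = M\<^sup>2 * (M\<^sup>2 + 2 * Re (t * l2_inner (f m) (u m)) + (cmod t)\<^sup>2 * Re (l2_inner (f m) (f m)))"
          unfolding l2_inner_add_scale[OF u f] um ..
        finally show "(cmod (of_real (M\<^sup>2) + t * quad_err 1 \<sigma> N B (f 0)))\<^sup>2 \<le>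
            M\<^sup>2 * (M\<^sup>2 + 2 * Re (t * l2_inner (f m) (u m)) + (cmod t)\<^sup>2 * Re (l2_inner (f m) (f m)))" .
      qed (use False M0 l2_inner_self(3)[OF f] in auto)
      then show ?thesis using False by simp
    qed
    show "\<forall>\<beta>\<in>{0..N}. D \<beta> = C \<beta>"
    proof
      fix \<beta> assume \<beta>: "\<beta> \<in> {0..N}"
      \<comment> \<open>A polynomial that vanishes at every node but \<open>\<beta>\<close>. The
        error at \<open>p\<close> is the same for \<open>D\<close> and \<open>C\<close>, and the
        integrals agree, so it isolates the coefficient at \<open>\<beta>\<close>.\<close>
      define p where "p = (\<Prod>j\<in>{..N} - {\<beta>}. [:- complex_of_real (real j / real N), 1:])"
      have f: "smooth_chain m (poly_chain p)" by (rule smooth_chain_poly[OF m])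
      have val: "poly_chain p 0 (real j / real N) = (\<Prod>i\<in>{..N} - {\<beta>}. of_real (real j / real N - real i / real N))" for j
        by (simp add: poly_chain_def p_def poly_prod)
      have z: "poly_chain p 0 (real j / real N) = 0" if "j \<in> {..N} - {\<beta>}" for j
        unfolding val using that by (intro prod_zero) auto
      have nz: "poly_chain p 0 (real \<beta> / real N) \<noteq> 0"
        unfolding val using N by (auto simp: field_simps)
      have S: "(\<Sum>\<gamma>\<le>N. B \<gamma> * poly_chain p 0 (real \<gamma> / real N)) = B \<beta> * poly_chain p 0 (real \<beta> / real N)" for B
        using \<beta> z by (subst sum.remove[of _ \<beta>]) auto
      have "quad_err 1 \<sigma> N D (poly_chain p 0) = quad_err 1 \<sigma> N C (poly_chain p 0)"
        using determined[OF D f] determined[OF upper f] by simp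
      then show "D \<beta> = C \<beta>" using nz by (simp add: quad_err_def S)
    qed
  qed
qed

text \<open>Vanishing at the nodes makes the error at the conjugate spline zero, so the
  \<open>m\<close>-th derivative vanishes almost everywhere. This removes all truncated powers that
  are active on \<open>{0..1}\<close>, and the remaining polynomial of degree less than
  \<open>m\<close> has \<open>N + 1\<close> roots. The term at the last node is zero on
  \<open>{0..1}\<close> whatever its coefficient.\<close>

lemma spline_homogeneous:
  assumes m: "m \<ge> 1" and N: "N \<ge> 1" and Nm: "N + 1 \<ge> m" and P: "degree P < m"
    and ex: "\<And>j. j < m \<Longrightarrow> quad_err 0 \<sigma> N C (\<lambda>x. of_real (x ^ j)) = 0" and \<sigma>: "\<sigma> \<noteq> 0"
    and nodes: "\<And>\<beta>. \<beta> \<le> N \<Longrightarrow> spline 0 \<sigma> N m C P 0 (real \<beta> / real N) = 0"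
  shows "P = 0"
proof -
  define s where "s = spline 0 \<sigma> N m C P"
  have s: "smooth_chain m s" unfolding s_def by (rule smooth_chain_spline[OF \<sigma> m N])
  have "quad_err 0 \<sigma> N C (\<lambda>x. (- 1) ^ m * cnj (s 0 x)) = 0"
    using nodes by (simp add: quad_err_def s_def)
  then have "l2_inner (s m) (s m) = 0"
    using exact_spline_self[OF ex \<sigma> N m P] by (simp add: s_def)
  then have "(LINT x:{0..1}|lebesgue. (cmod (s m x))\<^sup>2) = 0"
    using l2_inner_self(2)[OF s] by simp
  then have "AE x in lebesgue. indicator {0..1} x *\<^sub>R (cmod (s m x))\<^sup>2 = 0"
    using l2_inner_self(1)[OF s] unfolding set_lebesgue_integral_def set_integrable_def
    by (subst (asm) integral_nonneg_eq_0_iff_AE) auto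
  then have "\<exists>Z\<in>null_sets lebesgue. {x. \<not> (indicator {0..1} x *\<^sub>R (cmod (s m x))\<^sup>2 = 0)} \<subseteq> Z"
    by (auto simp: eventually_ae_filter)
  then have null: "negligible {x. \<not> (indicator {0..1} x *\<^sub>R (cmod (s m x))\<^sup>2 = 0)}"
    using negligible_subset by (auto simp: negligible_iff_null_sets[symmetric])
  have sm: "s m x = - (\<Sum>\<gamma>\<le>N. C \<gamma> * tpow (m - 1) (x - real \<gamma> / real N))" for x
    unfolding s_def spline_eq_peano[OF P] by (simp add: peano_def)
  \<comment> \<open>Induction from the left: between the nodes \<open>\<gamma>\<close> and
    \<open>\<gamma> + 1\<close> the truncated powers of later nodes are zero, and those of earlier
    nodes have coefficient 0.\<close>
  have C0: "C \<gamma> = 0" if "\<gamma> < N" for \<gamma>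
    using that
  proof (induction \<gamma> rule: less_induct)
    case (less \<gamma>)
    define I where "I = {real \<gamma> / real N<..<real (Suc \<gamma>) / real N}"
    have I01: "I \<subseteq> {0..1}"
    proof
      fix x assume "x \<in> I"
      then have "real \<gamma> / real N < x" "x < real (Suc \<gamma>) / real N" by (auto simp: I_def)
      moreover have "0 \<le> real \<gamma> / real N" "real (Suc \<gamma>) / real N \<le> 1" using less.prems N by auto
      ultimately show "x \<in> {0..1}" unfolding atLeastAtMost_iff by linarith
    qed
    have "real \<gamma> / real N < real (Suc \<gamma>) / real N" using N by (intro divide_strict_right_mono) auto
    then have ne: "I \<noteq> {}" unfolding I_def by (simp only: greaterThanLessThan_empty_iff not_le not_False_eq_True)
    \<comment> \<open>The derivative is zero only almost everywhere, but a nonempty open interval is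
      not null and so contains a usable point.\<close>
    have "\<not> I \<subseteq> {x. \<not> (indicator {0..1} x *\<^sub>R (cmod (s m x))\<^sup>2 = 0)}"
      using open_not_negligible[of I] ne negligible_subset[OF null] by (auto simp: I_def)
    then obtain x where x: "x \<in> I" "s m x = 0" using I01 by (auto simp: indicator_def split: if_splits)
    have "(\<Sum>j\<le>N. C j * tpow (m - 1) (x - real j / real N)) = (\<Sum>j\<in>{\<gamma>}. C j * tpow (m - 1) (x - real j / real N))"
    proof (rule sum.mono_neutral_right)
      show "\<forall>j\<in>{..N} - {\<gamma>}. C j * tpow (m - 1) (x - real j / real N) = 0"
      proof
        fix j assume j: "j \<in> {..N} - {\<gamma>}"
        show "C j * tpow (m - 1) (x - real j / real N) = 0"
        proof (cases "j < \<gamma>")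
          case True
          then show ?thesis using less by simp
        next
          case False
          then have "real (Suc \<gamma>) / real N \<le> real j / real N" using j by (intro divide_right_mono) auto
          then have "x - real j / real N \<le> 0" using x(1) by (simp add: I_def)
          then show ?thesis by simp
        qed
      qed
    qed (use less.prems in auto)
    then have "C \<gamma> * tpow (m - 1) (x - real \<gamma> / real N) = 0" using x(2) sm[of x] by simp
    moreover have "tpow k t \<noteq> 0" if "t > 0" for k t using that by (simp add: tpow_def)
    then have "tpow (m - 1) (x - real \<gamma> / real N) \<noteq> 0" using x(1) unfolding I_def by simp
    ultimately show ?case by simp
  qed
  have root: "poly P (of_real (real \<beta> / real N)) = 0" if \<beta>: "\<beta> \<le> N" for \<beta>
  proof -
    have "(\<Sum>\<gamma>\<le>N. C \<gamma> * tpow (2 * m - 1) (real \<beta> / real N - real \<gamma> / real N)) = 0"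
    proof (intro sum.neutral ballI)
      fix \<gamma> assume "\<gamma> \<in> {..N}"
      then show "C \<gamma> * tpow (2 * m - 1) (real \<beta> / real N - real \<gamma> / real N) = 0"
        using C0[of \<gamma>] \<beta> N by (cases "\<gamma> < N") (auto simp: divide_right_mono)
    qed
    then show ?thesis using nodes[OF \<beta>] by (simp add: spline_def poly_chain_def)
  qed
  show "P = 0"
  proof (rule ccontr)
    assume P0: "P \<noteq> 0"
    have inj: "inj_on (\<lambda>\<beta>. complex_of_real (real \<beta> / real N)) {..N}"
      using N by (auto simp: inj_on_def)
    have "N + 1 = card ((\<lambda>\<beta>. complex_of_real (real \<beta> / real N)) ` {..N})"
      using card_image[OF inj] by simp
    also have "\<dots> \<le> card {x. poly P x = 0}"
      using root by (intro card_mono poly_roots_finite P0) auto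
    also have "\<dots> \<le> degree P" by (rule card_poly_roots_bound[OF P0])
    finally show False using P Nm by simp
  qed
qed

section \<open>Regularised moments of geometric sequences\<close>

text \<open>In contrast to \<open>diff_zero\<close> the sum includes \<open>l = 0\<close>, where
  \<open>0 ^ 0 = 1\<close>, so that the recurrences hold from \<open>n = 0\<close> on. The value is
  \<open>fact t\<close> times a Stirling number of the second kind.\<close>

definition fin_diff :: "nat \<Rightarrow> nat \<Rightarrow> complex" where
  "fin_diff t n = (\<Sum>l\<le>t. (- 1) ^ (t - l) * of_nat (t choose l) * of_nat l ^ n)"

lemma fin_diff_eq_diff_zero: "n \<ge> 1 \<Longrightarrow> fin_diff t n = diff_zero t n"
  unfolding fin_diff_def diff_zero_def
  by (rule sum.mono_neutral_right) auto

text \<open>The sum on the right is the \<open>t\<close>-th difference at 1, and the next difference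
  at 0 is the difference at 1 minus the one at 0.\<close>

lemma fin_diff_Suc_left:
  "fin_diff (Suc t) n = (\<Sum>l\<le>t. (- 1) ^ (t - l) * of_nat (t choose l) * of_nat (Suc l) ^ n) - fin_diff t n"
proof -
  have "fin_diff (Suc t) n = (- 1) ^ Suc t * 0 ^ n +
      (\<Sum>l\<le>t. (- 1) ^ (t - l) * of_nat (Suc t choose Suc l) * of_nat (Suc l) ^ n)"
    unfolding fin_diff_def by (subst sum.atMost_Suc_shift) simp
  also have "(\<Sum>l\<le>t. (- 1) ^ (t - l) * of_nat (Suc t choose Suc l) * (of_nat (Suc l) :: complex) ^ n) =
      (\<Sum>l\<le>t. (- 1) ^ (t - l) * of_nat (t choose l) * of_nat (Suc l) ^ n) +
      (\<Sum>l\<le>t. (- 1) ^ (t - l) * of_nat (t choose Suc l) * of_nat (Suc l) ^ n)"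
    by (simp only: sum.distrib[symmetric]) (intro sum.cong refl, simp add: algebra_simps)
  also have "(\<Sum>l\<le>t. (- 1) ^ (t - l) * of_nat (t choose Suc l) * (of_nat (Suc l) :: complex) ^ n) =
      - (\<Sum>l\<le>t. (- 1) ^ (Suc t - Suc l) * - of_nat (t choose Suc l) * of_nat (Suc l) ^ n)"
    by (simp add: sum_negf)
  also have "- (\<Sum>l\<le>t. (- 1) ^ (Suc t - Suc l) * - of_nat (t choose Suc l) * (of_nat (Suc l) :: complex) ^ n)
      = (\<Sum>l\<le>Suc t. (- 1) ^ (Suc t - l) * of_nat (t choose l) * of_nat l ^ n) - (- 1) ^ Suc t * 0 ^ n"
    by (subst sum.atMost_Suc_shift) (simp add: sum_negf)
  also have "(\<Sum>l\<le>Suc t. (- 1) ^ (Suc t - l) * of_nat (t choose l) * (of_nat l :: complex) ^ n)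
      = (\<Sum>l\<le>t. (- 1) ^ (Suc t - l) * of_nat (t choose l) * of_nat l ^ n)"
    by simp
  also have "\<dots> = - fin_diff t n"
    unfolding fin_diff_def sum_negf[symmetric] by (intro sum.cong refl) (simp add: Suc_diff_le)
  finally show ?thesis by simp
qed

text \<open>The binomial sum replaces the power of \<open>l\<close> by \<open>(l + 1) ^ n\<close>,
  and a shift by 1 is the identity plus the difference operator.\<close>

lemma fin_diff_binomial_sum:
  "(\<Sum>\<alpha>\<le>n. of_nat (n choose \<alpha>) * fin_diff t \<alpha>) = fin_diff t n + fin_diff (Suc t) n"
proof -
  have "(\<Sum>\<alpha>\<le>n. of_nat (n choose \<alpha>) * fin_diff t \<alpha>) =
      (\<Sum>l\<le>t. (- 1) ^ (t - l) * of_nat (t choose l) * (\<Sum>\<alpha>\<le>n. of_nat (n choose \<alpha>) * of_nat l ^ \<alpha>))"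
    unfolding fin_diff_def sum_distrib_left by (subst sum.swap) (simp add: mult_ac)
  also have "\<dots> = (\<Sum>l\<le>t. (- 1) ^ (t - l) * of_nat (t choose l) * of_nat (Suc l) ^ n)"
  proof (intro sum.cong refl arg_cong2[of _ _ _ _ "(*)"])
    fix l show "(\<Sum>\<alpha>\<le>n. of_nat (n choose \<alpha>) * of_nat l ^ \<alpha>) = (of_nat (Suc l) :: complex) ^ n"
      using binomial_ring[of "of_nat l :: complex" 1 n] by (simp add: add.commute)
  qed
  also have "\<dots> = fin_diff t n + fin_diff (Suc t) n" by (simp add: fin_diff_Suc_left)
  finally show ?thesis .
qed

lemma fin_diff_0_right: "fin_diff t 0 = (if t = 0 then 1 else 0)"
proof -
  have "fin_diff t 0 = (\<Sum>l\<le>t. of_nat (t choose l) * 1 ^ l * (- 1) ^ (t - l))"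
    unfolding fin_diff_def by (intro sum.cong) (auto simp: mult_ac)
  also have "\<dots> = (1 + - 1) ^ t" by (subst binomial_ring) simp
  finally show ?thesis by (cases t) auto
qed

lemma fin_diff_0_left: "fin_diff 0 n = (if n = 0 then 1 else 0)"
  by (cases n) (auto simp: fin_diff_def)

text \<open>One factor of the power is absorbed by the binomial coefficient; this is the recurrence
  of the Stirling numbers.\<close>

lemma fin_diff_Suc_right: "fin_diff (Suc t) (Suc n) = of_nat (Suc t) * (fin_diff t n + fin_diff (Suc t) n)"
proof -
  have "fin_diff (Suc t) (Suc n) =
      (\<Sum>l\<le>t. (- 1) ^ (t - l) * of_nat (Suc t choose Suc l) * of_nat (Suc l) ^ Suc n)"
    unfolding fin_diff_def by (subst sum.atMost_Suc_shift) simp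
  also have "\<dots> = of_nat (Suc t) * (\<Sum>l\<le>t. (- 1) ^ (t - l) * of_nat (t choose l) * of_nat (Suc l) ^ n)"
    unfolding sum_distrib_left
  proof (intro sum.cong refl)
    fix l
    have "of_nat (Suc t choose Suc l) * of_nat (Suc l) = (of_nat (Suc t) * of_nat (t choose l) :: complex)"
      using Suc_times_binomial[of l t] by (metis mult.commute of_nat_mult)
    then show "(- 1) ^ (t - l) * of_nat (Suc t choose Suc l) * of_nat (Suc l) ^ Suc n =
        (of_nat (Suc t) * ((- 1) ^ (t - l) * of_nat (t choose l) * of_nat (Suc l) ^ n) :: complex)"
      by (metis (no_types, opaque_lifting) mult.assoc mult.left_commute power_Suc)
  qed
  also have "\<dots> = of_nat (Suc t) * (fin_diff t n + fin_diff (Suc t) n)"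
    by (simp add: fin_diff_Suc_left)
  finally show ?thesis .
qed

lemma fin_diff_eq_0: "n < t \<Longrightarrow> fin_diff t n = 0"
proof (induction n arbitrary: t)
  case 0
  then show ?case by (simp add: fin_diff_0_right)
next
  case (Suc n)
  then obtain s where "t = Suc s" "n < s" by (cases t) auto
  then show ?case using Suc.IH[of s] Suc.IH[of "Suc s"] by (simp add: fin_diff_Suc_right)
qed

lemma fin_diff_diag: "fin_diff n n = fact n"
  by (induction n) (simp_all add: fin_diff_0_right fin_diff_Suc_right fin_diff_eq_0 del: of_nat_Suc)

section \<open>Moments as rational functions\<close>

text \<open>The rational function of \<open>x\<close> whose expansion at \<open>0\<close> is \<open>\<Sum>i\<ge>1. i\<^sup>n * x\<^sup>i\<close>.\<close>

definition geo_moment :: "nat \<Rightarrow> complex \<Rightarrow> complex" where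
  "geo_moment n x = (\<Sum>t\<le>n. fin_diff t n * (x ^ t / (1 - x) ^ (t + 1))) - (if n = 0 then 1 else 0)"

lemma geo_moment_diff_zero:
  "n \<ge> 1 \<Longrightarrow> geo_moment n x = (\<Sum>t=1..n. x ^ t * diff_zero t n / (1 - x) ^ (t + 1))"
proof -
  assume n: "n \<ge> 1"
  have "geo_moment n x = (\<Sum>t\<le>n. fin_diff t n * (x ^ t / (1 - x) ^ (t + 1)))"
    using n by (simp add: geo_moment_def)
  also have "\<dots> = (\<Sum>t=1..n. fin_diff t n * (x ^ t / (1 - x) ^ (t + 1)))"
    using n by (intro sum.mono_neutral_right) (auto simp: fin_diff_0_left not_le)
  finally show ?thesis using n by (simp add: fin_diff_eq_diff_zero mult.commute)
qed

lemma geo_moment_inverse_diff_zero: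
  assumes "n \<ge> 1" "x \<noteq> 0" "x \<noteq> 1"
  shows "geo_moment n (1 / x) = (\<Sum>t=1..n. x * diff_zero t n / (x - 1) ^ (t + 1))"
  unfolding geo_moment_diff_zero[OF assms(1)]
proof (intro sum.cong refl)
  fix t
  have "1 - 1 / x = (x - 1) / x" using assms by (simp add: field_simps)
  then show "(1 / x) ^ t * diff_zero t n / (1 - 1 / x) ^ (t + 1) = x * diff_zero t n / (x - 1) ^ (t + 1)"
    using assms by (simp add: power_divide field_simps)
qed

lemma geo_moment_0: "x \<noteq> 1 \<Longrightarrow> geo_moment 0 x = x / (1 - x)"
  by (simp add: geo_moment_def fin_diff_0_left field_simps)

text \<open>For \<open>|x| < 1\<close> this is the shift of the summation index by 1, with
  \<open>(i + 1) ^ n\<close> expanded. It is derived from the differences instead, since it is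
  applied at points on and outside the unit circle.\<close>

lemma geo_moment_rec:
  assumes "x \<noteq> 1"
  shows "geo_moment n x = x * (1 + (\<Sum>\<alpha>\<le>n. of_nat (n choose \<alpha>) * geo_moment \<alpha> x))"
proof -
  define y where "y = x / (1 - x)"
  define S where "S k = (\<Sum>t\<le>n. fin_diff t k * y ^ t)" for k
  have y: "x * (1 + y) = y" "1 / (1 - x) = 1 + y" using assms by (auto simp: y_def field_simps)
  have A: "geo_moment k x = (1 + y) * S k - (if k = 0 then 1 else 0)" if "k \<le> n" for k
  proof -
    have "(\<Sum>t\<le>k. fin_diff t k * (x ^ t / (1 - x) ^ (t + 1))) = (\<Sum>t\<le>n. fin_diff t k * (x ^ t / (1 - x) ^ (t + 1)))"
      using that by (intro sum.mono_neutral_left) (auto simp: fin_diff_eq_0)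
    also have "\<dots> = (1 + y) * S k"
      unfolding S_def sum_distrib_left y(2)[symmetric]
      by (intro sum.cong refl) (simp add: y_def power_divide)
    finally show ?thesis by (simp add: geo_moment_def)
  qed
  have "(\<Sum>\<alpha>\<le>n. of_nat (n choose \<alpha>) * S \<alpha>) = (\<Sum>t\<le>n. (\<Sum>\<alpha>\<le>n. of_nat (n choose \<alpha>) * fin_diff t \<alpha>) * y ^ t)"
    unfolding S_def sum_distrib_left sum_distrib_right by (subst sum.swap) (simp add: mult_ac)
  also have "\<dots> = S n + (\<Sum>t\<le>n. fin_diff (Suc t) n * y ^ t)"
    by (simp only: fin_diff_binomial_sum S_def sum.distrib distrib_right)
  finally have B: "(\<Sum>\<alpha>\<le>n. of_nat (n choose \<alpha>) * S \<alpha>) = S n + (\<Sum>t\<le>n. fin_diff (Suc t) n * y ^ t)" .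
  have "S n = (\<Sum>t\<le>Suc n. fin_diff t n * y ^ t)" by (simp add: S_def fin_diff_eq_0)
  also have "\<dots> = fin_diff 0 n + y * (\<Sum>t\<le>n. fin_diff (Suc t) n * y ^ t)"
    by (subst sum.atMost_Suc_shift) (simp add: sum_distrib_left mult_ac)
  finally have C: "y * (\<Sum>t\<le>n. fin_diff (Suc t) n * y ^ t) = S n - fin_diff 0 n" by simp
  have "(\<Sum>\<alpha>\<le>n. of_nat (n choose \<alpha>) * geo_moment \<alpha> x)
      = (\<Sum>\<alpha>\<le>n. (1 + y) * (of_nat (n choose \<alpha>) * S \<alpha>) - (if \<alpha> = 0 then 1 else 0))"
    by (intro sum.cong refl) (simp add: A algebra_simps)
  also have "\<dots> = (1 + y) * (\<Sum>\<alpha>\<le>n. of_nat (n choose \<alpha>) * S \<alpha>) - 1"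
    by (simp add: sum_subtractf sum_distrib_left sum.delta)
  finally have "x * (1 + (\<Sum>\<alpha>\<le>n. of_nat (n choose \<alpha>) * geo_moment \<alpha> x)) =
      (x * (1 + y)) * (\<Sum>\<alpha>\<le>n. of_nat (n choose \<alpha>) * S \<alpha>)" by simp
  also have "\<dots> = y * S n + (S n - fin_diff 0 n)"
    unfolding y(1) B C[symmetric] by (simp add: algebra_simps)
  also have "\<dots> = geo_moment n x" by (simp add: A fin_diff_0_left algebra_simps)
  finally show ?thesis by simp
qed

lemma pcompose_power: "pcompose (p ^ n) q = pcompose p q ^ n" for p q :: "'a::comm_ring_1 poly"
  by (induction n) (simp_all add: pcompose_1 pcompose_mult)

text \<open>A partial sum is the whole moment minus its tail from \<open>b + 1\<close> on, and the
  tail is \<open>x ^ b\<close> times the regularised sum of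
  \<open>(b + i) ^ n * x ^ i\<close>.\<close>

lemma geo_moment_sum:
  assumes "x \<noteq> 1"
  shows "(\<Sum>i=1..b. of_nat i ^ n * x ^ i) =
    geo_moment n x - x ^ b * (\<Sum>\<alpha>\<le>n. of_nat (n choose \<alpha>) * of_nat b ^ (n - \<alpha>) * geo_moment \<alpha> x)"
proof -
  \<comment> \<open>\<open>L p\<close> stands for the regularised sum of \<open>p i * x ^ i\<close>
    over \<open>i \<ge> 1\<close>; \<open>shift\<close> splits off its first term.\<close>
  define L where "L p = (\<Sum>\<alpha>\<le>n. coeff p \<alpha> * geo_moment \<alpha> x)" for p :: "complex poly"
  have shift: "L p = x * (poly p 1 + L (pcompose p [:1, 1:]))" if p: "degree p \<le> n" for p
  proof -
    have lin: "coeff ([:1, 1:] ^ k) j = (of_nat (k choose j) :: complex)" for k j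
      by (cases "j \<le> k") (simp_all add: coeff_linear_poly_power coeff_eq_0 degree_linear_power binomial_eq_0)
    have p1: "poly p 1 = (\<Sum>\<alpha>\<le>n. coeff p \<alpha>)"
      unfolding poly_altdef using p by (intro sum.mono_neutral_cong_left) (auto simp: coeff_eq_0)
    have pc: "pcompose p [:1, 1:] = (\<Sum>\<alpha>\<le>n. smult (coeff p \<alpha>) ([:1, 1:] ^ \<alpha>))"
      using p by (subst poly_as_sum_of_monoms'[OF p, symmetric])
        (simp add: pcompose_sum pcompose_smult monom_altdef pcompose_power pcompose_pCons del: poly_as_sum_of_monoms')
    have "L (pcompose p [:1, 1:]) = (\<Sum>\<gamma>\<le>n. (\<Sum>\<alpha>\<le>n. coeff p \<alpha> * of_nat (\<alpha> choose \<gamma>)) * geo_moment \<gamma> x)"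
      unfolding L_def pc by (simp add: coeff_sum lin)
    also have "\<dots> = (\<Sum>\<alpha>\<le>n. coeff p \<alpha> * (\<Sum>\<gamma>\<le>n. of_nat (\<alpha> choose \<gamma>) * geo_moment \<gamma> x))"
      unfolding sum_distrib_left sum_distrib_right by (subst sum.swap) (simp add: mult_ac)
    also have "\<dots> = (\<Sum>\<alpha>\<le>n. coeff p \<alpha> * (\<Sum>\<gamma>\<le>\<alpha>. of_nat (\<alpha> choose \<gamma>) * geo_moment \<gamma> x))"
      by (intro sum.cong refl arg_cong2[of _ _ _ _ "(*)"] sum.mono_neutral_right) (auto simp: binomial_eq_0)
    finally have "x * (poly p 1 + L (pcompose p [:1, 1:])) =
        (\<Sum>\<alpha>\<le>n. coeff p \<alpha> * (x * (1 + (\<Sum>\<gamma>\<le>\<alpha>. of_nat (\<alpha> choose \<gamma>) * geo_moment \<gamma> x))))"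
      unfolding p1 by (simp add: sum_distrib_left sum.distrib algebra_simps)
    also have "\<dots> = L p" unfolding L_def by (subst geo_moment_rec[OF assms]) simp
    finally show ?thesis by simp
  qed
  have Lb: "L ([:of_nat b, 1:] ^ n) = (\<Sum>\<alpha>\<le>n. of_nat (n choose \<alpha>) * of_nat b ^ (n - \<alpha>) * geo_moment \<alpha> x)" for b :: nat
    by (simp add: L_def coeff_linear_poly_power)
  have "(\<Sum>i=1..b. of_nat i ^ n * x ^ i) = geo_moment n x - x ^ b * L ([:of_nat b, 1:] ^ n)"
  proof (induction b)
    case 0
    have "L ([:0, 1:] ^ n) = (\<Sum>\<alpha>\<le>n. (if \<alpha> = n then geo_moment n x else 0))"
      unfolding L_def by (intro sum.cong refl) (auto simp: monom_altdef[of 1, simplified, symmetric])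
    then show ?case by simp
  next
    case (Suc b)
    have "degree ([:of_nat b, 1:] ^ n :: complex poly) \<le> n"
      using degree_linear_power[of "of_nat b :: complex" n] by simp
    moreover have "pcompose ([:of_nat b, 1:] ^ n) [:1, 1:] = ([:of_nat (Suc b), 1:] ^ n :: complex poly)"
      by (simp add: pcompose_power pcompose_pCons add.commute)
    ultimately have "L ([:of_nat b, 1:] ^ n) = x * (of_nat (Suc b) ^ n + L ([:of_nat (Suc b), 1:] ^ n))"
      using shift[of "[:of_nat b, 1:] ^ n"] by (simp add: add.commute)
    then show ?case using Suc.IH by (simp add: algebra_simps)
  qed
  then show ?thesis by (simp only: Lb)
qed

text \<open>Multiplying the \<open>i\<close>-th term by \<open>i\<close> is the operator
  \<open>x d/dx\<close>, by which the Euler-Frobenius functions are defined; this links the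
  two.\<close>

lemma geo_moment_deriv:
  assumes x: "x \<noteq> 1" and x0: "x \<noteq> 0"
  shows "(geo_moment (Suc n) has_field_derivative geo_moment (Suc (Suc n)) x / x) (at x)"
proof -
  define S where "S t y = y ^ t / (1 - y) ^ (t + 1)" for t and y :: complex
  have dS: "(S t has_field_derivative (of_nat t * S t x + of_nat (Suc t) * S (Suc t) x) / x) (at x)" for t
  proof -
    have nz: "1 - x \<noteq> 0" using x by simp
    have "((\<lambda>y. y ^ t) has_field_derivative of_nat t * x ^ t / x) (at x)"
      using DERIV_power[where n=t and x=x, OF DERIV_ident] x0 by (cases t) auto
    moreover have "((\<lambda>y. (1 - y) ^ (t + 1)) has_field_derivative - (of_nat (Suc t) * (1 - x) ^ t)) (at x)"
    proof -
      have "((\<lambda>y. 1 - y) has_field_derivative - 1) (at x)" by (auto intro!: derivative_eq_intros)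
      from DERIV_power[where n="t + 1", OF this] show ?thesis by simp
    qed
    ultimately have "(S t has_field_derivative (of_nat t * x ^ t / x * (1 - x) ^ (t + 1)
        - x ^ t * - (of_nat (Suc t) * (1 - x) ^ t)) / ((1 - x) ^ (t + 1) * (1 - x) ^ (t + 1))) (at x)"
      unfolding S_def using nz by (intro DERIV_divide) auto
    moreover have "(of_nat t * x ^ t / x * (1 - x) ^ (t + 1)
        - x ^ t * - (of_nat (Suc t) * (1 - x) ^ t)) / ((1 - x) ^ (t + 1) * (1 - x) ^ (t + 1))
      = (of_nat t * S t x + of_nat (Suc t) * S (Suc t) x) / x"
    proof -
      have "((1 - x) ^ (t + 1) * (1 - x) ^ (t + 1)) = (1 - x) ^ t * (1 - x) ^ (t + 2)"
        by (simp flip: power_add)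
      moreover have "of_nat t * x ^ t / x * (1 - x) ^ (t + 1) - x ^ t * - (of_nat (Suc t) * (1 - x) ^ t)
          = (1 - x) ^ t * (of_nat t * x ^ t / x * (1 - x) + x ^ t * of_nat (Suc t))"
        using x0 by (simp add: field_simps)
      ultimately show ?thesis
        using nz x0 by (simp add: S_def divide_simps)
    qed
    ultimately show ?thesis by simp
  qed
  have "(\<lambda>y. \<Sum>t\<le>Suc n. fin_diff t (Suc n) * S t y) = geo_moment (Suc n)"
    by (rule ext) (simp add: geo_moment_def S_def)
  moreover have "((\<lambda>y. \<Sum>t\<le>Suc n. fin_diff t (Suc n) * S t y) has_field_derivative
     (\<Sum>t\<le>Suc n. fin_diff t (Suc n) * ((of_nat t * S t x + of_nat (Suc t) * S (Suc t) x) / x))) (at x)"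
    by (intro DERIV_sum DERIV_cmult dS)
  moreover have "(\<Sum>t\<le>Suc n. fin_diff t (Suc n) * ((of_nat t * S t x + of_nat (Suc t) * S (Suc t) x) / x))
      = geo_moment (Suc (Suc n)) x / x"
  proof -
    have "geo_moment (Suc (Suc n)) x = (\<Sum>t\<le>Suc n. fin_diff (Suc t) (Suc (Suc n)) * S (Suc t) x)"
      unfolding geo_moment_def by (subst sum.atMost_Suc_shift) (simp add: S_def fin_diff_0_left)
    also have "\<dots> = (\<Sum>t\<le>Suc n. of_nat (Suc t) * fin_diff t (Suc n) * S (Suc t) x)
        + (\<Sum>t\<le>Suc n. of_nat (Suc t) * fin_diff (Suc t) (Suc n) * S (Suc t) x)"
      by (simp only: fin_diff_Suc_right[of _ "Suc n"] sum.distrib[symmetric] distrib_left distrib_right)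
    also have "(\<Sum>t\<le>Suc n. of_nat (Suc t) * fin_diff (Suc t) (Suc n) * S (Suc t) x)
        = (\<Sum>t\<le>Suc (Suc n). of_nat t * fin_diff t (Suc n) * S t x)"
      by (subst (2) sum.atMost_Suc_shift) simp
    also have "\<dots> = (\<Sum>t\<le>Suc n. of_nat t * fin_diff t (Suc n) * S t x)"
      by (simp add: fin_diff_eq_0)
    finally show ?thesis
      by (simp only: sum_divide_distrib sum.distrib[symmetric] times_divide_eq_right distrib_left
          add.commute mult_ac)
  qed
  ultimately show ?thesis by simp
qed

lemma geo_moment_1: "x \<noteq> 1 \<Longrightarrow> geo_moment (Suc 0) x = x / (1 - x)\<^sup>2"
  by (simp add: geo_moment_def fin_diff_0_left fin_diff_diag[of 1, simplified] power2_eq_square)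

section \<open>Moments and Euler-Frobenius polynomials\<close>

lemma geo_moment_ef_rec:
  assumes "x \<noteq> 0" "x \<noteq> 1"
  shows "geo_moment (Suc k) x = x * poly (ef_rec k) x / (1 - x) ^ (k + 2)"
proof -
  have "((\<lambda>f z. z * deriv f z) ^^ k) (\<lambda>z. z / (1 - z)\<^sup>2) x = geo_moment (Suc k) x"
    using assms
  proof (induction k arbitrary: x)
    case (Suc k)
    have "open (- {0, 1 :: complex})" by (intro open_Compl finite_imp_closed) simp
    then have ev: "eventually (\<lambda>z. z \<in> - {0, 1}) (nhds x)"
      using Suc.prems by (intro eventually_nhds_in_open) auto
    have "deriv (((\<lambda>f z. z * deriv f z) ^^ k) (\<lambda>z. z / (1 - z)\<^sup>2)) x = deriv (geo_moment (Suc k)) x"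
      by (rule deriv_cong_ev[OF eventually_mono[OF ev] refl]) (use Suc.IH in auto)
    also have "\<dots> = geo_moment (Suc (Suc k)) x / x"
      by (rule DERIV_imp_deriv[OF geo_moment_deriv[OF Suc.prems(2,1)]])
    finally show ?case using Suc.prems by simp
  qed (simp add: geo_moment_1)
  then show ?thesis using ef_rec_iterate[OF assms(2)] by simp
qed

text \<open>The recurrence of the Eulerian numbers.\<close>

lemma coeff_ef_rec_Suc:
  "coeff (ef_rec (Suc k)) s = of_nat (Suc s) * coeff (ef_rec k) s
     + (of_nat k + 2 - of_nat s) * (if s = 0 then 0 else coeff (ef_rec k) (s - 1))"
proof (cases s)
  case (Suc r)
  then show ?thesis by (cases r) (simp_all add: coeff_pderiv coeff_pCons algebra_simps)
qed simp

lemma coeff_ef_rec_gt: "s > k \<Longrightarrow> coeff (ef_rec k) s = 0"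
proof (induction k arbitrary: s)
  case (Suc k)
  show ?case
  proof (cases "s = k + 2")
    case True then show ?thesis using Suc.IH[of s] by (simp add: coeff_ef_rec_Suc del: ef_rec.simps)
  next
    case False
    then show ?thesis using Suc.IH[of s] Suc.IH[of "s - 1"] Suc.prems
      by (simp add: coeff_ef_rec_Suc del: ef_rec.simps)
  qed
qed (simp add: coeff_eq_0)

text \<open>Replacing \<open>s\<close> by \<open>k + 1 - s\<close> exchanges the two factors, and
  with them the two terms, of the recurrence.\<close>

lemma coeff_ef_rec_sym: "s \<le> k \<Longrightarrow> coeff (ef_rec k) (k - s) = coeff (ef_rec k) s"
proof (induction k arbitrary: s)
  case (Suc k)
  consider "s = 0" | "s = Suc k" | "0 < s" "s \<le> k" using Suc.prems by linarith
  then show ?case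
  proof cases
    case 1
    then show ?thesis using Suc.IH[of 0] by (simp add: coeff_ef_rec_Suc coeff_ef_rec_gt del: ef_rec.simps)
  next
    case 2
    then show ?thesis using Suc.IH[of 0] by (simp add: coeff_ef_rec_Suc coeff_ef_rec_gt del: ef_rec.simps)
  next
    case 3
    then obtain r where r: "s = Suc r" by (cases s) auto
    have "coeff (ef_rec k) (Suc k - s) = coeff (ef_rec k) r" "coeff (ef_rec k) (Suc k - s - 1) = coeff (ef_rec k) s"
      using Suc.IH[of r] Suc.IH[of s] 3 r by (auto simp: Suc_diff_le)
    then show ?thesis using 3 r
      by (simp add: coeff_ef_rec_Suc of_nat_diff Suc_diff_le del: ef_rec.simps)
  qed
qed simp

lemma poly_ef_rec: "poly (ef_rec k) x = (\<Sum>s\<le>k. coeff (ef_rec k) s * x ^ s)"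
proof -
  have "degree (ef_rec k) \<le> k" using coeff_ef_rec_gt by (intro degree_le) auto
  then show ?thesis
    unfolding poly_altdef by (intro sum.mono_neutral_cong_left) (auto simp: coeff_eq_0)
qed

lemma degree_ef_rec: "degree (ef_rec k) \<le> k"
  using coeff_ef_rec_gt by (intro degree_le) auto

lemma poly_ef_rec_inverse:
  assumes "x \<noteq> 0" shows "x ^ k * poly (ef_rec k) (1 / x) = poly (ef_rec k) x"
proof -
  have "x ^ k * poly (ef_rec k) (1 / x) = (\<Sum>s\<le>k. coeff (ef_rec k) (k - s) * x ^ (k - s))"
    unfolding poly_ef_rec sum_distrib_left
    using assms by (intro sum.cong refl) (simp add: coeff_ef_rec_sym power_diff power_divide)
  also have "\<dots> = (\<Sum>s\<le>k. coeff (ef_rec k) s * x ^ s)"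
    by (rule sum.nat_diff_reindex[of _ "Suc k", simplified lessThan_Suc_atMost, simplified])
  finally show ?thesis by (simp add: poly_ef_rec)
qed

text \<open>The numerator is a reciprocal polynomial of degree \<open>k\<close>, and the sign of
  \<open>(1 - x) ^ (k + 2)\<close> under inversion is positive for even \<open>k\<close>.\<close>

lemma geo_moment_inverse_even:
  assumes x: "x \<noteq> 0" "x \<noteq> 1" and k: "even k"
  shows "geo_moment (Suc k) (1 / x) = geo_moment (Suc k) x"
proof -
  have "(1 - 1 / x) ^ (k + 2) = ((x - 1) / x) ^ (k + 2)" using x by (simp add: diff_divide_distrib)
  also have "\<dots> = (x - 1) ^ (k + 2) / x ^ (k + 2)" by (rule power_divide)
  also have "(x - 1) ^ (k + 2) = (1 - x) ^ (k + 2)"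
    using k power_minus_even[of "k + 2" "1 - x"] by simp
  finally have e: "(1 - 1 / x) ^ (k + 2) = (1 - x) ^ (k + 2) / x ^ (k + 2)" .
  have "1 / x \<noteq> 0" "1 / x \<noteq> 1" using x by auto
  from geo_moment_ef_rec[OF this, of k]
  have "geo_moment (Suc k) (1 / x) = x * (x ^ k * poly (ef_rec k) (1 / x)) / (1 - x) ^ (k + 2)"
    unfolding e using x by simp
  then show ?thesis
    unfolding poly_ef_rec_inverse[OF x(1)] geo_moment_ef_rec[OF x] .
qed

lemma coeff_ef_rec_0: "coeff (ef_rec k) 0 = 1"
  by (induction k) (simp_all add: coeff_ef_rec_Suc del: ef_rec.simps(2))

section \<open>Linear systems\<close>

lemma underdetermined_system:
  fixes A :: "'i \<Rightarrow> 'j \<Rightarrow> 'a::field"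
  assumes "finite I" "finite J" "card I < card J"
  shows "\<exists>x. (\<exists>j\<in>J. x j \<noteq> 0) \<and> (\<forall>i\<in>I. (\<Sum>j\<in>J. A i j * x j) = 0)"
  using assms
proof (induction I arbitrary: J A rule: finite_induct)
  case empty
  then have "J \<noteq> {}" by auto
  then show ?case by (intro exI[of _ "\<lambda>_. 1"]) auto
next
  case (insert p I)
  show ?case
  proof (cases "\<forall>j\<in>J. A p j = 0")
    case True
    obtain x where "\<exists>j\<in>J. x j \<noteq> 0" "\<forall>i\<in>I. (\<Sum>j\<in>J. A i j * x j) = 0"
      using insert.IH[of J A] insert.prems insert.hyps by auto
    then show ?thesis using True by (intro exI[of _ x]) auto
  next
    case False
    then obtain l where l: "l \<in> J" "A p l \<noteq> 0" by blast
    \<comment> \<open>Gaussian elimination of the unknown \<open>l\<close> by means of equation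
      \<open>p\<close>.\<close>
    define B where "B i j = A i j - A i l * A p j / A p l" for i j
    have "card I < card (J - {l})" using insert l by simp
    then obtain x where x: "\<exists>j\<in>J - {l}. x j \<noteq> 0" "\<forall>i\<in>I. (\<Sum>j\<in>J - {l}. B i j * x j) = 0"
      using insert.IH[of "J - {l}" B] insert.prems by auto
    define y where "y = x(l := - (\<Sum>j\<in>J - {l}. A p j * x j) / A p l)"
    have split: "(\<Sum>j\<in>J. A i j * y j) = (\<Sum>j\<in>J - {l}. A i j * x j) - A i l * (\<Sum>j\<in>J - {l}. A p j * x j) / A p l" for i
    proof -
      have "(\<Sum>j\<in>J. A i j * y j) = A i l * y l + (\<Sum>j\<in>J - {l}. A i j * y j)"
        using l insert.prems by (simp add: sum.remove)
      also have "(\<Sum>j\<in>J - {l}. A i j * y j) = (\<Sum>j\<in>J - {l}. A i j * x j)"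
        by (intro sum.cong refl) (auto simp: y_def)
      finally show ?thesis by (simp add: y_def)
    qed
    have "(\<Sum>j\<in>J. A i j * y j) = 0" if "i \<in> I" for i
    proof -
      have "(\<Sum>j\<in>J - {l}. B i j * x j) = (\<Sum>j\<in>J - {l}. A i j * x j) - A i l * (\<Sum>j\<in>J - {l}. A p j * x j) / A p l"
        by (simp add: B_def algebra_simps sum_subtractf sum_distrib_left sum_divide_distrib)
      then show ?thesis using x(2) that by (simp add: split)
    qed
    moreover have "(\<Sum>j\<in>J. A p j * y j) = 0" using l by (simp add: split)
    moreover have "\<exists>j\<in>J. y j \<noteq> 0" using x(1) by (auto simp: y_def)
    ultimately show ?thesis by (intro exI[of _ y]) auto
  qed
qed

text \<open>The right side becomes an additional column with its own unknown \<open>x 0\<close>. A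
  nontrivial solution of the enlarged homogeneous system has \<open>x 0 \<noteq> 0\<close> by
  injectivity, and dividing by \<open>x 0\<close> solves the original system.\<close>

lemma square_system_solvable:
  fixes A :: "nat \<Rightarrow> nat \<Rightarrow> 'a::field"
  assumes inj: "\<And>x. (\<And>i. i \<in> {1..n} \<Longrightarrow> (\<Sum>j=1..n. A i j * x j) = 0) \<Longrightarrow> \<forall>j\<in>{1..n}. x j = 0"
  shows "\<exists>x. \<forall>i\<in>{1..n}. (\<Sum>j=1..n. A i j * x j) = r i"
proof -
  define B where "B i j = (if j = 0 then - r i else A i j)" for i j
  obtain x where x: "\<exists>j\<in>{0..n}. x j \<noteq> 0" "\<forall>i\<in>{1..n}. (\<Sum>j=0..n. B i j * x j) = 0"
    using underdetermined_system[of "{1..n}" "{0..n}" B] by auto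
  have eq: "(\<Sum>j=1..n. A i j * x j) = r i * x 0" if "i \<in> {1..n}" for i
  proof -
    have "(\<Sum>j=0..n. B i j * x j) = - r i * x 0 + (\<Sum>j=1..n. A i j * x j)"
      by (subst sum.atLeast_Suc_atMost) (auto simp: B_def intro!: sum.cong)
    then show ?thesis using x(2) that by (simp add: algebra_simps eq_neg_iff_add_eq_0)
  qed
  have "x 0 \<noteq> 0"
  proof
    assume "x 0 = 0"
    then have "\<forall>j\<in>{1..n}. x j = 0" using eq by (intro inj) auto
    then have "x j = 0" if "j \<in> {0..n}" for j using that \<open>x 0 = 0\<close> by (cases j) auto
    then show False using x(1) by blast
  qed
  then show ?thesis
    using eq by (intro exI[of _ "\<lambda>j. x j / x 0"]) (simp flip: sum_divide_distrib)
qed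

text \<open>The exponents start at 1, so the test polynomial that isolates \<open>y k\<close> must
  have no constant term. The factor \<open>x\<close> provides this at the price of
  \<open>y k \<noteq> 0\<close>.\<close>

lemma vandermonde_kernel:
  fixes y w :: "'j \<Rightarrow> complex"
  assumes J: "finite J" and inj: "inj_on y J" and nz: "\<And>j. j \<in> J \<Longrightarrow> y j \<noteq> 0"
    and eq: "\<And>t. t \<in> {1..card J} \<Longrightarrow> (\<Sum>j\<in>J. w j * y j ^ t) = 0" and k: "k \<in> J"
  shows "w k = 0"
proof -
  define p where "p = pCons 0 (\<Prod>j\<in>J - {k}. [:- y j, 1:])"
  have "degree (\<Prod>j\<in>J - {k}. [:- y j, 1:]) = card J - 1"
    using k J by (subst degree_prod_eq_sum_degree) auto
  then have deg: "degree p \<le> card J"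
    unfolding p_def using degree_pCons_le[of 0 "\<Prod>j\<in>J - {k}. [:- y j, 1:]"] k J card_gt_0_iff[of J] by auto
  have pv: "poly p x = x * (\<Prod>j\<in>J - {k}. x - y j)" for x
    by (simp add: p_def poly_prod)
  have "(\<Sum>j\<in>J. w j * poly p (y j)) = (\<Sum>t\<le>card J. coeff p t * (\<Sum>j\<in>J. w j * y j ^ t))"
  proof -
    have "poly p x = (\<Sum>t\<le>card J. coeff p t * x ^ t)" for x
      unfolding poly_altdef using deg by (intro sum.mono_neutral_cong_left) (auto simp: coeff_eq_0)
    then have "(\<Sum>j\<in>J. w j * poly p (y j)) = (\<Sum>j\<in>J. \<Sum>t\<le>card J. coeff p t * (w j * y j ^ t))"
      by (simp add: sum_distrib_left mult_ac)
    also have "\<dots> = (\<Sum>t\<le>card J. coeff p t * (\<Sum>j\<in>J. w j * y j ^ t))"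
      unfolding sum_distrib_left by (rule sum.swap)
    finally show ?thesis .
  qed
  also have "\<dots> = 0"
  proof (intro sum.neutral ballI)
    fix t assume "t \<in> {..card J}"
    then show "coeff p t * (\<Sum>j\<in>J. w j * y j ^ t) = 0"
      using eq[of t] by (cases "t = 0") (auto simp: p_def)
  qed
  also have "(\<Sum>j\<in>J. w j * poly p (y j)) = w k * poly p (y k)"
  proof -
    have "(\<Sum>j\<in>J. w j * poly p (y j)) = w k * poly p (y k) + (\<Sum>j\<in>J - {k}. w j * poly p (y j))"
      using J k by (simp add: sum.remove)
    moreover have "poly p (y j) = 0" if "j \<in> J - {k}" for j
      unfolding pv using that J by (intro mult_eq_0_iff[THEN iffD2] disjI2 prod_zero) auto
    ultimately show ?thesis by simp
  qed
  finally have "w k * poly p (y k) = 0" .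
  moreover have "poly p (y k) \<noteq> 0"
    unfolding pv using nz[OF k] inj J k by (auto simp: inj_on_def)
  ultimately show ?thesis by simp
qed

text \<open>With \<open>y = x / (1 - x)\<close> the moment of order \<open>t\<close> is
  \<open>1 / (1 - x)\<close> times a combination of \<open>y, ..., y ^ t\<close> with leading
  coefficient \<open>fact t\<close>. Vanishing moments thus give vanishing power sums, and the map
  from \<open>x\<close> to \<open>y\<close> is injective.\<close>

lemma geo_moment_kernel:
  assumes J: "finite J" and inj: "inj_on x J" and nz: "\<And>j. j \<in> J \<Longrightarrow> x j \<noteq> 0 \<and> x j \<noteq> 1"
    and eq: "\<And>t. t \<in> {1..card J} \<Longrightarrow> (\<Sum>j\<in>J. w j * geo_moment t (x j)) = 0" and k: "k \<in> J"
  shows "w k = 0"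
proof -
  define y where "y j = x j / (1 - x j)" for j
  have sums: "(\<Sum>j\<in>J. w j / (1 - x j) * y j ^ t) = 0" if "t \<in> {1..card J}" for t
    using that
  proof (induction t rule: less_induct)
    case (less t)
    have "0 = (\<Sum>j\<in>J. w j * geo_moment t (x j))" using eq[OF less.prems] by simp
    also have "\<dots> = (\<Sum>j\<in>J. \<Sum>s\<le>t. fin_diff s t * (w j / (1 - x j) * y j ^ s))"
      unfolding geo_moment_def using less.prems
      by (intro sum.cong refl) (simp add: sum_distrib_left y_def power_divide mult_ac)
    also have "\<dots> = (\<Sum>s\<le>t. fin_diff s t * (\<Sum>j\<in>J. w j / (1 - x j) * y j ^ s))"
      unfolding sum_distrib_left by (rule sum.swap)
    also have "\<dots> = (\<Sum>s\<in>{t}. fin_diff s t * (\<Sum>j\<in>J. w j / (1 - x j) * y j ^ s))"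
    proof (rule sum.mono_neutral_right)
      show "\<forall>s\<in>{..t} - {t}. fin_diff s t * (\<Sum>j\<in>J. w j / (1 - x j) * y j ^ s) = 0"
      proof
        fix s assume "s \<in> {..t} - {t}"
        then show "fin_diff s t * (\<Sum>j\<in>J. w j / (1 - x j) * y j ^ s) = 0"
          using less by (cases "s = 0") (auto simp: fin_diff_0_left)
      qed
    qed auto
    finally show ?case by (simp add: fin_diff_diag)
  qed
  have "w k / (1 - x k) = 0"
  proof (rule vandermonde_kernel[OF J _ _ sums k])
    show "inj_on y J"
    proof (rule inj_onI)
      fix i j assume ij: "i \<in> J" "j \<in> J" "y i = y j"
      then have "x i = x j" using nz[of i] nz[of j] by (simp add: y_def field_simps)
      then show "i = j" using inj ij by (simp add: inj_on_def)
    qed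
  qed (use nz in \<open>auto simp: y_def\<close>)
  then show ?thesis using nz[OF k] by simp
qed

section \<open>The constant K and the roots of the Euler-Frobenius polynomial\<close>

lemma sum_symmetric_split:
  fixes f :: "nat \<Rightarrow> 'a::comm_monoid_add"
  shows "(\<Sum>s\<le>2 * M. f s) = (\<Sum>s<M. f s + f (2 * M - s)) + f M"
proof -
  have "{..2 * M} = {..<M} \<union> (insert M ((\<lambda>s. 2 * M - s) ` {..<M}))"
  proof (intro equalityI subsetI)
    fix s assume "s \<in> {..2 * M}"
    moreover have "s = 2 * M - (2 * M - s)" if "s \<le> 2 * M" using that by simp
    ultimately show "s \<in> {..<M} \<union> (insert M ((\<lambda>s. 2 * M - s) ` {..<M}))"
      by (cases "s < M"; cases "s = M") (auto simp: image_iff intro!: bexI[of _ "2 * M - s"])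
  qed auto
  moreover have "inj_on (\<lambda>s. 2 * M - s) {..<M}" by (auto simp: inj_on_def)
  ultimately have "(\<Sum>s\<le>2 * M. f s) = (\<Sum>s<M. f s) + (f M + (\<Sum>s<M. f (2 * M - s)))"
    by (simp only:) (subst sum.union_disjoint, force, force, force, subst sum.insert, force, force, simp add: sum.reindex)
  then show ?thesis by (simp add: sum.distrib ac_simps)
qed

text \<open>At \<open>z = cis (2 * \<phi>)\<close> the symmetry of the coefficients makes the
  polynomial \<open>z ^ (m - 1)\<close> times the cosine sum in \<open>K_const\<close>, and
  \<open>(1 - z)^2\<close> is \<open>- 4 * sin \<phi> ^ 2 * z\<close>. The powers of
  \<open>z\<close> cancel in the moment, and comparison with \<open>T^2 = - 4 * \<phi>^2\<close>
  leaves the factor \<open>(sin \<phi> / \<phi>) ^ (2 * m)\<close>.\<close>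

lemma K_const_geo_moment:
  fixes \<omega> h :: real
  defines "T \<equiv> 2 * of_real pi * \<i> * of_real \<omega> * of_real h"
  assumes m: "m \<ge> 1" and wh: "\<omega> * h \<notin> \<int>" and E: "poly (ef_rec (2 * m - 2)) (exp T) \<noteq> 0"
  shows "complex_of_real (K_const \<omega> m h) * geo_moment (2 * m - 1) (exp T) = fact (2 * m - 1) / T ^ (2 * m)"
proof -
  define M where "M = m - 1"
  have mM: "2 * m - 2 = 2 * M" "2 * m - 1 = Suc (2 * M)" "2 * m = 2 * M + 2" using m by (auto simp: M_def)
  define \<phi> where "\<phi> = pi * \<omega> * h"
  define z where "z = exp T"
  have T: "T = \<i> * of_real (2 * \<phi>)" by (simp add: T_def \<phi>_def)
  have z: "z = cis (2 * \<phi>)" by (simp add: z_def T cis_conv_exp)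
  have \<phi>0: "\<phi> \<noteq> 0" using wh by (auto simp: \<phi>_def)
  have s0: "sin \<phi> \<noteq> 0"
  proof
    assume "sin \<phi> = 0"
    then obtain i :: int where "\<phi> = of_int i * pi" by (auto simp: sin_zero_iff_int2)
    then have "\<omega> * h = of_int i" by (simp add: \<phi>_def)
    then show False using wh by simp
  qed
  have z1: "(1 - z)\<^sup>2 = - 4 * (of_real (sin \<phi>))\<^sup>2 * z"
  proof -
    have "1 - z = - 2 * \<i> * of_real (sin \<phi>) * cis \<phi>"
      unfolding z complex_eq_iff by (simp add: cos_double_sin sin_double power2_eq_square)
    then have "(1 - z)\<^sup>2 = - 4 * (of_real (sin \<phi>))\<^sup>2 * (cis \<phi>)\<^sup>2"
      by (simp add: power_mult_distrib)
    also have "(cis \<phi>)\<^sup>2 = z" using Complex.DeMoivre[of \<phi> 2] by (simp add: z)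
    finally show ?thesis .
  qed
  have zn: "z \<noteq> 0" "z \<noteq> 1"
    using s0 z1 by (auto simp: z)
  define D where "D = 2 * (\<Sum>\<alpha><M. ef_coeff m \<alpha> * cos (2 * \<phi> * real (M - \<alpha>))) + ef_coeff m M"
  have c: "coeff (ef_rec (2 * M)) s = of_real (ef_coeff m s)" for s
    using coeff_euler_frobenius[OF m, of s] by (simp add: mM euler_frobenius_eq_ef_rec)
  have "poly (ef_rec (2 * M)) z = (\<Sum>s<M. of_real (ef_coeff m s) * (z ^ s + z ^ (2 * M - s))) + of_real (ef_coeff m M) * z ^ M"
    unfolding poly_ef_rec sum_symmetric_split
    by (intro arg_cong2[of _ _ _ _ "(+)"] sum.cong refl) (simp_all only: c[symmetric] distrib_left, simp_all add: coeff_ef_rec_sym)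
  also have "(\<Sum>s<M. of_real (ef_coeff m s) * (z ^ s + z ^ (2 * M - s))) =
      (\<Sum>s<M. of_real (ef_coeff m s) * (z ^ M * of_real (2 * cos (2 * \<phi> * real (M - s)))))"
  proof (intro sum.cong refl arg_cong2[of _ _ _ _ "(*)"])
    fix s assume "s \<in> {..<M}"
    then have s: "s \<le> M" by simp
    have "z ^ s = z ^ M * cis (- (2 * \<phi> * real (M - s)))" "z ^ (2 * M - s) = z ^ M * cis (2 * \<phi> * real (M - s))"
      using s by (simp_all add: z Complex.DeMoivre cis_mult of_nat_diff algebra_simps)
    then show "z ^ s + z ^ (2 * M - s) = z ^ M * of_real (2 * cos (2 * \<phi> * real (M - s)))"
      by (simp add: complex_eq_iff algebra_simps)
  qed
  finally have ED: "poly (ef_rec (2 * M)) z = z ^ M * of_real D"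
    by (simp add: D_def sum_distrib_left mult_ac distrib_left)
  have D0: "D \<noteq> 0" using E ED by (auto simp: mM z_def)
  have K: "K_const \<omega> m h = (sin \<phi> / \<phi>) ^ (2 * m) * (fact (2 * m - 1) / D)"
    by (simp add: K_const_def D_def \<phi>_def M_def mult_ac)
  have "geo_moment (2 * m - 1) z = z * poly (ef_rec (2 * M)) z / (1 - z) ^ (2 * M + 2)"
    unfolding mM(2) using geo_moment_ef_rec[OF zn, of "2 * M"] by simp
  also have "(1 - z) ^ (2 * M + 2) = ((1 - z)\<^sup>2) ^ m"
    by (simp flip: power_mult add: mM(3))
  also have "\<dots> = (- 4 * (of_real (sin \<phi>))\<^sup>2) ^ m * z ^ m"
    unfolding z1 by (rule power_mult_distrib)
  also have "z * poly (ef_rec (2 * M)) z = z ^ m * of_real D"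
  proof -
    have "m = Suc M" using m by (simp add: M_def)
    then show ?thesis by (simp add: ED)
  qed
  finally have A: "geo_moment (2 * m - 1) z = of_real D / (- 4 * (of_real (sin \<phi>))\<^sup>2) ^ m"
    using zn by simp
  have "T ^ (2 * m) = (- 4 * (of_real \<phi>)\<^sup>2) ^ m"
    unfolding power_mult by (simp add: T power_mult_distrib)
  moreover have "(- 4 * y) ^ m = (- 4) ^ m * y ^ m" for y :: complex by (rule power_mult_distrib)
  ultimately show ?thesis
    unfolding z_def[symmetric] A K using s0 \<phi>0 D0
    by (simp only: power_mult power_divide of_real_mult of_real_divide of_real_power of_real_fact) simp
qed

text \<open>The constant coefficient is 1, so 0 is no root, and by symmetry the reciprocals of the
  \<open>q k\<close> are roots outside the unit disc. Together these are \<open>2m - 2\<close>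
  roots, as many as the degree allows, so none is left for the unit circle.\<close>

lemma euler_frobenius_roots:
  assumes m: "m \<ge> 1"
    and q: "bij_betw q {1..m-1} {x. poly (euler_frobenius (2 * m - 2)) x = 0 \<and> cmod x < 1}"
  shows "\<And>k. k \<in> {1..m-1} \<Longrightarrow> q k \<noteq> 0 \<and> q k \<noteq> 1 \<and> cmod (q k) < 1 \<and>
      geo_moment (2 * m - 1) (q k) = 0 \<and> geo_moment (2 * m - 1) (1 / q k) = 0"
    and "inj_on q {1..m-1}"
    and "\<And>z. cmod z = 1 \<Longrightarrow> poly (ef_rec (2 * m - 2)) z \<noteq> 0"
proof -
  let ?E = "ef_rec (2 * m - 2)"
  show inj: "inj_on q {1..m-1}" using q by (simp add: bij_betw_def)
  have root: "poly ?E (q k) = 0" "cmod (q k) < 1" if "k \<in> {1..m-1}" for k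
    using q that by (auto simp: bij_betw_def euler_frobenius_eq_ef_rec)
  have nz: "poly ?E 0 \<noteq> 0" by (simp add: poly_0_coeff_0 coeff_ef_rec_0)
  have q0: "q k \<noteq> 0" if "k \<in> {1..m-1}" for k using root(1)[OF that] nz by auto
  have q1: "q k \<noteq> 1" if "k \<in> {1..m-1}" for k using root(2)[OF that] by auto
  have rooti: "poly ?E (1 / q k) = 0" if "k \<in> {1..m-1}" for k
    using poly_ef_rec_inverse[OF q0[OF that], of "2 * m - 2"] root(1)[OF that] q0[OF that] by simp
  have S: "2 * m - 1 = Suc (2 * m - 2)" using m by simp
  show "q k \<noteq> 0 \<and> q k \<noteq> 1 \<and> cmod (q k) < 1 \<and>
      geo_moment (2 * m - 1) (q k) = 0 \<and> geo_moment (2 * m - 1) (1 / q k) = 0" if k: "k \<in> {1..m-1}" for k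
    unfolding S using q0[OF k] q1[OF k] root[OF k] rooti[OF k] by (simp add: geo_moment_ef_rec)
  fix z :: complex assume z: "cmod z = 1"
  show "poly ?E z \<noteq> 0"
  proof
    assume Ez: "poly ?E z = 0"
    define R where "R = insert z (q ` {1..m-1} \<union> (\<lambda>k. 1 / q k) ` {1..m-1})"
    have E0: "?E \<noteq> 0" using nz by auto
    have "inj_on (\<lambda>k. 1 / q k) {1..m-1}" using inj by (auto simp: inj_on_def)
    moreover have out: "cmod (1 / q k) > 1" if "k \<in> {1..m-1}" for k
      using root(2)[OF that] q0[OF that] by (simp add: norm_divide field_simps)
    have d: "q ` {1..m-1} \<inter> (\<lambda>k. 1 / q k) ` {1..m-1} = {}"
    proof (rule ccontr)
      assume "\<not> ?thesis"
      then obtain k l where "k \<in> {1..m-1}" "l \<in> {1..m-1}" "q k = 1 / q l" by blast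
      then show False using root(2)[of k] out[of l] by simp
    qed
    have zn: "z \<notin> q ` {1..m-1} \<union> (\<lambda>k. 1 / q k) ` {1..m-1}"
    proof
      assume "z \<in> q ` {1..m-1} \<union> (\<lambda>k. 1 / q k) ` {1..m-1}"
      then obtain k where "k \<in> {1..m-1}" "z = q k \<or> z = 1 / q k" by auto
      then show False using root(2)[of k] out[of k] z by auto
    qed
    ultimately have "card R = Suc ((m - 1) + (m - 1))"
      unfolding R_def using inj d by (simp add: card_Un_disjoint card_image)
    moreover have "card R \<le> card {x. poly ?E x = 0}"
      using root rooti Ez by (intro card_mono poly_roots_finite E0) (auto simp: R_def)
    moreover have "card {x. poly ?E x = 0} \<le> 2 * m - 2"
      using card_poly_roots_bound[OF E0] degree_ef_rec[of "2 * m - 2"] by linarith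
    ultimately show False using m by linarith
  qed
qed

section \<open>Geometric sequences with regularised ends\<close>

text \<open>The values at \<open>0\<close> and \<open>N\<close> are \<open>\<Sum>\<gamma>\<le>0. x\<^sup>\<gamma>\<close> and \<open>\<Sum>\<gamma>\<ge>N. x\<^sup>\<gamma>\<close> as rational functions.\<close>

definition node_weight :: "nat \<Rightarrow> complex \<Rightarrow> nat \<Rightarrow> complex" where
  "node_weight N x \<gamma> = (if \<gamma> = 0 then x / (x - 1) else if \<gamma> < N then x ^ \<gamma> else x ^ N / (1 - x))"

text \<open>Reversing the order of summation gives a partial sum of moments at \<open>1 / x\<close>.
  The weight at 0 exceeds 1 by \<open>1 / (x - 1)\<close>, the moment of order 0 at
  \<open>1 / x\<close>, which cancels the term \<open>\<alpha> = 0\<close>.\<close>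

lemma node_weight_convolution:
  assumes x: "x \<noteq> 0" "x \<noteq> 1" and n: "n \<ge> 1" and b: "\<beta> \<le> N"
  shows "(\<Sum>\<gamma><\<beta>. node_weight N x \<gamma> * of_nat (\<beta> - \<gamma>) ^ n) =
    x ^ \<beta> * geo_moment n (1 / x)
    - (\<Sum>\<alpha>=1..n. of_nat (n choose \<alpha>) * of_nat \<beta> ^ (n - \<alpha>) * geo_moment \<alpha> (1 / x))"
proof (cases "\<beta> = 0")
  case True
  have "(\<Sum>\<alpha>=1..n. of_nat (n choose \<alpha>) * 0 ^ (n - \<alpha>) * geo_moment \<alpha> (1 / x)) =
      (\<Sum>\<alpha>\<in>{n}. of_nat (n choose \<alpha>) * 0 ^ (n - \<alpha>) * geo_moment \<alpha> (1 / x))"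
    using n by (intro sum.mono_neutral_right) auto
  then show ?thesis using True by simp
next
  case False
  have x': "1 / x \<noteq> 1" using x by simp
  have "(\<Sum>\<gamma><\<beta>. node_weight N x \<gamma> * of_nat (\<beta> - \<gamma>) ^ n) =
      (\<Sum>\<gamma><\<beta>. x ^ \<gamma> * of_nat (\<beta> - \<gamma>) ^ n + (if \<gamma> = 0 then of_nat \<beta> ^ n / (x - 1) else 0))"
    using b x by (intro sum.cong refl) (auto simp: node_weight_def field_simps)
  also have "\<dots> = (\<Sum>\<gamma><\<beta>. x ^ \<gamma> * of_nat (\<beta> - \<gamma>) ^ n) + of_nat \<beta> ^ n / (x - 1)"
    using False by (simp add: sum.distrib)
  also have "(\<Sum>\<gamma><\<beta>. x ^ \<gamma> * of_nat (\<beta> - \<gamma>) ^ n) = (\<Sum>i=1..\<beta>. x ^ (\<beta> - i) * of_nat i ^ n)"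
    by (rule sum.reindex_bij_witness[of _ "\<lambda>i. \<beta> - i" "\<lambda>i. \<beta> - i"]) auto
  also have "\<dots> = x ^ \<beta> * (\<Sum>i=1..\<beta>. of_nat i ^ n * (1 / x) ^ i)"
    unfolding sum_distrib_left using x by (intro sum.cong refl) (simp add: power_diff power_divide)
  also have "\<dots> = x ^ \<beta> * geo_moment n (1 / x)
      - (\<Sum>\<alpha>\<le>n. of_nat (n choose \<alpha>) * of_nat \<beta> ^ (n - \<alpha>) * geo_moment \<alpha> (1 / x))"
    unfolding geo_moment_sum[OF x'] using x by (simp add: algebra_simps power_divide)
  also have "(\<Sum>\<alpha>\<le>n. of_nat (n choose \<alpha>) * of_nat \<beta> ^ (n - \<alpha>) * geo_moment \<alpha> (1 / x))
      = of_nat \<beta> ^ n * geo_moment 0 (1 / x) + (\<Sum>\<alpha>=1..n. of_nat (n choose \<alpha>) * of_nat \<beta> ^ (n - \<alpha>) * geo_moment \<alpha> (1 / x))"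
    by (simp add: atMost_atLeast0 sum.atLeast_Suc_atMost)
  also have "geo_moment 0 (1 / x) = 1 / (x - 1)"
    using x x' by (simp add: geo_moment_0 field_simps)
  finally show ?thesis by simp
qed

text \<open>The weight at \<open>N\<close> exceeds \<open>x ^ N\<close> by \<open>x ^ N\<close>
  times the moment of order 0, which cancels the term \<open>\<alpha> = 0\<close> of the
  tail.\<close>

lemma node_weight_moment:
  assumes x: "x \<noteq> 1" and i: "i \<ge> 1" and N: "N \<ge> 1"
  shows "(\<Sum>\<gamma>\<le>N. node_weight N x \<gamma> * of_nat \<gamma> ^ i) =
    geo_moment i x - x ^ N * (\<Sum>\<alpha>=1..i. of_nat (i choose \<alpha>) * of_nat N ^ (i - \<alpha>) * geo_moment \<alpha> x)"
proof -
  have "(\<Sum>\<gamma>\<le>N. node_weight N x \<gamma> * of_nat \<gamma> ^ i) = (\<Sum>\<gamma>=1..N. node_weight N x \<gamma> * of_nat \<gamma> ^ i)"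
    using i by (intro sum.mono_neutral_right) (auto simp: not_le)
  also have "\<dots> = (\<Sum>\<gamma>=1..N. of_nat \<gamma> ^ i * x ^ \<gamma> + (if \<gamma> = N then of_nat N ^ i * (x ^ N * x / (1 - x)) else 0))"
    using x by (intro sum.cong refl) (auto simp: node_weight_def field_simps)
  also have "\<dots> = (\<Sum>\<gamma>=1..N. of_nat \<gamma> ^ i * x ^ \<gamma>) + of_nat N ^ i * (x ^ N * x / (1 - x))"
    using N by (simp add: sum.distrib)
  also have "(\<Sum>\<gamma>=1..N. of_nat \<gamma> ^ i * x ^ \<gamma>) =
      geo_moment i x - x ^ N * (of_nat N ^ i * geo_moment 0 x +
      (\<Sum>\<alpha>=1..i. of_nat (i choose \<alpha>) * of_nat N ^ (i - \<alpha>) * geo_moment \<alpha> x))"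
    unfolding geo_moment_sum[OF x] by (simp add: atMost_atLeast0 sum.atLeast_Suc_atMost)
  finally show ?thesis using x by (simp add: geo_moment_0 algebra_simps)
qed

text \<open>This is the regularised sum of \<open>x ^ \<gamma>\<close> over all integers; the
  rational values of its two half-lines cancel.\<close>

lemma node_weight_sum:
  assumes x: "x \<noteq> 1" and N: "N \<ge> 1"
  shows "(\<Sum>\<gamma>\<le>N. node_weight N x \<gamma>) = 0"
proof -
  obtain M where M: "N = Suc M" using N by (cases N) auto
  have "(\<Sum>\<gamma>\<le>N. node_weight N x \<gamma>) = (\<Sum>\<gamma>\<le>M. node_weight N x \<gamma>) + x ^ N / (1 - x)"
    by (simp add: M node_weight_def)
  also have "(\<Sum>\<gamma>\<le>M. node_weight N x \<gamma>) = (\<Sum>\<gamma>\<le>M. x ^ \<gamma> + (if \<gamma> = 0 then 1 / (x - 1) else 0))"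
    using x by (intro sum.cong refl) (auto simp: node_weight_def M field_simps)
  also have "\<dots> = (\<Sum>\<gamma><N. x ^ \<gamma>) + 1 / (x - 1)"
    by (simp add: sum.distrib M lessThan_Suc_atMost)
  also have "(\<Sum>\<gamma><N. x ^ \<gamma>) = (1 - x ^ N) / (1 - x)"
    using x by (simp add: sum_gp_strict)
  finally have "(\<Sum>\<gamma>\<le>N. node_weight N x \<gamma>) = 1 / (1 - x) + 1 / (x - 1)"
    by (simp add: diff_divide_distrib)
  also have "1 / (x - 1) = - (1 / (1 - x))" using minus_divide_right[of 1 "1 - x"] by simp
  finally show ?thesis by simp
qed

section \<open>The coefficient formulas\<close>

definition truncated_moment :: "nat \<Rightarrow> nat \<Rightarrow> complex \<Rightarrow> complex" where
  "truncated_moment N j x = geo_moment j x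
     - x ^ N * (\<Sum>\<alpha>=1..j. of_nat (j choose \<alpha>) * of_nat N ^ (j - \<alpha>) * geo_moment \<alpha> x)"

text \<open>For \<open>j \<ge> 1\<close> this is \<open>N ^ (j + 1)\<close> times the integral of
  \<open>exp (T * N * x) * x ^ j\<close> without the term \<open>\<alpha> = 0\<close>, which the end
  weight at \<open>N\<close> accounts for.\<close>

definition monomial_rhs :: "nat \<Rightarrow> complex \<Rightarrow> nat \<Rightarrow> complex" where
  "monomial_rhs N T j = exp (T * of_nat N) *
     (\<Sum>\<alpha>=1..j. of_nat N ^ (j - \<alpha>) * ((- 1) ^ \<alpha> * fact j / (fact (j - \<alpha>) * T ^ (\<alpha> + 1))))
     - (- 1) ^ j * fact j / T ^ (j + 1)"

text \<open>The terms with \<open>1 / T\<close> in the first and last coefficient. They integrate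
  constants exactly on their own, since the geometric weights sum to 0.\<close>

definition end_weight :: "nat \<Rightarrow> complex \<Rightarrow> nat \<Rightarrow> complex" where
  "end_weight N T \<gamma> = (if \<gamma> = 0 then - 1 / T else if \<gamma> < N then 0 else exp (T * of_nat N) / T)"

definition node_coeff ::
  "nat \<Rightarrow> complex \<Rightarrow> complex \<Rightarrow> nat set \<Rightarrow> (nat \<Rightarrow> complex) \<Rightarrow> (nat \<Rightarrow> complex) \<Rightarrow> nat \<Rightarrow> complex" where
  "node_coeff N T \<kappa> J x w \<gamma> = (\<kappa> * end_weight N T \<gamma> + (\<Sum>i\<in>J. w i * node_weight N (x i) \<gamma>)) / of_nat N"

text \<open>The coefficient of degree \<open>i\<close> compensates the mismatch of the moment of
  order \<open>2m - 1 - i\<close> with its value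
  \<open>\<kappa> * fact \<alpha> / T ^ (\<alpha> + 1)\<close>. These are the orders from
  \<open>m\<close> to \<open>2m - 1\<close>, which the linear system leaves free.\<close>

definition node_poly ::
  "nat \<Rightarrow> nat \<Rightarrow> complex \<Rightarrow> complex \<Rightarrow> nat set \<Rightarrow> (nat \<Rightarrow> complex) \<Rightarrow> (nat \<Rightarrow> complex) \<Rightarrow> complex poly" where
  "node_poly m N T \<kappa> J x w = (\<Sum>i<m. monom (- ((1 / of_nat N) ^ (2 * m - i)) / fact i *
     ((\<Sum>k\<in>J. w k * geo_moment (2 * m - 1 - i) (1 / x k)) / fact (2 * m - 1 - i) - \<kappa> / T ^ (2 * m - i))) i)"

lemma degree_node_poly: "m \<ge> 1 \<Longrightarrow> degree (node_poly m N T \<kappa> J x w) < m"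
  unfolding node_poly_def
  by (rule le_less_trans[OF degree_sum_le[of _ _ "m - 1"]])
    (auto intro: order_trans[OF degree_monom_le])

lemma coeff_node_poly:
  "i < m \<Longrightarrow> coeff (node_poly m N T \<kappa> J x w) i = - ((1 / of_nat N) ^ (2 * m - i)) / fact i *
     ((\<Sum>k\<in>J. w k * geo_moment (2 * m - 1 - i) (1 / x k)) / fact (2 * m - 1 - i) - \<kappa> / T ^ (2 * m - i))"
  by (simp add: node_poly_def coeff_sum)

lemma integral_exp_monomial:
  fixes \<sigma> :: complex
  assumes \<sigma>: "\<sigma> \<noteq> 0"
  shows "integral {0..1} (\<lambda>x. exp (\<sigma> * of_real x) * of_real (x ^ j)) =
    exp \<sigma> * (\<Sum>\<alpha>\<le>j. (- 1) ^ \<alpha> * fact j / (fact (j - \<alpha>) * \<sigma> ^ (\<alpha> + 1))) - (- 1) ^ j * fact j / \<sigma> ^ (j + 1)"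
proof -
  define f where "f k x = (if k \<le> j then fact j / fact (j - k) * complex_of_real x ^ (j - k) else 0)" for k and x :: real
  \<comment> \<open>Plain antiderivatives, so that both end points contribute; at 0 only the
    constant last derivative of the monomial survives.\<close>
  define G where "G k z = exp (\<sigma> * z) / \<sigma> ^ k" for k and z :: complex
  have "smooth_chain (Suc j) f"
  proof (rule smooth_chain_C1)
    fix k and x :: real assume "k < Suc j"
    then have k: "k \<le> j" by simp
    show "(f k has_vector_derivative f (Suc k) x) (at x within {0..1})"
    proof -
      have d: "((\<lambda>z. fact j / fact (j - k) * z ^ (j - k)) has_field_derivative
          fact j / fact (j - k) * (of_nat (j - k) * (1 * z ^ (j - k - Suc 0)))) (at z)" for z :: complex
        by (intro DERIV_cmult DERIV_power DERIV_ident)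
      have "fact j / fact (j - k) * (of_nat (j - k) * (1 * complex_of_real x ^ (j - k - Suc 0))) = f (Suc k) x"
      proof (cases "k = j")
        case False
        then obtain l where l: "j - k = Suc l" using k by (metis Suc_diff_Suc le_neq_implies_less)
        then have "j - Suc k = l" by simp
        then show ?thesis using l k False by (simp add: f_def field_simps del: of_nat_Suc)
      qed (simp add: f_def)
      moreover have "f k = (\<lambda>x. fact j / fact (j - k) * complex_of_real x ^ (j - k))"
        using k by (auto simp: f_def)
      ultimately show ?thesis
        using has_vector_derivative_real_field[OF d, of x "{0..1}"] by (simp only:)
    qed
  next
    show "continuous_on UNIV (f (Suc j))" by (simp add: f_def[abs_def])
  qed simp
  then have ac: "ac_chain (Suc j) f" by (rule smooth_chain_imp_ac_chain)
  have dG: "(G (Suc k) has_field_derivative G k z) (at z)" for k z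
  proof -
    have "((\<lambda>z. exp (\<sigma> * z)) has_field_derivative \<sigma> * exp (\<sigma> * z)) (at z)"
      by (auto intro!: derivative_eq_intros)
    from DERIV_cdivide[OF this, of "\<sigma> ^ Suc k"] show ?thesis
      using \<sigma> by (simp add: G_def[abs_def])
  qed
  have cG: "continuous_on UNIV (G 0)" by (simp add: G_def[abs_def]) (intro continuous_intros)
  have one: "Suc j \<ge> 1" by simp
  have "integral {0..1} (\<lambda>x. G 0 (of_real x) * f 0 x) =
      (\<Sum>i<Suc j. (- 1) ^ i * (G (Suc i) 1 * f i 1 - G (Suc i) (of_real 0) * f i 0))
      + (- 1) ^ Suc j * integral {0..1} (\<lambda>x. G (Suc j) (of_real x) * f (Suc j) x)"
    by (rule conjunct2[OF ac_chain_by_parts[where G=G and c=0, OF ac order_refl zero_le_one one cG dG order_refl]])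
  also have "integral {0..1} (\<lambda>x. G (Suc j) (of_real x) * f (Suc j) x) = 0"
    by (simp add: f_def)
  also have "(\<Sum>i<Suc j. (- 1) ^ i * (G (Suc i) 1 * f i 1 - G (Suc i) (of_real 0) * f i 0)) =
      (\<Sum>\<alpha>\<le>j. exp \<sigma> * ((- 1) ^ \<alpha> * fact j / (fact (j - \<alpha>) * \<sigma> ^ (\<alpha> + 1)))
        - (if \<alpha> = j then (- 1) ^ j * fact j / \<sigma> ^ (j + 1) else 0))"
    unfolding lessThan_Suc_atMost
    by (intro sum.cong refl) (auto simp: f_def G_def zero_power field_simps)
  also have "\<dots> = exp \<sigma> * (\<Sum>\<alpha>\<le>j. (- 1) ^ \<alpha> * fact j / (fact (j - \<alpha>) * \<sigma> ^ (\<alpha> + 1))) - (- 1) ^ j * fact j / \<sigma> ^ (j + 1)"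
    by (simp add: sum_subtractf sum_distrib_left)
  finally show ?thesis by (simp add: G_def f_def)
qed

text \<open>For \<open>j = 0\<close> no equation of the system is involved: the end weights alone
  give the integral of the exponential.\<close>

lemma node_coeff_exact:
  assumes N: "N \<ge> 1" and T: "T \<noteq> 0" and J: "finite J" and x: "\<And>i. i \<in> J \<Longrightarrow> x i \<noteq> 1"
    and sys: "j \<ge> 1 \<Longrightarrow> (\<Sum>i\<in>J. w i * truncated_moment N j (x i)) =
      \<kappa> * monomial_rhs N T j"
  shows "quad_err \<kappa> (T * of_nat N) N (node_coeff N T \<kappa> J x w) (\<lambda>y. of_real (y ^ j)) = 0"
proof -
  define W where "W = exp (T * of_nat N)"
  define n where "n = complex_of_nat N"
  have n: "n \<noteq> 0" using N by (simp add: n_def)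
  have "(\<Sum>\<gamma>\<le>N. node_coeff N T \<kappa> J x w \<gamma> * of_real ((real \<gamma> / real N) ^ j)) =
      (\<kappa> * (\<Sum>\<gamma>\<le>N. end_weight N T \<gamma> * of_nat \<gamma> ^ j)
        + (\<Sum>i\<in>J. w i * (\<Sum>\<gamma>\<le>N. node_weight N (x i) \<gamma> * of_nat \<gamma> ^ j))) / n ^ (j + 1)"
  proof -
    have "(\<Sum>\<gamma>\<le>N. node_coeff N T \<kappa> J x w \<gamma> * of_real ((real \<gamma> / real N) ^ j)) =
        (\<Sum>\<gamma>\<le>N. \<kappa> * (end_weight N T \<gamma> * of_nat \<gamma> ^ j) + (\<Sum>i\<in>J. w i * (node_weight N (x i) \<gamma> * of_nat \<gamma> ^ j))) / n ^ (j + 1)"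
      unfolding sum_divide_distrib
    proof (intro sum.cong refl)
      fix \<gamma>
      have "of_real ((real \<gamma> / real N) ^ j) = complex_of_nat \<gamma> ^ j / n ^ j"
        by (simp add: n_def power_divide)
      then show "node_coeff N T \<kappa> J x w \<gamma> * of_real ((real \<gamma> / real N) ^ j) =
          (\<kappa> * (end_weight N T \<gamma> * of_nat \<gamma> ^ j) + (\<Sum>i\<in>J. w i * (node_weight N (x i) \<gamma> * of_nat \<gamma> ^ j))) / n ^ (j + 1)"
        by (simp add: node_coeff_def n_def[symmetric] distrib_right sum_distrib_right mult.assoc)
    qed
    also have "(\<Sum>\<gamma>\<le>N. \<kappa> * (end_weight N T \<gamma> * of_nat \<gamma> ^ j) + (\<Sum>i\<in>J. w i * (node_weight N (x i) \<gamma> * of_nat \<gamma> ^ j))) =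
        \<kappa> * (\<Sum>\<gamma>\<le>N. end_weight N T \<gamma> * of_nat \<gamma> ^ j)
        + (\<Sum>i\<in>J. w i * (\<Sum>\<gamma>\<le>N. node_weight N (x i) \<gamma> * of_nat \<gamma> ^ j))"
      unfolding sum.distrib sum_distrib_left by (subst sum.swap) (rule refl)
    finally show ?thesis .
  qed
  also have "\<kappa> * (\<Sum>\<gamma>\<le>N. end_weight N T \<gamma> * of_nat \<gamma> ^ j)
        + (\<Sum>i\<in>J. w i * (\<Sum>\<gamma>\<le>N. node_weight N (x i) \<gamma> * of_nat \<gamma> ^ j)) =
      \<kappa> * (W * (\<Sum>\<alpha>\<le>j. n ^ (j - \<alpha>) * ((- 1) ^ \<alpha> * fact j / (fact (j - \<alpha>) * T ^ (\<alpha> + 1))))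
        - (- 1) ^ j * fact j / T ^ (j + 1))"
  proof -
    obtain M where M: "N = Suc M" using N by (cases N) auto
    have e: "(\<Sum>\<gamma>\<le>N. end_weight N T \<gamma> * of_nat \<gamma> ^ j) = (if j = 0 then - 1 / T else 0) + W / T * n ^ j"
    proof -
      have "(\<Sum>\<gamma>\<le>N. end_weight N T \<gamma> * of_nat \<gamma> ^ j) = (\<Sum>\<gamma>\<le>M. end_weight N T \<gamma> * of_nat \<gamma> ^ j) + W / T * n ^ j"
        by (simp add: M end_weight_def W_def n_def)
      also have "(\<Sum>\<gamma>\<le>M. end_weight N T \<gamma> * of_nat \<gamma> ^ j) = (\<Sum>\<gamma>\<le>M. if \<gamma> = 0 then (if j = 0 then - 1 / T else 0) else 0)"
        by (intro sum.cong refl) (auto simp: end_weight_def M zero_power)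
      finally show ?thesis by simp
    qed
    show ?thesis
    proof (cases "j = 0")
      case True
      have "(\<Sum>i\<in>J. w i * (\<Sum>\<gamma>\<le>N. node_weight N (x i) \<gamma> * of_nat \<gamma> ^ j)) = 0"
        using x N True by (simp add: node_weight_sum)
      then show ?thesis unfolding e using True by (simp add: algebra_simps)
    next
      case False
      then have j: "j \<ge> 1" by simp
      have "(\<Sum>i\<in>J. w i * (\<Sum>\<gamma>\<le>N. node_weight N (x i) \<gamma> * of_nat \<gamma> ^ j)) = (\<Sum>i\<in>J. w i * truncated_moment N j (x i))"
        using x N j by (intro sum.cong refl) (simp add: node_weight_moment truncated_moment_def)
      also note sys[OF j]
      finally have s: "(\<Sum>i\<in>J. w i * (\<Sum>\<gamma>\<le>N. node_weight N (x i) \<gamma> * of_nat \<gamma> ^ j)) =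
          \<kappa> * (W * (\<Sum>\<alpha>=1..j. n ^ (j - \<alpha>) * ((- 1) ^ \<alpha> * fact j / (fact (j - \<alpha>) * T ^ (\<alpha> + 1))))
            - (- 1) ^ j * fact j / T ^ (j + 1))" unfolding W_def n_def monomial_rhs_def .
      have "(\<Sum>\<alpha>\<le>j. n ^ (j - \<alpha>) * ((- 1) ^ \<alpha> * fact j / (fact (j - \<alpha>) * T ^ (\<alpha> + 1)))) =
          n ^ j / T + (\<Sum>\<alpha>=1..j. n ^ (j - \<alpha>) * ((- 1) ^ \<alpha> * fact j / (fact (j - \<alpha>) * T ^ (\<alpha> + 1))))"
        by (subst atMost_atLeast0, subst sum.atLeast_Suc_atMost) auto
      then show ?thesis unfolding e s using j by (simp only: distrib_left right_diff_distrib) simp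
    qed
  qed
  also have "\<dots> / n ^ (j + 1) = \<kappa> * integral {0..1} (\<lambda>y. exp (T * of_nat N * of_real y) * of_real (y ^ j))"
  proof -
    have eq1: "(W * (\<Sum>\<alpha>\<le>j. n ^ (j - \<alpha>) * ((- 1) ^ \<alpha> * fact j / (fact (j - \<alpha>) * T ^ (\<alpha> + 1))))
        - (- 1) ^ j * fact j / T ^ (j + 1)) / n ^ (j + 1) =
      W * (\<Sum>\<alpha>\<le>j. (- 1) ^ \<alpha> * fact j / (fact (j - \<alpha>) * (T * n) ^ (\<alpha> + 1))) - (- 1) ^ j * fact j / (T * n) ^ (j + 1)"
    proof -
      have "(\<Sum>\<alpha>\<le>j. n ^ (j - \<alpha>) * ((- 1) ^ \<alpha> * fact j / (fact (j - \<alpha>) * T ^ (\<alpha> + 1)))) / n ^ (j + 1) =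
          (\<Sum>\<alpha>\<le>j. (- 1) ^ \<alpha> * fact j / (fact (j - \<alpha>) * (T * n) ^ (\<alpha> + 1)))"
        unfolding sum_divide_distrib
      proof (intro sum.cong refl)
        fix \<alpha> assume "\<alpha> \<in> {..j}"
        then have "n ^ (j + 1) = n ^ (j - \<alpha>) * n ^ (\<alpha> + 1)" by (simp flip: power_add)
        then show "n ^ (j - \<alpha>) * ((- 1) ^ \<alpha> * fact j / (fact (j - \<alpha>) * T ^ (\<alpha> + 1))) / n ^ (j + 1) =
            (- 1) ^ \<alpha> * fact j / (fact (j - \<alpha>) * (T * n) ^ (\<alpha> + 1))"
          using n by (simp only: power_mult_distrib) simp
      qed
      moreover have "(- 1) ^ j * fact j / T ^ (j + 1) / n ^ (j + 1) = (- 1) ^ j * fact j / (T * n) ^ (j + 1)"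
        by (simp only: power_mult_distrib) simp
      moreover have "(W * y - z) / u = W * (y / u) - z / u" for y z u :: complex
        by (simp add: diff_divide_distrib)
      ultimately show ?thesis by (simp only:)
    qed
    have "T * n \<noteq> 0" using T n by simp
    from integral_exp_monomial[OF this, of j]
    have eq2: "integral {0..1} (\<lambda>y. exp (T * of_nat N * of_real y) * of_real (y ^ j)) =
        W * (\<Sum>\<alpha>\<le>j. (- 1) ^ \<alpha> * fact j / (fact (j - \<alpha>) * (T * n) ^ (\<alpha> + 1))) - (- 1) ^ j * fact j / (T * n) ^ (j + 1)"
      unfolding W_def n_def .
    show ?thesis
      by (subst times_divide_eq_right[symmetric], rule arg_cong[of _ _ "(*) \<kappa>"], rule trans[OF eq1 eq2[symmetric]])
  qed
  finally show ?thesis by (simp add: quad_err_def)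
qed

text \<open>All three parts of the spline are \<open>h ^ (2m)\<close> times an exponential in
  \<open>\<beta>\<close> plus a polynomial in \<open>\<beta>\<close>. The exponentials cancel by
  \<open>top\<close>. In the polynomial the moments of order 1 to \<open>m - 1\<close> cancel by
  \<open>sys\<close>, the higher ones by the choice of \<open>node_poly\<close>, and order 0 by the
  end weight at 0.\<close>

lemma node_coeff_spline:
  assumes N: "N \<ge> 1" and m: "m \<ge> 1" and T: "T \<noteq> 0" and J: "finite J" and x: "\<And>i. i \<in> J \<Longrightarrow> x i \<noteq> 0 \<and> x i \<noteq> 1"
    and sys: "\<And>\<alpha>. \<alpha> \<in> {1..m-1} \<Longrightarrow> (\<Sum>i\<in>J. w i * geo_moment \<alpha> (1 / x i)) = \<kappa> * fact \<alpha> / T ^ (\<alpha> + 1)"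
    and top: "(\<Sum>i\<in>J. w i * x i ^ \<beta> * geo_moment (2 * m - 1) (1 / x i)) = \<kappa> * exp (T * of_nat \<beta>) * fact (2 * m - 1) / T ^ (2 * m)"
    and \<beta>: "\<beta> \<le> N"
  shows "spline \<kappa> (T * of_nat N) N m (node_coeff N T \<kappa> J x w) (node_poly m N T \<kappa> J x w) 0 (real \<beta> / real N) = 0"
proof -
  define n where "n = 2 * m - 1"
  have n1: "n \<ge> 1" "2 * m = n + 1" using m by (auto simp: n_def)
  define h where "h = 1 / complex_of_nat N"
  have h: "h \<noteq> 0" "complex_of_nat N = 1 / h" using N by (auto simp: h_def)
  define b where "b = complex_of_nat \<beta>"
  define M where "M \<alpha> = (\<Sum>i\<in>J. w i * geo_moment \<alpha> (1 / x i))" for \<alpha>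
  define B where "B \<alpha> = b ^ (n - \<alpha>) / fact (n - \<alpha>) * (M \<alpha> / fact \<alpha> - \<kappa> / T ^ (\<alpha> + 1))" for \<alpha>
  define E where "E = exp (T * b)"
  have bh: "of_real (real \<beta> / real N) = b * h" by (simp add: b_def h_def)
  have S1: "exp_rem (T * of_nat N) (n + 1) (b * h) = h ^ (n + 1) * (E / T ^ (n + 1) - (\<Sum>\<alpha>=0..n. b ^ (n - \<alpha>) / (fact (n - \<alpha>) * T ^ (\<alpha> + 1))))"
  proof -
    have Tb: "T * of_nat N * (b * h) = T * b" using h by simp
    have "(\<Sum>i<n + 1. (T * b) ^ i / fact i) = (\<Sum>\<alpha>=0..n. (T * b) ^ (n - \<alpha>) / fact (n - \<alpha>))"
      by (rule sum.reindex_bij_witness[of _ "\<lambda>\<alpha>. n - \<alpha>" "\<lambda>i. n - i"]) auto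
    also have "\<dots> = T ^ (n + 1) * (\<Sum>\<alpha>=0..n. b ^ (n - \<alpha>) / (fact (n - \<alpha>) * T ^ (\<alpha> + 1)))"
      unfolding sum_distrib_left
    proof (intro sum.cong refl)
      fix \<alpha> assume "\<alpha> \<in> {0..n}"
      then have "T ^ (n + 1) = T ^ (n - \<alpha>) * T ^ (\<alpha> + 1)" by (simp flip: power_add)
      then show "(T * b) ^ (n - \<alpha>) / fact (n - \<alpha>) = T ^ (n + 1) * (b ^ (n - \<alpha>) / (fact (n - \<alpha>) * T ^ (\<alpha> + 1)))"
        using T by (simp add: power_mult_distrib)
    qed
    finally have s: "(\<Sum>i<n + 1. (T * b) ^ i / fact i) = T ^ (n + 1) * (\<Sum>\<alpha>=0..n. b ^ (n - \<alpha>) / (fact (n - \<alpha>) * T ^ (\<alpha> + 1)))" .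
    have "(T * of_nat N) ^ (n + 1) = T ^ (n + 1) / h ^ (n + 1)"
      unfolding h(2) by (simp add: power_divide power_mult_distrib)
    moreover have "(e - t * y) / (t / g) = g * (e / t - y)" if "t \<noteq> 0" for e t y g :: complex
      using that by (simp add: field_simps)
    ultimately show ?thesis
      unfolding exp_rem_def Tb s E_def using T by simp
  qed
  have S2: "poly_chain (node_poly m N T \<kappa> J x w) 0 (real \<beta> / real N) = - (h ^ (n + 1)) * (\<Sum>\<alpha>=m..n. B \<alpha>)"
  proof -
    have "poly_chain (node_poly m N T \<kappa> J x w) 0 (real \<beta> / real N) =
        (\<Sum>i<m. (- (h ^ (n + 1 - i)) / fact i * (M (n - i) / fact (n - i) - \<kappa> / T ^ (n + 1 - i))) * (b * h) ^ i)"
      unfolding poly_chain_def bh funpow_0 node_poly_def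
      by (simp add: poly_sum poly_monom n1(2) M_def h_def)
    also have "\<dots> = (\<Sum>i<m. - (h ^ (n + 1)) * B (n - i))"
    proof (intro sum.cong refl)
      fix i assume "i \<in> {..<m}"
      then have i: "i \<le> n" using m by (simp add: n_def)
      have "h ^ (n + 1 - i) = h * h ^ (n - i)" using i by (simp add: Suc_diff_le)
      moreover have "h ^ (n + 1) = h * (h ^ (n - i) * h ^ i)" using i by (simp flip: power_add)
      moreover have "T ^ (n + 1 - i) = T ^ (n - i + 1)" using i by (simp add: Suc_diff_le)
      moreover have "n - (n - i) = i" using i by simp
      ultimately show "(- (h ^ (n + 1 - i)) / fact i * (M (n - i) / fact (n - i) - \<kappa> / T ^ (n + 1 - i))) * (b * h) ^ i = - (h ^ (n + 1)) * B (n - i)"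
        unfolding B_def by (simp only: power_mult_distrib) simp
    qed
    also have "\<dots> = - (h ^ (n + 1)) * (\<Sum>i<m. B (n - i))" by (simp add: sum_distrib_left sum_negf)
    also have "(\<Sum>i<m. B (n - i)) = (\<Sum>\<alpha>=m..n. B \<alpha>)"
      by (rule sum.reindex_bij_witness[of _ "\<lambda>\<alpha>. n - \<alpha>" "\<lambda>i. n - i"]) (use m in \<open>auto simp: n_def\<close>)
    finally show ?thesis .
  qed
  have S3: "(\<Sum>\<gamma>\<le>N. node_coeff N T \<kappa> J x w \<gamma> * tpow n (real \<beta> / real N - real \<gamma> / real N)) =
      h ^ (n + 1) * (- \<kappa> * b ^ n / (T * fact n) + \<kappa> * E / T ^ (n + 1)
        - (\<Sum>\<alpha>=1..n. b ^ (n - \<alpha>) / (fact (n - \<alpha>) * fact \<alpha>) * M \<alpha>))"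
  proof -
    have "(\<Sum>\<gamma>\<le>N. node_coeff N T \<kappa> J x w \<gamma> * tpow n (real \<beta> / real N - real \<gamma> / real N)) =
        (\<Sum>\<gamma><\<beta>. node_coeff N T \<kappa> J x w \<gamma> * tpow n (real \<beta> / real N - real \<gamma> / real N))"
    proof (rule sum.mono_neutral_right)
      show "\<forall>\<gamma>\<in>{..N} - {..<\<beta>}. node_coeff N T \<kappa> J x w \<gamma> * tpow n (real \<beta> / real N - real \<gamma> / real N) = 0"
        using N by (auto simp: divide_right_mono)
    qed (use \<beta> in auto)
    also have "\<dots> = (\<Sum>\<gamma><\<beta>. h ^ (n + 1) / fact n * (\<kappa> * (end_weight N T \<gamma> * of_nat (\<beta> - \<gamma>) ^ n)
        + (\<Sum>i\<in>J. w i * (node_weight N (x i) \<gamma> * of_nat (\<beta> - \<gamma>) ^ n))))"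
    proof (intro sum.cong refl)
      fix \<gamma> assume "\<gamma> \<in> {..<\<beta>}"
      then have g: "\<gamma> < \<beta>" by simp
      have "real \<beta> / real N - real \<gamma> / real N = real (\<beta> - \<gamma>) / real N"
        using g by (simp add: of_nat_diff diff_divide_distrib)
      moreover have "real (\<beta> - \<gamma>) / real N > 0" using g N by simp
      ultimately have "tpow n (real \<beta> / real N - real \<gamma> / real N) = of_nat (\<beta> - \<gamma>) ^ n * h ^ n / fact n"
        unfolding h_def by (simp only: tpow_def not_le[symmetric] if_False) (simp add: power_divide)
      then show "node_coeff N T \<kappa> J x w \<gamma> * tpow n (real \<beta> / real N - real \<gamma> / real N) =
          h ^ (n + 1) / fact n * (\<kappa> * (end_weight N T \<gamma> * of_nat (\<beta> - \<gamma>) ^ n)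
          + (\<Sum>i\<in>J. w i * (node_weight N (x i) \<gamma> * of_nat (\<beta> - \<gamma>) ^ n)))"
        by (simp add: node_coeff_def h(2) distrib_right distrib_left sum_distrib_right sum_distrib_left sum_divide_distrib add_divide_distrib mult_ac)
    qed
    also have "\<dots> = h ^ (n + 1) / fact n * (\<kappa> * (\<Sum>\<gamma><\<beta>. end_weight N T \<gamma> * of_nat (\<beta> - \<gamma>) ^ n)
        + (\<Sum>i\<in>J. w i * (\<Sum>\<gamma><\<beta>. node_weight N (x i) \<gamma> * of_nat (\<beta> - \<gamma>) ^ n)))"
      unfolding sum_distrib_left[symmetric] sum.distrib
      by (subst sum.swap) (simp add: sum_distrib_left)
    also have "(\<Sum>\<gamma><\<beta>. end_weight N T \<gamma> * of_nat (\<beta> - \<gamma>) ^ n) = - (b ^ n) / T"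
    proof -
      have "(\<Sum>\<gamma><\<beta>. end_weight N T \<gamma> * of_nat (\<beta> - \<gamma>) ^ n) = (\<Sum>\<gamma><\<beta>. if \<gamma> = 0 then - (b ^ n) / T else 0)"
        using \<beta> by (intro sum.cong refl) (auto simp: end_weight_def b_def)
      also have "\<dots> = - (b ^ n) / T" using n1 by (cases "\<beta> = 0") (auto simp: b_def zero_power)
      finally show ?thesis .
    qed
    also have "(\<Sum>i\<in>J. w i * (\<Sum>\<gamma><\<beta>. node_weight N (x i) \<gamma> * of_nat (\<beta> - \<gamma>) ^ n)) =
        (\<Sum>i\<in>J. w i * x i ^ \<beta> * geo_moment n (1 / x i)) - (\<Sum>\<alpha>=1..n. of_nat (n choose \<alpha>) * b ^ (n - \<alpha>) * M \<alpha>)"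
    proof -
      have "(\<Sum>i\<in>J. w i * (\<Sum>\<gamma><\<beta>. node_weight N (x i) \<gamma> * of_nat (\<beta> - \<gamma>) ^ n)) =
          (\<Sum>i\<in>J. w i * x i ^ \<beta> * geo_moment n (1 / x i)
            - (\<Sum>\<alpha>=1..n. of_nat (n choose \<alpha>) * b ^ (n - \<alpha>) * (w i * geo_moment \<alpha> (1 / x i))))"
      proof (intro sum.cong refl)
        fix i assume "i \<in> J"
        then have "x i \<noteq> 0" "x i \<noteq> 1" using x by auto
        from node_weight_convolution[OF this n1(1) \<beta>]
        show "w i * (\<Sum>\<gamma><\<beta>. node_weight N (x i) \<gamma> * of_nat (\<beta> - \<gamma>) ^ n) =
            w i * x i ^ \<beta> * geo_moment n (1 / x i)
            - (\<Sum>\<alpha>=1..n. of_nat (n choose \<alpha>) * b ^ (n - \<alpha>) * (w i * geo_moment \<alpha> (1 / x i)))"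
          by (simp only: b_def right_diff_distrib sum_distrib_left mult_ac)
      qed
      also have "\<dots> = (\<Sum>i\<in>J. w i * x i ^ \<beta> * geo_moment n (1 / x i)) -
          (\<Sum>\<alpha>=1..n. \<Sum>i\<in>J. of_nat (n choose \<alpha>) * b ^ (n - \<alpha>) * (w i * geo_moment \<alpha> (1 / x i)))"
        unfolding sum_subtractf by (subst sum.swap) (rule refl)
      finally show ?thesis by (simp add: M_def sum_distrib_left)
    qed
    also have "(\<Sum>i\<in>J. w i * x i ^ \<beta> * geo_moment n (1 / x i)) = \<kappa> * E * fact n / T ^ (n + 1)"
      using top by (simp add: n_def[symmetric] n1(2) E_def b_def)
    also have "(\<Sum>\<alpha>=1..n. of_nat (n choose \<alpha>) * b ^ (n - \<alpha>) * M \<alpha>) =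
        fact n * (\<Sum>\<alpha>=1..n. b ^ (n - \<alpha>) / (fact (n - \<alpha>) * fact \<alpha>) * M \<alpha>)"
      unfolding sum_distrib_left by (intro sum.cong refl) (simp add: binomial_fact mult_ac)
    finally have "(\<Sum>\<gamma>\<le>N. node_coeff N T \<kappa> J x w \<gamma> * tpow n (real \<beta> / real N - real \<gamma> / real N)) =
        h ^ (n + 1) / fact n * (\<kappa> * (- (b ^ n) / T) + (\<kappa> * E * fact n / T ^ (n + 1) -
          fact n * (\<Sum>\<alpha>=1..n. b ^ (n - \<alpha>) / (fact (n - \<alpha>) * fact \<alpha>) * M \<alpha>)))" .
    then show ?thesis by (simp add: algebra_simps diff_divide_distrib add_divide_distrib)
  qed
  have S4: "(\<Sum>\<alpha>=1..n. B \<alpha>) = (\<Sum>\<alpha>=m..n. B \<alpha>)"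
  proof (rule sum.mono_neutral_right)
    show "\<forall>\<alpha>\<in>{1..n} - {m..n}. B \<alpha> = 0"
    proof
      fix \<alpha> assume "\<alpha> \<in> {1..n} - {m..n}"
      then have "\<alpha> \<in> {1..m-1}" by auto
      from sys[OF this] have "M \<alpha> = \<kappa> * fact \<alpha> / T ^ (\<alpha> + 1)" by (simp add: M_def)
      then show "B \<alpha> = 0" by (simp add: B_def)
    qed
  qed (use m in auto)
  have S5: "(\<Sum>\<alpha>=1..n. B \<alpha>) = (\<Sum>\<alpha>=1..n. b ^ (n - \<alpha>) / (fact (n - \<alpha>) * fact \<alpha>) * M \<alpha>)
      - \<kappa> * (\<Sum>\<alpha>=1..n. b ^ (n - \<alpha>) / (fact (n - \<alpha>) * T ^ (\<alpha> + 1)))"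
    unfolding sum_distrib_left sum_subtractf[symmetric]
    by (intro sum.cong refl) (simp add: B_def right_diff_distrib mult_ac)
  define X where "X = (\<Sum>\<alpha>=1..n. b ^ (n - \<alpha>) / (fact (n - \<alpha>) * fact \<alpha>) * M \<alpha>)"
  define Y where "Y = (\<Sum>\<alpha>=1..n. b ^ (n - \<alpha>) / (fact (n - \<alpha>) * T ^ (\<alpha> + 1)))"
  \<comment> \<open>The separated term \<open>\<alpha> = 0\<close> is the one that the end weight
    \<open>- 1 / T\<close> produces in \<open>S3\<close>.\<close>
  have S6: "(\<Sum>\<alpha>=0..n. b ^ (n - \<alpha>) / (fact (n - \<alpha>) * T ^ (\<alpha> + 1))) = b ^ n / (T * fact n) + Y"
    unfolding Y_def by (subst sum.atLeast_Suc_atMost) (auto simp: mult.commute)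
  show ?thesis
    unfolding spline_def minus_nat.diff_0 n_def[symmetric]
    unfolding S3 S2 S4[symmetric] bh n1(2) S1 S5 S6 X_def[symmetric] Y_def[symmetric]
    by (simp add: algebra_simps)
qed

section \<open>Translation of the linear system and of the coefficient formulas\<close>

text \<open>The terms \<open>a\<^sub>k q\<^sub>k\<^sup>\<gamma>\<close> have the indices \<open>k\<close>, and the terms
  \<open>b\<^sub>k q\<^sub>k\<^bsup>N-\<gamma>\<^esup> = (b\<^sub>k q\<^sub>k\<^sup>N) (1/q\<^sub>k)\<^sup>\<gamma>\<close> the indices \<open>m - 1 + k\<close>.\<close>

definition node :: "nat \<Rightarrow> complex \<Rightarrow> (nat \<Rightarrow> complex) \<Rightarrow> nat \<Rightarrow> complex" where
  "node m z q i = (if i = 0 then z else if i < m then q i else 1 / q (i - (m - 1)))"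

definition weight :: "nat \<Rightarrow> nat \<Rightarrow> complex \<Rightarrow> (nat \<Rightarrow> complex) \<Rightarrow> (nat \<Rightarrow> complex) \<Rightarrow> (nat \<Rightarrow> complex) \<Rightarrow> nat \<Rightarrow> complex" where
  "weight m N K q a b i = (if i = 0 then K else if i < m then a i else b (i - (m - 1)) * q (i - (m - 1)) ^ N)"

lemma sum_split_blocks:
  fixes f :: "nat \<Rightarrow> 'a::comm_monoid_add"
  assumes "m \<ge> 1"
  shows "(\<Sum>i=1..2*m-2. f i) = (\<Sum>k=1..m-1. f k) + (\<Sum>k=1..m-1. f (m - 1 + k))"
    and "(\<Sum>i=0..2*m-2. f i) = f 0 + (\<Sum>i=1..2*m-2. f i)"
proof -
  have "{1..2*m-2} = {1..m-1} \<union> (\<lambda>k. m - 1 + k) ` {1..m-1}"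
  proof (intro equalityI subsetI)
    fix i assume i: "i \<in> {1..2*m-2}"
    show "i \<in> {1..m-1} \<union> (\<lambda>k. m - 1 + k) ` {1..m-1}"
    proof (cases "i \<le> m - 1")
      case False
      then have "i = m - 1 + (i - (m - 1))" "i - (m - 1) \<in> {1..m-1}" using i by auto
      then show ?thesis by blast
    qed (use i in auto)
  qed auto
  moreover have "sum f ({1..m-1} \<union> (\<lambda>k. m - 1 + k) ` {1..m-1}) = sum f {1..m-1} + sum f ((\<lambda>k. m - 1 + k) ` {1..m-1})"
    by (rule sum.union_disjoint) auto
  moreover have "sum f ((\<lambda>k. m - 1 + k) ` {1..m-1}) = (\<Sum>k=1..m-1. f (m - 1 + k))"
    by (subst sum.reindex) (auto simp: inj_on_def)
  ultimately show "(\<Sum>i=1..2*m-2. f i) = (\<Sum>k=1..m-1. f k) + (\<Sum>k=1..m-1. f (m - 1 + k))"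
    by (simp only:)
  show "(\<Sum>i=0..2*m-2. f i) = f 0 + (\<Sum>i=1..2*m-2. f i)"
    by (subst sum.atLeast_Suc_atMost) auto
qed

lemma sum_node_weight:
  fixes F :: "complex \<Rightarrow> complex"
  assumes "m \<ge> 1"
  shows "(\<Sum>i=0..2*m-2. weight m N K q a b i * F (node m z q i)) =
    K * F z + (\<Sum>k=1..m-1. a k * F (q k)) + (\<Sum>k=1..m-1. b k * (q k ^ N * F (1 / q k)))"
proof -
  have "(\<Sum>k=1..m-1. weight m N K q a b k * F (node m z q k)) = (\<Sum>k=1..m-1. a k * F (q k))"
    by (intro sum.cong refl) (auto simp: weight_def node_def)
  moreover have "(\<Sum>k=1..m-1. weight m N K q a b (m - 1 + k) * F (node m z q (m - 1 + k))) =
      (\<Sum>k=1..m-1. b k * (q k ^ N * F (1 / q k)))"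
    using assms by (intro sum.cong refl) (auto simp: weight_def node_def)
  ultimately show ?thesis
    unfolding sum_split_blocks[OF assms] by (simp add: weight_def[of _ _ _ _ _ _ 0] node_def[of _ _ _ 0])
qed

text \<open>The equations of the system in terms of the moments: the first family states that the moments
  of order \<open>1, \<dots>, m - 1\<close> at the left end match, the second that monomials are integrated exactly.\<close>

definition moment_system ::
  "nat \<Rightarrow> nat \<Rightarrow> complex \<Rightarrow> complex \<Rightarrow> (nat \<Rightarrow> complex) \<Rightarrow> (nat \<Rightarrow> complex) \<Rightarrow> bool" where
  "moment_system m N T \<kappa> x w \<longleftrightarrow>
    (\<forall>j\<in>{1..m-1}. (\<Sum>i=0..2*m-2. w i * geo_moment j (1 / x i)) = \<kappa> * fact j / T ^ (j + 1)) \<and>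
    (\<forall>j\<in>{1..m-1}. (\<Sum>i=0..2*m-2. w i * truncated_moment N j (x i)) =
      \<kappa> * monomial_rhs N T j)"

text \<open>Sums with \<open>q k - 1\<close> in the denominator are moments at
  \<open>1 / q k\<close>, those with \<open>1 - q k\<close> moments at \<open>q k\<close>. The terms
  with \<open>K\<close> on the right sides are those of the node \<open>exp T\<close>, moved to the
  left with index 0.\<close>

lemma coeff_system_iff_moment_system:
  assumes m: "m \<ge> 1" and N: "N \<ge> 1" and h: "h = 1 / real N"
    and q: "\<And>k. k \<in> {1..m-1} \<Longrightarrow> q k \<noteq> 0 \<and> q k \<noteq> 1"
    and T: "T = 2 * of_real pi * \<i> * of_real \<omega> * of_real h" and z1: "exp T \<noteq> 1"
  shows "coeff_system m N \<omega> h q a b \<longleftrightarrow>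
    moment_system m N T 1 (node m (exp T) q) (weight m N (of_real (K_const \<omega> m h)) q a b)"
proof -
  define z where "z = exp T"
  define K where "K = complex_of_real (K_const \<omega> m h)"
  define W where "W = exp (2 * of_real pi * \<i> * complex_of_real \<omega>)"
  have z: "z \<noteq> 0" "z \<noteq> 1" using z1 by (auto simp: z_def)
  have TN: "T * of_nat N = 2 * of_real pi * \<i> * of_real \<omega>" using N by (simp add: T h)
  \<comment> \<open>As \<open>h * N = 1\<close>, the number \<open>w\<close> of the system is both
    \<open>exp (T * N)\<close> and \<open>z ^ N\<close>.\<close>
  have W: "exp (T * of_nat N) = W" "z ^ N = W" by (simp_all add: TN W_def z_def exp_of_nat_mult[symmetric] mult.commute[of "of_nat N"])
  have powi: "complex_of_real h powi (int \<alpha> - int j) = of_nat N ^ (j - \<alpha>)" if "\<alpha> \<in> {1..j}" for \<alpha> j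
  proof -
    have e: "int \<alpha> - int j = - int (j - \<alpha>)" using that by auto
    show ?thesis unfolding e h by (simp add: power_int_minus power_one_over)
  qed
  have P1: "(\<Sum>k=1..m-1. a k * (\<Sum>t=1..j. q k * diff_zero t j / (q k - 1) ^ (t + 1)))
         + (\<Sum>k=1..m-1. b k * (\<Sum>t=1..j. q k ^ (N + t) * diff_zero t j / (1 - q k) ^ (t + 1)))
         = fact j / T ^ (j + 1) - (\<Sum>t=1..j. z * K * diff_zero t j / (z - 1) ^ (t + 1)) \<longleftrightarrow>
       (\<Sum>i=0..2*m-2. weight m N K q a b i * geo_moment j (1 / node m z q i)) = 1 * fact j / T ^ (j + 1)"
    if j: "j \<in> {1..m-1}" for j
  proof -
    have j1: "j \<ge> 1" using j by simp
    have "(\<Sum>k=1..m-1. a k * (\<Sum>t=1..j. q k * diff_zero t j / (q k - 1) ^ (t + 1))) = (\<Sum>k=1..m-1. a k * geo_moment j (1 / q k))"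
      using q j1 by (intro sum.cong refl) (simp add: geo_moment_inverse_diff_zero)
    moreover have "(\<Sum>k=1..m-1. b k * (\<Sum>t=1..j. q k ^ (N + t) * diff_zero t j / (1 - q k) ^ (t + 1))) =
        (\<Sum>k=1..m-1. b k * (q k ^ N * geo_moment j (1 / (1 / q k))))"
      by (intro sum.cong refl) (simp add: geo_moment_diff_zero[OF j1] sum_distrib_left power_add mult_ac)
    moreover have "(\<Sum>t=1..j. z * K * diff_zero t j / (z - 1) ^ (t + 1)) = K * geo_moment j (1 / z)"
      using z j1 by (simp add: geo_moment_inverse_diff_zero sum_distrib_left mult_ac)
    ultimately show ?thesis
      unfolding sum_node_weight[OF m, of N K q a b "\<lambda>y. geo_moment j (1 / y)" z] by (auto simp: algebra_simps)
  qed
  have P2: "((\<Sum>k=1..m-1. a k *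
            ((\<Sum>t=1..j. q k ^ t * diff_zero t j / (1 - q k) ^ (t + 1))
             - (\<Sum>\<alpha>=1..j. complex_of_real h powi (int \<alpha> - int j) * of_nat (j choose \<alpha>) *
                 (\<Sum>t=1..\<alpha>. q k ^ (N + t) * diff_zero t \<alpha> / (1 - q k) ^ (t + 1)))))
         + (\<Sum>k=1..m-1. b k *
            ((\<Sum>t=1..j. q k ^ (N + 1) * diff_zero t j / (q k - 1) ^ (t + 1))
             - (\<Sum>\<alpha>=1..j. complex_of_real h powi (int \<alpha> - int j) * of_nat (j choose \<alpha>) *
                 (\<Sum>t=1..\<alpha>. q k * diff_zero t \<alpha> / (q k - 1) ^ (t + 1)))))
         = (- 1) ^ (j + 1) * fact j / T ^ (j + 1)
           + (\<Sum>\<alpha>=1..j. complex_of_real h powi (int \<alpha> - int j) *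
                ((- 1) ^ \<alpha> * fact j * W / (fact (j - \<alpha>) * T ^ (\<alpha> + 1))))
           - K / (1 - z) * (\<Sum>t=1..j. (z / (1 - z)) ^ t * diff_zero t j)
           + K * W / (1 - z) *
               (\<Sum>\<alpha>=1..j. complex_of_real h powi (int \<alpha> - int j) * of_nat (j choose \<alpha>) *
                 (\<Sum>t=1..\<alpha>. (z / (1 - z)) ^ t * diff_zero t \<alpha>))) \<longleftrightarrow>
      (\<Sum>i=0..2*m-2. weight m N K q a b i * truncated_moment N j (node m z q i)) =
      1 * monomial_rhs N T j" (is "?A + ?B = ?R1 + ?R2 - ?R3 + ?R4 \<longleftrightarrow> _")
    if j: "j \<in> {1..m-1}" for j
  proof -
    have j1: "j \<ge> 1" using j by simp
    have A: "?A = (\<Sum>k=1..m-1. a k * truncated_moment N j (q k))"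
    proof (intro sum.cong refl arg_cong2[of _ _ _ _ "(*)"])
      fix k assume "k \<in> {1..m-1}"
      have "(\<Sum>\<alpha>=1..j. complex_of_real h powi (int \<alpha> - int j) * of_nat (j choose \<alpha>) *
                 (\<Sum>t=1..\<alpha>. q k ^ (N + t) * diff_zero t \<alpha> / (1 - q k) ^ (t + 1))) =
          (\<Sum>\<alpha>=1..j. q k ^ N * (of_nat (j choose \<alpha>) * of_nat N ^ (j - \<alpha>) * geo_moment \<alpha> (q k)))"
      proof (intro sum.cong refl)
        fix \<alpha> assume \<alpha>: "\<alpha> \<in> {1..j}"
        then have "\<alpha> \<ge> 1" by simp
        have "(\<Sum>t=1..\<alpha>. q k ^ (N + t) * diff_zero t \<alpha> / (1 - q k) ^ (t + 1)) = q k ^ N * geo_moment \<alpha> (q k)"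
          unfolding geo_moment_diff_zero[OF \<open>\<alpha> \<ge> 1\<close>] sum_distrib_left
          by (intro sum.cong refl) (simp add: power_add mult_ac)
        then show "complex_of_real h powi (int \<alpha> - int j) * of_nat (j choose \<alpha>) *
                 (\<Sum>t=1..\<alpha>. q k ^ (N + t) * diff_zero t \<alpha> / (1 - q k) ^ (t + 1)) =
            q k ^ N * (of_nat (j choose \<alpha>) * of_nat N ^ (j - \<alpha>) * geo_moment \<alpha> (q k))"
          unfolding powi[OF \<alpha>] by (simp only: mult_ac)
      qed
      then show "(\<Sum>t=1..j. q k ^ t * diff_zero t j / (1 - q k) ^ (t + 1))
             - (\<Sum>\<alpha>=1..j. complex_of_real h powi (int \<alpha> - int j) * of_nat (j choose \<alpha>) *
                 (\<Sum>t=1..\<alpha>. q k ^ (N + t) * diff_zero t \<alpha> / (1 - q k) ^ (t + 1))) = truncated_moment N j (q k)"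
        unfolding truncated_moment_def geo_moment_diff_zero[OF j1] sum_distrib_left by (simp only:)
    qed
    have B: "?B = (\<Sum>k=1..m-1. b k * (q k ^ N * truncated_moment N j (1 / q k)))"
    proof (intro sum.cong refl arg_cong2[of _ _ _ _ "(*)"])
      fix k assume k: "k \<in> {1..m-1}"
      have qk: "q k \<noteq> 0" "q k \<noteq> 1" using q[OF k] by auto
      have "(\<Sum>\<alpha>=1..j. complex_of_real h powi (int \<alpha> - int j) * of_nat (j choose \<alpha>) *
                 (\<Sum>t=1..\<alpha>. q k * diff_zero t \<alpha> / (q k - 1) ^ (t + 1))) =
          (\<Sum>\<alpha>=1..j. of_nat (j choose \<alpha>) * of_nat N ^ (j - \<alpha>) * geo_moment \<alpha> (1 / q k))"
      proof (intro sum.cong refl)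
        fix \<alpha> assume \<alpha>: "\<alpha> \<in> {1..j}"
        then have "\<alpha> \<ge> 1" by simp
        show "complex_of_real h powi (int \<alpha> - int j) * of_nat (j choose \<alpha>) *
                 (\<Sum>t=1..\<alpha>. q k * diff_zero t \<alpha> / (q k - 1) ^ (t + 1)) =
            of_nat (j choose \<alpha>) * of_nat N ^ (j - \<alpha>) * geo_moment \<alpha> (1 / q k)"
          unfolding powi[OF \<alpha>] geo_moment_inverse_diff_zero[OF \<open>\<alpha> \<ge> 1\<close> qk] by (simp only: mult_ac)
      qed
      moreover have "(\<Sum>t=1..j. q k ^ (N + 1) * diff_zero t j / (q k - 1) ^ (t + 1)) = q k ^ N * geo_moment j (1 / q k)"
        unfolding geo_moment_inverse_diff_zero[OF j1 qk] sum_distrib_left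
        by (intro sum.cong refl) (simp add: mult_ac)
      \<comment> \<open>The factor \<open>q k ^ N\<close> in the weight cancels the power
        \<open>(1 / q k) ^ N\<close> in the truncated moment.\<close>
      moreover have "q k ^ N * (u - (1 / q k) ^ N * v) = q k ^ N * u - v" for u v
        using qk by (simp add: right_diff_distrib power_divide)
      ultimately show "(\<Sum>t=1..j. q k ^ (N + 1) * diff_zero t j / (q k - 1) ^ (t + 1))
             - (\<Sum>\<alpha>=1..j. complex_of_real h powi (int \<alpha> - int j) * of_nat (j choose \<alpha>) *
                 (\<Sum>t=1..\<alpha>. q k * diff_zero t \<alpha> / (q k - 1) ^ (t + 1))) = q k ^ N * truncated_moment N j (1 / q k)"
        unfolding truncated_moment_def by (simp only:)
    qed
    have gz: "(\<Sum>t=1..\<alpha>. (z / (1 - z)) ^ t * diff_zero t \<alpha>) = (1 - z) * geo_moment \<alpha> z" if "\<alpha> \<ge> 1" for \<alpha>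
      unfolding geo_moment_diff_zero[OF that] sum_distrib_left
      using z by (intro sum.cong refl) (simp add: power_divide field_simps)
    have R3: "?R3 = K * geo_moment j z" unfolding gz[OF j1] using z by simp
    have R4: "?R4 = K * (z ^ N * (\<Sum>\<alpha>=1..j. of_nat (j choose \<alpha>) * of_nat N ^ (j - \<alpha>) * geo_moment \<alpha> z))"
    proof -
      have "(\<Sum>\<alpha>=1..j. complex_of_real h powi (int \<alpha> - int j) * of_nat (j choose \<alpha>) *
                 (\<Sum>t=1..\<alpha>. (z / (1 - z)) ^ t * diff_zero t \<alpha>)) =
          (1 - z) * (\<Sum>\<alpha>=1..j. of_nat (j choose \<alpha>) * of_nat N ^ (j - \<alpha>) * geo_moment \<alpha> z)"
        unfolding sum_distrib_left[of "1 - z"]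
      proof (intro sum.cong refl)
        fix \<alpha> assume \<alpha>: "\<alpha> \<in> {1..j}"
        then have "\<alpha> \<ge> 1" by simp
        show "complex_of_real h powi (int \<alpha> - int j) * of_nat (j choose \<alpha>) * (\<Sum>t=1..\<alpha>. (z / (1 - z)) ^ t * diff_zero t \<alpha>) =
            (1 - z) * (of_nat (j choose \<alpha>) * of_nat N ^ (j - \<alpha>) * geo_moment \<alpha> z)"
          unfolding powi[OF \<alpha>] gz[OF \<open>\<alpha> \<ge> 1\<close>] by (simp only: mult_ac)
      qed
      then show ?thesis unfolding W(2)[symmetric] using z by simp
    qed
    have R2: "?R2 = W * (\<Sum>\<alpha>=1..j. of_nat N ^ (j - \<alpha>) * ((- 1) ^ \<alpha> * fact j / (fact (j - \<alpha>) * T ^ (\<alpha> + 1))))"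
      unfolding sum_distrib_left
    proof (intro sum.cong refl)
      fix \<alpha> assume \<alpha>: "\<alpha> \<in> {1..j}"
      show "complex_of_real h powi (int \<alpha> - int j) * ((- 1) ^ \<alpha> * fact j * W / (fact (j - \<alpha>) * T ^ (\<alpha> + 1))) =
          W * (of_nat N ^ (j - \<alpha>) * ((- 1) ^ \<alpha> * fact j / (fact (j - \<alpha>) * T ^ (\<alpha> + 1))))"
        unfolding powi[OF \<alpha>] by simp
    qed
    have R1: "?R1 = - ((- 1) ^ j * fact j / T ^ (j + 1))" by simp
    have alg: "A + B = - r + s - k * g + k * v \<longleftrightarrow> k * (g - v) + A + B = 1 * (s - r)" for A B r s k g v :: complex
      by (auto simp: algebra_simps)
    show ?thesis
      unfolding A B R1 R2 R3 R4 monomial_rhs_def W(1) sum_node_weight[OF m, of N K q a b "truncated_moment N j" z]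
        truncated_moment_def[of N j z] by (rule alg)
  qed
  show ?thesis
    unfolding coeff_system_def moment_system_def Let_def T[symmetric] z_def[symmetric] K_def[symmetric] W_def[symmetric]
    using P1 P2 by simp
qed

lemma coeff_formula_eq_node_coeff:
  assumes m: "m \<ge> 1" and N: "N \<ge> 1" and h: "h = 1 / real N" and \<beta>: "\<beta> \<le> N"
    and q: "\<And>k. k \<in> {1..m-1} \<Longrightarrow> q k \<noteq> 0 \<and> q k \<noteq> 1"
    and T: "T = 2 * of_real pi * \<i> * of_real \<omega> * of_real h"
  shows "coeff_formula m N \<omega> h q a b \<beta> =
    node_coeff N T 1 {0..2*m-2} (node m (exp T) q) (weight m N (of_real (K_const \<omega> m h)) q a b) \<beta>"
proof -
  define z where "z = exp T"
  define K where "K = complex_of_real (K_const \<omega> m h)"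
  define W where "W = exp (2 * of_real pi * \<i> * complex_of_real \<omega>)"
  have TN: "T * of_nat N = 2 * of_real pi * \<i> * of_real \<omega>" using N by (simp add: T h)
  have W: "exp (T * of_nat N) = W" "z ^ N = W" by (simp_all add: TN W_def z_def exp_of_nat_mult[symmetric] mult.commute[of "of_nat N"])
  have H: "complex_of_real h = 1 / of_nat N" by (simp add: h)
  have zb: "exp (T * of_nat \<beta>) = z ^ \<beta>" by (simp add: z_def exp_of_nat_mult[symmetric] mult.commute)
  \<comment> \<open>Passing from \<open>q k\<close> to \<open>1 / q k\<close> and multiplying by
    \<open>q k ^ N\<close> exchanges the two end weights; this is the symmetry between the roles of
    \<open>a\<close> and \<open>b\<close>.\<close>
  have inv: "q k ^ N * ((1 / q k) / (1 / q k - 1)) = q k ^ N / (1 - q k)"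
    "q k ^ N * ((1 / q k) ^ N / (1 - 1 / q k)) = q k / (q k - 1)"
    if "k \<in> {1..m-1}" for k
    using q[OF that] by (simp_all add: power_divide field_simps)
  have inv2: "q k ^ N * (1 / q k) ^ \<beta> = q k ^ (N - \<beta>)" if "k \<in> {1..m-1}" for k
    using q[OF that] \<beta> by (simp add: power_divide power_diff)
  have div: "1 / of_nat N * u = v / complex_of_nat N" if "u = v" for u v using that by simp
  show ?thesis
    unfolding node_coeff_def z_def[symmetric] K_def[symmetric] sum_node_weight[OF m, of N K q a b "\<lambda>y. node_weight N y \<beta>" z]
  proof -
    consider "\<beta> = 0" | "\<beta> \<noteq> 0" "\<beta> < N" | "\<beta> \<noteq> 0" "\<beta> = N" using \<beta> by linarith
    then show "coeff_formula m N \<omega> h q a b \<beta> = (1 * end_weight N T \<beta> + (K * node_weight N z \<beta> +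
        (\<Sum>k=1..m-1. a k * node_weight N (q k) \<beta>) + (\<Sum>k=1..m-1. b k * (q k ^ N * node_weight N (1 / q k) \<beta>)))) / of_nat N"
    proof cases
      case 1
      have s: "(\<Sum>k=1..m-1. a k * (q k / (q k - 1)) + b k * (q k ^ N / (1 - q k))) =
          (\<Sum>k=1..m-1. a k * node_weight N (q k) \<beta>) + (\<Sum>k=1..m-1. b k * (q k ^ N * node_weight N (1 / q k) \<beta>))"
        unfolding sum.distrib[symmetric] using 1 inv(1) by (intro sum.cong refl) (simp only: node_weight_def simp_thms if_True)
      show ?thesis
        unfolding coeff_formula_def Let_def T[symmetric] z_def[symmetric] K_def[symmetric]
        unfolding H s
        by (subst if_P, rule 1, intro div) (simp add: end_weight_def node_weight_def[of _ z] 1 algebra_simps)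
    next
      case 2
      have s: "(\<Sum>k=1..m-1. a k * q k ^ \<beta> + b k * q k ^ (N - \<beta>)) =
          (\<Sum>k=1..m-1. a k * node_weight N (q k) \<beta>) + (\<Sum>k=1..m-1. b k * (q k ^ N * node_weight N (1 / q k) \<beta>))"
        unfolding sum.distrib[symmetric] using 2 inv2 by (intro sum.cong refl) (simp only: node_weight_def if_True if_False)
      show ?thesis
        unfolding coeff_formula_def Let_def T[symmetric] z_def[symmetric] K_def[symmetric]
        unfolding H s
        by (subst if_not_P, rule 2(1), subst if_P, rule 2(2), intro div) (simp add: end_weight_def node_weight_def[of _ z] zb 2 algebra_simps)
    next
      case 3
      have s: "(\<Sum>k=1..m-1. a k * (q k ^ N / (1 - q k)) + b k * (q k / (q k - 1))) =
          (\<Sum>k=1..m-1. a k * node_weight N (q k) \<beta>) + (\<Sum>k=1..m-1. b k * (q k ^ N * node_weight N (1 / q k) \<beta>))"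
        unfolding sum.distrib[symmetric] using 3 inv(2) by (intro sum.cong refl) (simp add: node_weight_def)
      show ?thesis
        unfolding coeff_formula_def Let_def T[symmetric] z_def[symmetric] K_def[symmetric] W_def[symmetric]
        unfolding H s
        by (subst if_not_P, rule 3(1), subst if_not_P, simp add: 3, intro div) (use N in \<open>simp add: end_weight_def node_weight_def[of _ z] W 3 algebra_simps\<close>)
    qed
  qed
qed

section \<open>Unique solvability\<close>

text \<open>The homogeneous spline vanishes at the nodes, hence its polynomial part is zero. Its
  coefficients then add the moments of orders \<open>m\<close> to \<open>2m - 1\<close> to those
  that the system annihilates, enough to separate the \<open>2m - 2\<close> nodes however small
  \<open>N\<close> is.\<close>

lemma moment_system_unique:
  assumes m: "m \<ge> 1" and N: "N \<ge> 1" and Nm: "N + 1 \<ge> m" and T: "T \<noteq> 0"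
    and x: "\<And>i. i \<in> {0..2*m-2} \<Longrightarrow> x i \<noteq> 0 \<and> x i \<noteq> 1" and inj: "inj_on x {1..2*m-2}"
    and root: "\<And>i. i \<in> {1..2*m-2} \<Longrightarrow> geo_moment (2*m-1) (1 / x i) = 0"
    and sys: "moment_system m N T 0 x w" and w0: "w 0 = 0"
  shows "\<forall>i\<in>{1..2*m-2}. w i = 0"
proof -
  define J where "J = {0..2*m-2}"
  define C where "C = node_coeff N T 0 J x w"
  define P where "P = node_poly m N T 0 J x w"
  have J: "finite J" by (simp add: J_def)
  have xJ: "x i \<noteq> 0 \<and> x i \<noteq> 1" if "i \<in> J" for i using x that by (simp add: J_def)
  have sigma: "T * of_nat N \<noteq> 0" using T N by simp
  have split: "(\<Sum>i\<in>J. w i * F i) = (\<Sum>i=1..2*m-2. w i * F i)" for F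
    unfolding J_def sum_split_blocks(2)[OF m] by (simp add: w0)
  have "P = 0"
  proof (rule spline_homogeneous[OF m N Nm _ _ sigma])
    show "degree P < m" unfolding P_def by (rule degree_node_poly[OF m])
    show "quad_err 0 (T * of_nat N) N C (\<lambda>y. of_real (y ^ j)) = 0" if "j < m" for j
      unfolding C_def
    proof (rule node_coeff_exact[OF N T J])
      show "x i \<noteq> 1" if "i \<in> J" for i using xJ[OF that] by blast
      assume "j \<ge> 1"
      then show "(\<Sum>i\<in>J. w i * truncated_moment N j (x i)) =
          0 * monomial_rhs N T j"
        using sys that unfolding moment_system_def J_def by simp
    qed
    show "spline 0 (T * of_nat N) N m C P 0 (real \<beta> / real N) = 0" if "\<beta> \<le> N" for \<beta>
      unfolding C_def P_def
    proof (rule node_coeff_spline[OF N m T J xJ _ _ that])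
      show "(\<Sum>i\<in>J. w i * geo_moment \<alpha> (1 / x i)) = 0 * fact \<alpha> / T ^ (\<alpha> + 1)" if "\<alpha> \<in> {1..m-1}" for \<alpha>
        using sys that unfolding moment_system_def J_def by simp
      show "(\<Sum>i\<in>J. w i * x i ^ \<beta> * geo_moment (2 * m - 1) (1 / x i)) = 0 * exp (T * of_nat \<beta>) * fact (2 * m - 1) / T ^ (2 * m)"
        unfolding mult.assoc split using root by simp
    qed
  qed
  have moments: "(\<Sum>i\<in>{1..2*m-2}. w i * geo_moment \<alpha> (1 / x i)) = 0" if \<alpha>: "\<alpha> \<in> {1..2*m-1}" for \<alpha>
  proof (cases "\<alpha> \<le> m - 1")
    case True
    then show ?thesis using sys \<alpha> unfolding moment_system_def J_def[symmetric] split by simp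
  next
    case False
    define i where "i = 2 * m - 1 - \<alpha>"
    have i: "i < m" "2 * m - 1 - i = \<alpha>" using False \<alpha> by (auto simp: i_def)
    \<comment> \<open>For \<open>\<kappa> = 0\<close> this coefficient is a nonzero multiple of the
      moment of order \<open>\<alpha>\<close>.\<close>
    have "0 = coeff P i" using \<open>P = 0\<close> by simp
    then have "(\<Sum>k\<in>J. w k * geo_moment \<alpha> (1 / x k)) = 0"
      using N unfolding P_def coeff_node_poly[OF i(1)] i(2) by simp
    then show ?thesis unfolding split .
  qed
  show ?thesis
  proof
    fix k assume k: "k \<in> {1..2*m-2}"
    show "w k = 0"
    proof (rule geo_moment_kernel[of "{1..2*m-2}" "\<lambda>i. 1 / x i" w])
      show "inj_on (\<lambda>i. 1 / x i) {1..2*m-2}" using inj by (auto simp: inj_on_def)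
      show "1 / x i \<noteq> 0 \<and> 1 / x i \<noteq> 1" if "i \<in> {1..2*m-2}" for i using x[of i] that by auto
      show "(\<Sum>j\<in>{1..2*m-2}. w j * geo_moment t (1 / x j)) = 0" if "t \<in> {1..card {1..2*m-2}}" for t
        by (rule moments) (use that in auto)
    qed (use k in auto)
  qed
qed

lemma moment_system_solvable:
  assumes m: "m \<ge> 1" and N: "N \<ge> 1" and Nm: "N + 1 \<ge> m" and T: "T \<noteq> 0"
    and x: "\<And>i. i \<in> {0..2*m-2} \<Longrightarrow> x i \<noteq> 0 \<and> x i \<noteq> 1" and inj: "inj_on x {1..2*m-2}"
    and root: "\<And>i. i \<in> {1..2*m-2} \<Longrightarrow> geo_moment (2*m-1) (1 / x i) = 0"
  shows "\<exists>w. w 0 = K \<and> moment_system m N T \<kappa> x w"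
proof -
  \<comment> \<open>Rows 1 to \<open>m - 1\<close> are the first family of equations, rows
    \<open>m\<close> to \<open>2m - 2\<close> the second. The column of the node 0, whose weight is
    prescribed, goes to the right side.\<close>
  define A where "A r i = (if r < m then geo_moment r (1 / x i) else truncated_moment N (r - (m - 1)) (x i))" for r i
  define R where "R r = \<kappa> * (if r < m then fact r / T ^ (r + 1) else monomial_rhs N T (r - (m - 1)))" for r
  have A2: "A (m - 1 + j) i = truncated_moment N j (x i)" "R (m - 1 + j) = \<kappa> * monomial_rhs N T j" "m - 1 + j \<in> {1..2*m-2}" if "j \<in> {1..m-1}" for j i
    using that m by (auto simp: A_def R_def)
  have A1: "A j i = geo_moment j (1 / x i)" "R j = \<kappa> * fact j / T ^ (j + 1)" "j \<in> {1..2*m-2}" if "j \<in> {1..m-1}" for j i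
    using that m by (auto simp: A_def R_def)
  have "\<exists>u. \<forall>r\<in>{1..2*m-2}. (\<Sum>i=1..2*m-2. A r i * u i) = R r - K * A r 0"
  proof (rule square_system_solvable)
    fix u :: "nat \<Rightarrow> complex" assume u: "\<And>r. r \<in> {1..2*m-2} \<Longrightarrow> (\<Sum>i=1..2*m-2. A r i * u i) = 0"
    define w where "w = u(0 := 0)"
    have w: "(\<Sum>i=0..2*m-2. w i * A r i) = 0" if "r \<in> {1..2*m-2}" for r
      using u[OF that] unfolding sum_split_blocks(2)[OF m] by (simp add: w_def mult.commute)
    have "moment_system m N T 0 x w"
      unfolding moment_system_def
    proof (intro conjI ballI)
      fix j assume j: "j \<in> {1..m-1}"
      show "(\<Sum>i=0..2*m-2. w i * geo_moment j (1 / x i)) = 0 * fact j / T ^ (j + 1)"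
        using w[OF A1(3)[OF j]] A1(1)[OF j] by simp
      show "(\<Sum>i=0..2*m-2. w i * truncated_moment N j (x i)) =
        0 * monomial_rhs N T j"
        using w[OF A2(3)[OF j]] A2(1)[OF j] by simp
    qed
    from moment_system_unique[OF m N Nm T x inj root this] show "\<forall>i\<in>{1..2*m-2}. u i = 0"
      by (auto simp: w_def)
  qed
  then obtain u where u: "\<And>r. r \<in> {1..2*m-2} \<Longrightarrow> (\<Sum>i=1..2*m-2. A r i * u i) = R r - K * A r 0" by blast
  define w where "w = u(0 := K)"
  have w: "(\<Sum>i=0..2*m-2. w i * A r i) = R r" if "r \<in> {1..2*m-2}" for r
    using u[OF that] unfolding sum_split_blocks(2)[OF m] by (simp add: w_def mult.commute)
  have "moment_system m N T \<kappa> x w"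
    unfolding moment_system_def
  proof (intro conjI ballI)
    fix j assume j: "j \<in> {1..m-1}"
    show "(\<Sum>i=0..2*m-2. w i * geo_moment j (1 / x i)) = \<kappa> * fact j / T ^ (j + 1)"
      using w[OF A1(3)[OF j]] A1(1,2)[OF j] by simp
    show "(\<Sum>i=0..2*m-2. w i * truncated_moment N j (x i)) =
      \<kappa> * monomial_rhs N T j"
      using w[OF A2(3)[OF j]] A2(1,2)[OF j] by simp
  qed
  then show ?thesis by (intro exI[of _ w]) (simp add: w_def)
qed

lemma moment_system_diff:
  assumes "moment_system m N T \<kappa> x v" "moment_system m N T \<kappa> x w"
  shows "moment_system m N T 0 x (\<lambda>i. v i - w i)"
  using assms unfolding moment_system_def by (simp add: left_diff_distrib sum_subtractf)

section \<open>Optimal coefficients\<close>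

theorem theorem6:
  fixes m N :: nat and \<omega> h :: real and q :: "nat \<Rightarrow> complex"
  assumes "m \<ge> 1" and "N \<ge> 1" and "N + 1 \<ge> m"
    and "h = 1 / real N"
    and "\<omega> * h \<notin> \<int>"
    and "bij_betw q {1..m-1} {x. poly (euler_frobenius (2 * m - 2)) x = 0 \<and> cmod x < 1}"
  shows "\<exists>a b. coeff_system m N \<omega> h q a b \<and>
           (\<forall>a' b'. coeff_system m N \<omega> h q a' b' \<longrightarrow>
              (\<forall>k\<in>{1..m-1}. a' k = a k \<and> b' k = b k)) \<and>
           (\<forall>C. sard_optimal m 0 1 N \<omega> C \<longleftrightarrow>
              (\<forall>\<beta>\<in>{0..N}. C \<beta> = coeff_formula m N \<omega> h q a b \<beta>))"
proof -
  note m = assms(1) and N = assms(2) and Nm = assms(3) and h = assms(4) and wh = assms(5)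
  define T where "T = 2 * of_real pi * \<i> * of_real \<omega> * complex_of_real h"
  define K where "K = complex_of_real (K_const \<omega> m h)"
  define x where "x = node m (exp T) q"
  define J where "J = {0..2*m-2}"
  note roots = euler_frobenius_roots[OF m assms(6)]
  have q: "q k \<noteq> 0 \<and> q k \<noteq> 1" if "k \<in> {1..m-1}" for k using roots(1)[OF that] by blast
  have \<omega>0: "\<omega> \<noteq> 0" using wh by auto
  have h0: "h \<noteq> 0" using h N by simp
  have T0: "T \<noteq> 0" using \<omega>0 h0 by (simp add: T_def)
  have T': "T = \<i> * of_real (2 * pi * (\<omega> * h))" by (simp add: T_def)
  have z1: "exp T \<noteq> 1"
  proof
    assume "exp T = 1"
    then obtain n :: int where "2 * pi * (\<omega> * h) = of_int (2 * n) * pi"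
      unfolding exp_eq_1 T' by auto
    then have "\<omega> * h = of_int n" by simp
    then show False using wh by simp
  qed
  have znorm: "cmod (exp T) = 1" by (simp add: T')
  have TN: "T * of_nat N = 2 * of_real pi * \<i> * of_real \<omega>" using N by (simp add: T_def h)
  have xcases: "x 0 = exp T" "k \<in> {1..m-1} \<Longrightarrow> x k = q k" "k \<in> {1..m-1} \<Longrightarrow> x (m - 1 + k) = 1 / q k" for k
    by (auto simp: x_def node_def)
  have block: "i \<in> {1..m-1} \<or> (\<exists>k\<in>{1..m-1}. i = m - 1 + k)" if "i \<in> {1..2*m-2}" for i
  proof (cases "i \<le> m - 1")
    case False
    then have "i = m - 1 + (i - (m - 1))" "i - (m - 1) \<in> {1..m-1}" using that by auto
    then show ?thesis by blast
  qed (use that in auto)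
  have x: "x i \<noteq> 0 \<and> x i \<noteq> 1" if "i \<in> {0..2*m-2}" for i
  proof (cases "i = 0")
    case False
    then have "i \<in> {1..2*m-2}" using that by simp
    from block[OF this] show ?thesis using q xcases by auto
  qed (use z1 xcases in simp)
  have root: "geo_moment (2*m-1) (1 / x i) = 0" if "i \<in> {1..2*m-2}" for i
    using block[OF that] roots(1) xcases by auto
  have inj: "inj_on x {1..2*m-2}"
  proof (rule inj_onI)
    fix i j assume ij: "i \<in> {1..2*m-2}" "j \<in> {1..2*m-2}" "x i = x j"
    have lt: "cmod (x k) < 1" if "k \<in> {1..m-1}" for k using roots(1)[OF that] xcases(2)[OF that] by simp
    have gt: "cmod (x (m - 1 + k)) > 1" if "k \<in> {1..m-1}" for k
      unfolding xcases(3)[OF that] using roots(1)[OF that] by (simp add: norm_divide field_simps)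
    have eq: "k = l" if "k \<in> {1..m-1}" "l \<in> {1..m-1}" "q k = q l" for k l
      using roots(2) that by (auto simp: inj_on_def)
    from block[OF ij(1)] block[OF ij(2)] show "i = j"
    proof (elim disjE bexE)
      assume "i \<in> {1..m-1}" "j \<in> {1..m-1}"
      then show ?thesis using eq ij(3) xcases(2) by simp
    next
      fix k assume "i \<in> {1..m-1}" "k \<in> {1..m-1}" "j = m - 1 + k"
      then show ?thesis using lt[of i] gt[of k] ij(3) by simp
    next
      fix k assume "k \<in> {1..m-1}" "i = m - 1 + k" "j \<in> {1..m-1}"
      then show ?thesis using lt[of j] gt[of k] ij(3) by simp
    next
      fix k l assume kl: "k \<in> {1..m-1}" "i = m - 1 + k" "l \<in> {1..m-1}" "j = m - 1 + l"
      then have "1 / q k = 1 / q l" using ij(3) xcases(3) by metis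
      then show ?thesis using eq[OF kl(1,3)] kl by simp
    qed
  qed
  have sys: "coeff_system m N \<omega> h q a b \<longleftrightarrow> moment_system m N T 1 x (weight m N K q a b)" for a b
    unfolding x_def K_def by (rule coeff_system_iff_moment_system[OF m N h q T_def z1])
  obtain w where w: "w 0 = K" "moment_system m N T 1 x w"
    using moment_system_solvable[OF m N Nm T0 x inj root] by blast
  define a where "a k = w k" for k
  \<comment> \<open>The division undoes the factor \<open>q k ^ N\<close> that \<open>weight\<close>
    attaches to the reciprocal nodes.\<close>
  define b where "b k = w (m - 1 + k) / q k ^ N" for k
  have ww: "weight m N K q a b i = w i" if "i \<in> {0..2*m-2}" for i
  proof (cases "i = 0")
    case False
    then have "i \<in> {1..2*m-2}" using that by simp
    from block[OF this] show ?thesis using q False by (auto simp: weight_def a_def b_def)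
  qed (simp add: weight_def w(1))
  have ab: "moment_system m N T 1 x (weight m N K q a b)"
    using w(2) ww unfolding moment_system_def by simp
  have unique: "\<forall>k\<in>{1..m-1}. a' k = a k \<and> b' k = b k" if "coeff_system m N \<omega> h q a' b'" for a' b'
  proof
    fix k assume k: "k \<in> {1..m-1}"
    define d where "d i = weight m N K q a' b' i - weight m N K q a b i" for i
    have "moment_system m N T 0 x d"
      unfolding d_def using that ab unfolding sys by (rule moment_system_diff)
    from moment_system_unique[OF m N Nm T0 x inj root this]
    have "\<forall>i\<in>{1..2*m-2}. d i = 0" by (simp add: d_def weight_def)
    moreover have "k \<in> {1..2*m-2}" "m - 1 + k \<in> {1..2*m-2}" using k by auto
    ultimately have "d k = 0" "d (m - 1 + k) = 0" by blast+
    moreover have "weight m N K q u v k = u k" "weight m N K q u v (m - 1 + k) = v k * q k ^ N" for u v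
      using k m by (auto simp: weight_def)
    ultimately show "a' k = a k \<and> b' k = b k" using q[OF k] by (simp add: d_def)
  qed
  define C where "C = node_coeff N T 1 J x (weight m N K q a b)"
  define P where "P = node_poly m N T 1 J x (weight m N K q a b)"
  have J: "finite J" by (simp add: J_def)
  have xJ: "x i \<noteq> 0 \<and> x i \<noteq> 1" if "i \<in> J" for i using x that by (simp add: J_def)
  have exact: "poly_exact m 0 1 N \<omega> C"
    unfolding poly_exact_iff TN[symmetric] C_def
  proof (intro allI impI)
    fix j assume j: "j < m"
    show "quad_err 1 (T * of_nat N) N (node_coeff N T 1 J x (weight m N K q a b)) (\<lambda>y. of_real (y ^ j)) = 0"
    proof (rule node_coeff_exact[OF N T0 J])
      show "x i \<noteq> 1" if "i \<in> J" for i using xJ[OF that] by blast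
      assume "j \<ge> 1"
      then show "(\<Sum>i\<in>J. weight m N K q a b i * truncated_moment N j (x i)) =
          1 * monomial_rhs N T j"
        using ab j unfolding moment_system_def J_def by simp
    qed
  qed
  have vanish: "spline 1 (2 * of_real pi * \<i> * of_real \<omega>) N m C P 0 (real \<beta> / real N) = 0" if "\<beta> \<le> N" for \<beta>
    unfolding TN[symmetric] C_def P_def
  proof (rule node_coeff_spline[OF N m T0 J xJ _ _ that])
    show "(\<Sum>i\<in>J. weight m N K q a b i * geo_moment \<alpha> (1 / x i)) = 1 * fact \<alpha> / T ^ (\<alpha> + 1)" if "\<alpha> \<in> {1..m-1}" for \<alpha>
      using ab that unfolding moment_system_def J_def by simp
    have z0: "exp T \<noteq> 0" by simp
    have S: "2 * m - 1 = Suc (2 * m - 2)" using m by simp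
    have "geo_moment (2 * m - 1) (1 / exp T) = geo_moment (2 * m - 1) (exp T)"
      unfolding S by (rule geo_moment_inverse_even[OF z0 z1]) simp
    moreover have "K * geo_moment (2 * m - 1) (exp T) = fact (2 * m - 1) / T ^ (2 * m)"
      unfolding K_def T_def by (rule K_const_geo_moment[OF m wh roots(3)[OF znorm, unfolded T_def]])
    ultimately have top: "K * geo_moment (2 * m - 1) (1 / exp T) = fact (2 * m - 1) / T ^ (2 * m)" by simp
    \<comment> \<open>At all nodes but \<open>exp T\<close> the moment of order
      \<open>2m - 1\<close> vanishes, since the \<open>q k\<close> and their reciprocals are
      roots.\<close>
    have "(\<Sum>i\<in>J. weight m N K q a b i * x i ^ \<beta> * geo_moment (2 * m - 1) (1 / x i)) =
        weight m N K q a b 0 * x 0 ^ \<beta> * geo_moment (2 * m - 1) (1 / x 0)"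
      unfolding J_def sum_split_blocks(2)[OF m] using root by simp
    also have "\<dots> = exp T ^ \<beta> * (K * geo_moment (2 * m - 1) (1 / exp T))"
      by (simp add: weight_def xcases)
    also have "\<dots> = 1 * exp (T * of_nat \<beta>) * fact (2 * m - 1) / T ^ (2 * m)"
      unfolding top by (simp add: exp_of_nat_mult[symmetric] mult.commute[of T])
    finally show "(\<Sum>i\<in>J. weight m N K q a b i * x i ^ \<beta> * geo_moment (2 * m - 1) (1 / x i)) =
        1 * exp (T * of_nat \<beta>) * fact (2 * m - 1) / T ^ (2 * m)" .
  qed
  have "degree P < m" unfolding P_def by (rule degree_node_poly[OF m])
  from spline_optimal[OF m N \<omega>0 this exact vanish]
  have opt: "sard_optimal m 0 1 N \<omega> D \<longleftrightarrow> (\<forall>\<beta>\<in>{0..N}. D \<beta> = C \<beta>)" for D .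
  have formula: "coeff_formula m N \<omega> h q a b \<beta> = C \<beta>" if "\<beta> \<in> {0..N}" for \<beta>
    using coeff_formula_eq_node_coeff[OF m N h _ q T_def, of \<beta>] that by (simp add: C_def J_def x_def K_def)
  show ?thesis
  proof (rule exI[of _ a], rule exI[of _ b], intro conjI allI impI)
    show "coeff_system m N \<omega> h q a b" unfolding sys by (rule ab)
    show "\<forall>k\<in>{1..m-1}. a' k = a k \<and> b' k = b k" if "coeff_system m N \<omega> h q a' b'" for a' b'
      by (rule unique[OF that])
    show "sard_optimal m 0 1 N \<omega> D \<longleftrightarrow> (\<forall>\<beta>\<in>{0..N}. D \<beta> = coeff_formula m N \<omega> h q a b \<beta>)" for D
      unfolding opt using formula by simp
  qed
qed

end
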